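(* Let $m\ge2$ and $f\in L^2(I)$, and let $u\in V$ be the weak solution of $-(\omega u')'=f$ in $I$, $u(\pm1)=0$, i.e. $a(u,v)=(f,v)$ for all $v\in V$; assume $u\in H^m(I)\cap H^1_{0,\omega}(I)$. For $N\ge2$ let $u_N\in V_N$ be the discrete solution, i.e. $a(u_N,v)=(f,v)$ for all $v\in V_N$. Then there is a constant $C$ independent of $N$ and $u$ such that $$\|u-u_N\|_V\le C N^{1-m}\|u\|_{H^m(I)}\qquad\text{and}\qquad \|u-u_N\|_{L^2(I)}\le C N^{-m}\|u\|_{H^m(I)}.$$
   Context: $I=(-1,1)$, $\omega(x)=\sqrt{1-x^2}$. $V=H^1_{0,\omega}(I)$ is the closure of $C_0^\infty(I)$ with respect to the norm $\big(\int_I (|u|^2+\omega|u'|^2)\,\mathrm dx\big)^{1/2}$, equipped with $\|u\|_V=\big(\int_I\omega|u'|^2\,\mathrm dx\big)^{1/2}$. $a(u,v)=\int_I\omega u'v'\,\mathrm dx$ and $(f,v)=\int_I fv\,\mathrm dx$. With $T_k$ the Chebyshev polynomial of the first kind of degree $k$, $\phi_n=T_{n+2}-T_n$ and $V_N=\mathrm{span}\{\phi_0,\dots,\phi_{N-2}\}$ (polynomials of degree $\le N$ vanishing at $\pm1$). $H^m(I)$ is the standard Sobolev space with norm $\|\cdot\|_{H^m(I)}$. *)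

theory Defs
  imports "HOL-Analysis.Analysis"
begin

definition I :: "real set" where "I = {-1<..<1}"

definition omega :: "real \<Rightarrow> real" where "omega x = sqrt (1 - x\<^sup>2)"

definition smooth :: "(real \<Rightarrow> real) \<Rightarrow> bool" where
  "smooth \<phi> \<longleftrightarrow> (\<exists>D :: nat \<Rightarrow> real \<Rightarrow> real. D 0 = \<phi> \<and>
      (\<forall>k x. (D k has_real_derivative D (Suc k) x) (at x)))"

definition test_fun :: "(real \<Rightarrow> real) \<Rightarrow> bool" where
  "test_fun \<phi> \<longleftrightarrow> smooth \<phi> \<and> (\<exists>a b. -1 < a \<and> b < 1 \<and> (\<forall>x. x \<notin> {a..b} \<longrightarrow> \<phi> x = 0))"

definition intI :: "(real \<Rightarrow> real) \<Rightarrow> real" where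
  "intI g = (LINT x:I|lborel. g x)"

definition L2 :: "(real \<Rightarrow> real) \<Rightarrow> bool" where
  "L2 u \<longleftrightarrow> set_borel_measurable lborel I u \<and> set_integrable lborel I (\<lambda>x. (u x)\<^sup>2)"

definition L2_norm :: "(real \<Rightarrow> real) \<Rightarrow> real" where
  "L2_norm u = sqrt (intI (\<lambda>x. (u x)\<^sup>2))"

definition loc_integrable :: "(real \<Rightarrow> real) \<Rightarrow> bool" where
  "loc_integrable u \<longleftrightarrow> (\<forall>a b. -1 < a \<and> b < 1 \<longrightarrow> set_integrable lborel {a..b} u)"

definition weak_deriv :: "(real \<Rightarrow> real) \<Rightarrow> (real \<Rightarrow> real) \<Rightarrow> bool" where
  "weak_deriv u g \<longleftrightarrow> loc_integrable u \<and> loc_integrable g \<and>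
     (\<forall>\<phi>. test_fun \<phi> \<longrightarrow> intI (\<lambda>x. u x * deriv \<phi> x) = - intI (\<lambda>x. g x * \<phi> x))"

definition has_weak_deriv :: "(real \<Rightarrow> real) \<Rightarrow> bool" where
  "has_weak_deriv u \<longleftrightarrow> (\<exists>g. weak_deriv u g)"

definition wderiv :: "(real \<Rightarrow> real) \<Rightarrow> real \<Rightarrow> real" where
  "wderiv u = (SOME g. weak_deriv u g)"

definition Hm :: "nat \<Rightarrow> (real \<Rightarrow> real) set" where
  "Hm m = {u. (\<forall>k<m. has_weak_deriv ((wderiv ^^ k) u)) \<and> (\<forall>k\<le>m. L2 ((wderiv ^^ k) u))}"

definition Hm_norm :: "nat \<Rightarrow> (real \<Rightarrow> real) \<Rightarrow> real" where
  "Hm_norm m u = sqrt (\<Sum>k\<le>m. intI (\<lambda>x. ((wderiv ^^ k) u x)\<^sup>2))"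

definition V :: "(real \<Rightarrow> real) set" where
  "V = {u. L2 u \<and> has_weak_deriv u \<and>
          set_integrable lborel I (\<lambda>x. omega x * (wderiv u x)\<^sup>2) \<and>
          (\<exists>\<phi> :: nat \<Rightarrow> real \<Rightarrow> real. (\<forall>n. test_fun (\<phi> n)) \<and>
             (\<lambda>n. intI (\<lambda>x. (u x - \<phi> n x)\<^sup>2 + omega x * (wderiv u x - deriv (\<phi> n) x)\<^sup>2))
               \<longlonglongrightarrow> 0)}"

definition V_norm :: "(real \<Rightarrow> real) \<Rightarrow> real" where
  "V_norm u = sqrt (intI (\<lambda>x. omega x * (wderiv u x)\<^sup>2))"

definition a :: "(real \<Rightarrow> real) \<Rightarrow> (real \<Rightarrow> real) \<Rightarrow> real" where
  "a u v = intI (\<lambda>x. omega x * wderiv u x * wderiv v x)"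

definition pairing :: "(real \<Rightarrow> real) \<Rightarrow> (real \<Rightarrow> real) \<Rightarrow> real" where
  "pairing f v = intI (\<lambda>x. f x * v x)"

fun cheb :: "nat \<Rightarrow> real \<Rightarrow> real" where
  "cheb 0 x = 1"
| "cheb (Suc 0) x = x"
| "cheb (Suc (Suc n)) x = 2 * x * cheb (Suc n) x - cheb n x"

definition phi :: "nat \<Rightarrow> real \<Rightarrow> real" where
  "phi n x = cheb (n + 2) x - cheb n x"

definition VN :: "nat \<Rightarrow> (real \<Rightarrow> real) set" where
  "VN N = {v. \<exists>c :: nat \<Rightarrow> real. v = (\<lambda>x. \<Sum>n\<le>N - 2. c n * phi n x)}"

end

theory Submission
  imports Defs
begin

text \<open>
  Put \<open>x = cos \<theta>\<close>. The derivatives \<open>T\<^sub>k' = k U\<^bsub>k-1\<^esub>\<close> are orthogonal with weight \<open>\<omega>\<close>, so for the error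
  \<open>e = u - u\<^sub>N\<close> everything can be read off the numbers \<open>z\<^sub>k = \<integral> \<omega> e' U\<^bsub>k-1\<^esub>\<close>. Testing with \<open>\<phi>\<^sub>n\<close> gives
  \<open>(n + 2) z\<^bsub>n+2\<^esub> = n z\<^sub>n\<close>: up to \<open>N\<close> the even coefficients vanish and the odd ones are \<open>\<lambda>/k\<close>, while beyond
  \<open>N\<close> they are those of \<open>u\<close>. The boundary condition fixes \<open>\<lambda>\<close> in terms of the sums
  \<open>\<Sum>\<^bsub>k>N\<^esub> T\<^sub>k(\<plusminus>1) z\<^sub>k / k\<close>.

  A duality argument would lose half a power of \<open>N\<close> for the \<open>L\<^sup>2\<close> error, because the dual solution need
  only behave like \<open>\<omega>\<close> at the endpoints. Instead these endpoint sums are bounded by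
  summation by parts: \<open>z\<^sub>k\<close> is the difference \<open>(d\<^bsub>k-1\<^esub> - d\<^bsub>k+1\<^esub>)/2\<close> where \<open>k d\<^sub>k\<close> is the corresponding
  coefficient of \<open>u''\<close>, so a pointwise bound on \<open>d\<^sub>k\<close> already yields \<open>O(N\<^bsup>-m\<^esup>)\<close>. The same
  recurrence, iterated \<open>m - 1\<close> times and combined with Bessel's inequality for the \<open>m\<close>-th weak derivative,
  bounds the tail \<open>\<Sum>\<^bsub>k>N\<^esub> z\<^sub>k\<^sup>2\<close>.
\<close>

subsection \<open>Smooth functions and cut-offs\<close>

text \<open>Each \<open>phi n\<close> is a difference of Chebyshev polynomials two degrees apart, so
  testing only links coefficients of equal parity. The even chain starts at \<open>T_0\<close>,
  whose factor 0 annihilates it; the odd chain starts at \<open>T_1\<close>, which no test function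
  isolates, and this leaves the free parameter \<lambda>. Only the equality of both endpoint values
  can fix it, but elements of \<open>V\<close> have no endpoint values by definition. The condition
  is therefore recovered as a limit over partial Chebyshev sums: \<open>1/omega\<close> is
  integrable, so the energy norm controls the integral of the derivative. Convergence of these sums
  rests on density of polynomials vanishing at the endpoints, whose expansions are finite, and on
  best approximation. The extra power of N in the \<open>L^2\<close> bound has two sources: for the
  tail, the coefficients of the error are those of its derivative divided by k > N; for the head,
  the summation by parts. Plain \<open>L^2\<close> norms are dominated by those with weight
  \<open>1/omega\<close>, at least 1, for which the \<open>T_k\<close> are orthogonal. Integration
  by parts is done only against functions vanishing at both endpoints, so endpoint values of
  derivatives of u never enter.\<close>

lemma smooth_coinduct:
  assumes "f \<in> S" "\<And>f. f \<in> S \<Longrightarrow> \<exists>f'\<in>S. \<forall>x. (f has_real_derivative f' x) (at x)"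
  shows "smooth f"
proof -
  \<comment> \<open>Choosing one derivative inside \<open>S\<close> for each member turns
    differentiation into a map on \<open>S\<close>; its iterates are the tower of derivatives that
    \<open>smooth\<close> asks for.\<close>
  obtain d where d: "\<And>f. f \<in> S \<Longrightarrow> d f \<in> S \<and> (\<forall>x. (f has_real_derivative d f x) (at x))"
    using assms(2) by metis
  have S: "(d ^^ k) f \<in> S" for k by (induct k) (auto simp: assms(1) d)
  show ?thesis unfolding smooth_def
    by (rule exI[of _ "\<lambda>k. (d ^^ k) f"]) (use d S in auto)
qed

lemma smooth_deriv:
  assumes "smooth f"
  obtains f' where "smooth f'" "\<And>x. (f has_real_derivative f' x) (at x)"
proof -
  obtain D where D: "D 0 = f" "\<And>k x. (D k has_real_derivative D (Suc k) x) (at x)"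
    using assms by (auto simp: smooth_def)
  have "smooth (D 1)" unfolding smooth_def
    by (rule exI[of _ "\<lambda>k. D (Suc k)"]) (auto simp: D)
  then show ?thesis using that[of "D 1"] D(2)[of 0] D(1) by simp
qed

lemma smooth_antideriv:
  assumes "smooth f'" "\<And>x. (f has_real_derivative f' x) (at x)"
  shows "smooth f"
proof (rule smooth_coinduct[where S="insert f {g. smooth g}"])
  fix g assume "g \<in> insert f {g. smooth g}"
  then show "\<exists>f'\<in>insert f {g. smooth g}. \<forall>x. (g has_real_derivative f' x) (at x)"
    using assms by (metis insert_iff mem_Collect_eq smooth_deriv)
qed simp

text \<open>Products alone are not closed under differentiation, but sums of products are, by the
  Leibniz rule. This is the invariant set for \<open>smooth_mult\<close>.\<close>

inductive_set prod_span :: "(real \<Rightarrow> real) set" where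
  prod: "smooth f \<Longrightarrow> smooth g \<Longrightarrow> (\<lambda>x. f x * g x) \<in> prod_span"
| plus: "f \<in> prod_span \<Longrightarrow> g \<in> prod_span \<Longrightarrow> (\<lambda>x. f x + g x) \<in> prod_span"

lemma smooth_mult:
  assumes "smooth f" "smooth g"
  shows "smooth (\<lambda>x. f x * g x)"
proof (rule smooth_coinduct[where S=prod_span])
  fix h assume "h \<in> prod_span"
  then show "\<exists>h'\<in>prod_span. \<forall>x. (h has_real_derivative h' x) (at x)"
  proof induction
    case (prod f g)
    obtain f' g' where *: "smooth f'" "smooth g'" "\<And>x. (f has_real_derivative f' x) (at x)"
       "\<And>x. (g has_real_derivative g' x) (at x)"
      using prod smooth_deriv by metis
    have "(\<lambda>x. f' x * g x + f x * g' x) \<in> prod_span"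
      by (intro prod_span.intros * prod)
    moreover have "((\<lambda>x. f x * g x) has_real_derivative f' x * g x + f x * g' x) (at x)" for x
      by (auto intro!: derivative_eq_intros *)
    ultimately show ?case by (intro bexI) auto
  next
    case (plus f g)
    then obtain f' g' where *: "f' \<in> prod_span" "g' \<in> prod_span"
       "\<And>x. (f has_real_derivative f' x) (at x)" "\<And>x. (g has_real_derivative g' x) (at x)"
      by metis
    have "(\<lambda>x. f' x + g' x) \<in> prod_span"
      by (intro prod_span.intros *)
    moreover have "((\<lambda>x. f x + g x) has_real_derivative f' x + g' x) (at x)" for x
      by (auto intro!: derivative_eq_intros *)
    ultimately show ?case by (intro bexI) auto
  qed
qed (intro prod_span.prod assms)

lemma smooth_const [simp]: "smooth (\<lambda>x. c)"
proof (rule smooth_coinduct[where S="range (\<lambda>c x. c)"])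
  fix f :: "real \<Rightarrow> real" assume "f \<in> range (\<lambda>c x. c)"
  then show "\<exists>f'\<in>range (\<lambda>c x. c). \<forall>x. (f has_real_derivative f' x) (at x)"
    by (intro bexI[of _ "\<lambda>x. 0"]) auto
qed auto

lemma smooth_cmult: "smooth f \<Longrightarrow> smooth (\<lambda>x. c * f x)"
  by (intro smooth_mult smooth_const)

lemma smooth_affine:
  assumes "smooth f"
  shows "smooth (\<lambda>x. f (c * x + d))"
\<comment> \<open>The prefactor \<open>e\<close> absorbs the powers of \<open>c\<close> produced by
  the chain rule.\<close>
proof (rule smooth_coinduct[where S="{\<lambda>x. e * f (c * x + d) | e f. smooth f}"])
  fix g assume "g \<in> {\<lambda>x. e * f (c * x + d) | e f. smooth f}"
  then obtain e f where g: "g = (\<lambda>x. e * f (c * x + d))" "smooth f" by auto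
  obtain f' where f': "smooth f'" "\<And>x. (f has_real_derivative f' x) (at x)"
    using smooth_deriv[OF g(2)] by metis
  have "(g has_real_derivative (e * c) * f' (c * x + d)) (at x)" for x
    unfolding g by (auto intro!: derivative_eq_intros DERIV_chain2[of f] f')
  then show "\<exists>f'\<in>{\<lambda>x. e * f (c * x + d) | e f. smooth f}. \<forall>x. (g has_real_derivative f' x) (at x)"
    using f'(1) by (intro bexI[of _ "\<lambda>x. (e * c) * f' (c * x + d)"]) blast+
next
  show "(\<lambda>x. f (c * x + d)) \<in> {\<lambda>x. e * f (c * x + d) | e f. smooth f}"
    using assms by (auto intro!: exI[of _ 1] exI[of _ f])
qed

lemma smooth_polynomial:
  assumes "real_polynomial_function p"
  shows "smooth p"
proof (rule smooth_coinduct[where S="{p. real_polynomial_function p}"])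
  fix f :: "real \<Rightarrow> real" assume "f \<in> {p. real_polynomial_function p}"
  then show "\<exists>f'\<in>{p. real_polynomial_function p}. \<forall>x. (f has_real_derivative f' x) (at x)"
    using has_real_derivative_polynomial_function by (metis mem_Collect_eq)
qed (use assms in auto)

text \<open>For \<open>t > 0\<close> the substitution \<open>s = 1/t\<close> turns \<open>d/dt\<close> into \<open>- s\<^sup>2 d/ds\<close>, so the family
  \<open>q(1/t) exp(-1/t)\<close> with \<open>q\<close> polynomial is closed under differentiation.\<close>
definition flat_exp :: "(real \<Rightarrow> real) \<Rightarrow> real \<Rightarrow> real" where
  "flat_exp q t = (if t > 0 then q (1/t) * exp (- (1/t)) else 0)"

lemma polynomial_exp_limit:
  assumes "real_polynomial_function q"
  shows "((\<lambda>s. q s * exp (- s)) \<longlongrightarrow> 0) at_top"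
proof -
  obtain c n where q: "q = (\<lambda>x. \<Sum>i\<le>n. c i * x^i)"
    using assms real_polynomial_function_iff_sum by auto
  have "((\<lambda>s::real. \<Sum>i\<le>n. c i * (s^i / exp s)) \<longlongrightarrow> (\<Sum>i\<le>n. c i * 0)) at_top"
    by (intro tendsto_intros tendsto_power_div_exp_0)
  then show ?thesis
    by (simp add: q sum_distrib_right exp_minus field_simps sum_divide_distrib)
qed

lemma smooth_flat_exp:
  assumes "real_polynomial_function q"
  shows "smooth (flat_exp q)"
proof (rule smooth_coinduct[where S="flat_exp ` {q. real_polynomial_function q}"])
  fix f assume "f \<in> flat_exp ` {q. real_polynomial_function q}"
  then obtain q where q: "real_polynomial_function q" "f = flat_exp q" by auto
  obtain q' where q': "real_polynomial_function q'" "\<And>x. (q has_real_derivative q' x) (at x)"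
    using has_real_derivative_polynomial_function[OF q(1)] by metis
  \<comment> \<open>Applying \<open>- s^2 d/ds\<close> to \<open>q(s) exp(-s)\<close> gives
    \<open>s^2 (q(s) - q'(s)) exp(-s)\<close>.\<close>
  define r where "r = (\<lambda>s. s^2 * (q s + (-1) * q' s))"
  have id: "real_polynomial_function (\<lambda>s::real. s)"
    by (rule real_polynomial_function.intros(1)) simp
  have r: "real_polynomial_function r"
    unfolding r_def by (intro real_polynomial_function.intros(2-) real_polynomial_function_power id q q')
  have "(flat_exp q has_real_derivative flat_exp r x) (at x)" for x
  proof -
    consider "x > 0" | "x < 0" | "x = 0" by linarith
    then show ?thesis
    proof cases
      case 1
      have "((\<lambda>t. q (1/t) * exp (- (1/t))) has_real_derivative flat_exp r x) (at x)"
        using 1 unfolding flat_exp_def r_def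
        by (auto intro!: derivative_eq_intros DERIV_chain2[OF q'(2)] simp: field_simps power2_eq_square)
      then show ?thesis
        by (rule has_field_derivative_transform_within_open[where S="{0<..}"])
           (use 1 in \<open>auto simp: flat_exp_def\<close>)
    next
      case 2
      have "((\<lambda>t. 0) has_real_derivative flat_exp r x) (at x)"
        using 2 by (auto simp: flat_exp_def)
      then show ?thesis
        by (rule has_field_derivative_transform_within_open[where S="{..<0}"])
           (use 2 in \<open>auto simp: flat_exp_def\<close>)
    next
      case 3
      \<comment> \<open>With \<open>s = 1/h\<close>, the difference quotient at 0 from the right is
        \<open>s q(s) exp(-s)\<close>, again a polynomial times a decaying exponential.\<close>
      have "((\<lambda>s. (s * q s) * exp (- s)) \<longlongrightarrow> 0) at_top"
        by (intro polynomial_exp_limit real_polynomial_function.intros(2-) id q)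
      then have "((\<lambda>h. (inverse h * q (inverse h)) * exp (- inverse h)) \<longlongrightarrow> 0) (at_right 0)"
        by (rule filterlim_compose[OF _ filterlim_inverse_at_top_right])
      then have R: "((\<lambda>h. flat_exp q h / h) \<longlongrightarrow> 0) (at_right 0)"
        by (rule Lim_transform_eventually)
           (auto simp: flat_exp_def eventually_at_filter field_simps)
      have L: "((\<lambda>h. flat_exp q h / h) \<longlongrightarrow> 0) (at_left 0)"
        by (rule tendsto_eventually) (auto simp: flat_exp_def eventually_at_filter)
      have "((\<lambda>h. flat_exp q h / h) \<longlongrightarrow> 0) (at 0)"
        by (rule filterlim_split_at[OF L R])
      then show ?thesis
        unfolding has_field_derivative_iff 3 by (simp add: flat_exp_def)
    qed
  qed
  then show "\<exists>f'\<in>flat_exp ` {q. real_polynomial_function q}. \<forall>x. (f has_real_derivative f' x) (at x)"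
    using r q(2) by auto
qed (use assms in auto)

text \<open>The step is the normalised integral of a bump supported in [0,1]. Continuity and support
  of \<open>B'\<close> are recorded because \<open>polynomial_test_approx\<close> has to bound the
  derivative of a cut-off.\<close>

lemma smooth_step:
  obtains B B' where "smooth B" "\<And>t. t \<le> 0 \<Longrightarrow> B t = 0" "\<And>t. t \<ge> 1 \<Longrightarrow> B t = 1"
    "\<And>t. 0 \<le> B t" "\<And>t. B t \<le> 1" "\<And>t. (B has_real_derivative B' t) (at t)" "continuous_on UNIV B'"
    "\<And>t. t \<notin> {0..1} \<Longrightarrow> B' t = 0"
proof -
  define \<rho> where "\<rho> t = flat_exp (\<lambda>_. 1) t * flat_exp (\<lambda>_. 1) ((-1) * t + 1)" for t
  have sm: "smooth \<rho>" unfolding \<rho>_def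
    by (intro smooth_mult smooth_affine smooth_flat_exp real_polynomial_function.intros)
  obtain \<rho>' where "\<And>x. (\<rho> has_real_derivative \<rho>' x) (at x)"
    using smooth_deriv[OF sm] by metis
  then have cont: "continuous_on S \<rho>" for S
    by (meson DERIV_atLeastAtMost_imp_continuous_on DERIV_isCont continuous_at_imp_continuous_on)
  have nonneg: "\<rho> t \<ge> 0" and pos: "0 < t \<Longrightarrow> t < 1 \<Longrightarrow> \<rho> t > 0" and zero: "t \<le> 0 \<or> t \<ge> 1 \<Longrightarrow> \<rho> t = 0" for t
    by (auto simp: \<rho>_def flat_exp_def)
  define c where "c = integral {0..1} \<rho>"
  have int: "\<rho> integrable_on {s..t}" for s t by (rule integrable_continuous_real[OF cont])
  have c: "c > 0"
  proof -
    have "c \<ge> 0" unfolding c_def by (rule integral_nonneg[OF int nonneg])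
    moreover have "c \<noteq> 0"
    proof
      assume "c = 0"
      then have "(\<rho> has_integral 0) {0..1}"
        using int[of 0 1] by (simp add: c_def has_integral_integral)
      then have "\<rho> (1/2) = 0"
        using has_integral_0_cbox_imp_0[of 0 1 \<rho> "1/2"] cont nonneg by simp
      then show False using pos[of "1/2"] by simp
    qed
    ultimately show ?thesis by simp
  qed
  \<comment> \<open>Starting the integral at -1 instead of 0 makes 0 an interior point, so the
    two-sided derivative there comes from the fundamental theorem.\<close>
  define F where "F t = (if t \<ge> -1 then integral {-1..t} \<rho> else 0)" for t :: real
  have F0: "F t = 0" if "t \<le> 0" for t
  proof -
    have "integral {-1..t} \<rho> = integral {-1..t} (\<lambda>x. 0)"
      by (rule integral_cong) (use that zero in auto)
    then show ?thesis by (simp add: F_def)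
  qed
  have F01: "F t = integral {0..t} \<rho>" if "t \<ge> 0" for t
    using Henstock_Kurzweil_Integration.integral_combine[OF _ that int, of "-1"] F0[of 0] that by (simp add: F_def)
  have Fmono: "F s \<le> F t" if "0 \<le> s" "s \<le> t" for s t
    using that F01 by (auto intro!: integral_subset_le int nonneg)
  have F1: "F t = c" if "t \<ge> 1" for t
  proof -
    have "integral {1..t} \<rho> = integral {1..t} (\<lambda>x. 0)"
      by (rule integral_cong) (use that zero in auto)
    then show ?thesis
      using Henstock_Kurzweil_Integration.integral_combine[OF _ that int, of 0] F01[of t] that by (simp add: c_def)
  qed
  have dF: "(F has_real_derivative \<rho> t) (at t)" for t
  proof (cases "t > -1")
    case True
    have "((\<lambda>t. integral {-1..t} \<rho>) has_real_derivative \<rho> t) (at t within {-1..t+1})"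
      by (rule integral_has_real_derivative[OF cont]) (use True in auto)
    then have "((\<lambda>t. integral {-1..t} \<rho>) has_real_derivative \<rho> t) (at t)"
      using True by (simp add: at_within_Icc_at)
    then show ?thesis
      by (rule has_field_derivative_transform_within_open[where S="{-1<..}"])
         (use True in \<open>auto simp: F_def\<close>)
  next
    case False
    have "((\<lambda>t. 0) has_real_derivative \<rho> t) (at t)" using False zero by simp
    then show ?thesis
      by (rule has_field_derivative_transform_within_open[where S="{..<0}"])
         (use False F0 in auto)
  qed
  show ?thesis
  proof (rule that[of "\<lambda>t. (1/c) * F t" "\<lambda>t. (1/c) * \<rho> t"])
    show "smooth (\<lambda>t. (1/c) * F t)"
      by (intro smooth_cmult smooth_antideriv[OF sm dF])
    show "(1/c) * F t = 0" if "t \<le> 0" for t using F0 that by simp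
    show "(1/c) * F t = 1" if "t \<ge> 1" for t using F1 that c by simp
    show "0 \<le> (1/c) * F t" for t
      using Fmono[of 0 t] F0[of 0] F0[of t] c by (cases "t \<ge> 0") auto
    show "(1/c) * F t \<le> 1" for t
      using Fmono[of t "max t 1"] F1[of "max t 1"] F0[of t] c by (cases "t \<ge> 0") (auto simp: field_simps)
    show "((\<lambda>t. (1/c) * F t) has_real_derivative (1/c) * \<rho> t) (at t)" for t
      by (intro DERIV_cmult dF)
    show "continuous_on UNIV (\<lambda>t. (1/c) * \<rho> t)" by (intro continuous_intros cont)
    show "(1/c) * \<rho> t = 0" if "t \<notin> {0..1}" for t using that zero[of t] by auto
  qed
qed

subsection \<open>Square integrable functions\<close>

definition sq_int :: "'a measure \<Rightarrow> ('a \<Rightarrow> real) \<Rightarrow> bool" where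
  "sq_int M f \<longleftrightarrow> f \<in> borel_measurable M \<and> integrable M (\<lambda>x. (f x)\<^sup>2)"

definition nrm :: "'a measure \<Rightarrow> ('a \<Rightarrow> real) \<Rightarrow> real" where
  "nrm M f = sqrt (\<integral>x. (f x)\<^sup>2 \<partial>M)"

lemma sq_int_measurable: "sq_int M f \<Longrightarrow> f \<in> borel_measurable M"
  by (simp add: sq_int_def)

lemma sq_int_square: "sq_int M f \<Longrightarrow> integrable M (\<lambda>x. (f x)\<^sup>2)"
  by (simp add: sq_int_def)

lemma sq_int_mult:
  assumes "sq_int M f" "sq_int M g"
  shows "integrable M (\<lambda>x. f x * g x)"
proof (rule Bochner_Integration.integrable_bound)
  show "integrable M (\<lambda>x. (f x)\<^sup>2 + (g x)\<^sup>2)"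
    using assms by (auto simp: sq_int_def)
  show "(\<lambda>x. f x * g x) \<in> borel_measurable M"
    using assms by (auto simp: sq_int_def)
  have "\<bar>f x * g x\<bar> \<le> (f x)\<^sup>2 + (g x)\<^sup>2" for x
  proof -
    have "2 * \<bar>f x\<bar> * \<bar>g x\<bar> \<le> \<bar>f x\<bar>\<^sup>2 + \<bar>g x\<bar>\<^sup>2" by (rule sum_squares_bound)
    moreover have "0 \<le> \<bar>f x\<bar> * \<bar>g x\<bar>" by simp
    ultimately show ?thesis unfolding abs_mult power2_abs by linarith
  qed
  then show "AE x in M. norm (f x * g x) \<le> norm ((f x)\<^sup>2 + (g x)\<^sup>2)"
    by (auto intro!: AE_I2 intro: order_trans)
qed

lemma sq_int_add: "sq_int M f \<Longrightarrow> sq_int M g \<Longrightarrow> sq_int M (\<lambda>x. f x + g x)"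
  using sq_int_mult[of M f g] by (auto simp: sq_int_def power2_sum mult.assoc)

lemma sq_int_cmult: "sq_int M f \<Longrightarrow> sq_int M (\<lambda>x. c * f x)"
  by (auto simp: sq_int_def power_mult_distrib)

lemma sq_int_diff: "sq_int M f \<Longrightarrow> sq_int M g \<Longrightarrow> sq_int M (\<lambda>x. f x - g x)"
  using sq_int_add[of M f "\<lambda>x. (-1) * g x"] sq_int_cmult[of M g "-1"] by simp

lemma sq_int_zero: "sq_int M (\<lambda>x. 0)"
  by (simp add: sq_int_def)

lemma sq_int_sum: "(\<And>i. i \<in> A \<Longrightarrow> sq_int M (f i)) \<Longrightarrow> sq_int M (\<lambda>x. \<Sum>i\<in>A. f i x)"
  by (induct A rule: infinite_finite_induct) (auto intro: sq_int_zero sq_int_add)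

lemma nrm_nonneg [simp]: "0 \<le> nrm M f"
  by (simp add: nrm_def)

lemma nrm_square: "(nrm M f)\<^sup>2 = (\<integral>x. (f x)\<^sup>2 \<partial>M)"
  by (simp add: nrm_def)

lemma nrm_cmult: "nrm M (\<lambda>x. c * f x) = \<bar>c\<bar> * nrm M f"
  by (simp add: nrm_def power_mult_distrib real_sqrt_mult)

lemma nrm_cong_AE:
  assumes "f \<in> borel_measurable M" "g \<in> borel_measurable M" "AE x in M. f x = g x"
  shows "nrm M f = nrm M g"
  unfolding nrm_def by (intro arg_cong[of _ _ sqrt] integral_cong_AE) (use assms in auto)

lemma Cauchy_Schwarz_integral:
  assumes f: "sq_int M f" and g: "sq_int M g"
  shows "\<bar>\<integral>x. f x * g x \<partial>M\<bar> \<le> nrm M f * nrm M g"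
proof -
  \<comment> \<open>Young's inequality with a free weight \<open>t\<close>; optimising
    \<open>t\<close> afterwards gives Cauchy-Schwarz.\<close>
  have *: "2 * (\<integral>x. f x * g x \<partial>M) \<le> t * (nrm M f)\<^sup>2 + (nrm M g)\<^sup>2 / t" if "t > 0" "sq_int M f" for t f
  proof -
    have "2 * (f x * g x) \<le> t * (f x)\<^sup>2 + (g x)\<^sup>2 / t" for x
    proof -
      have "0 \<le> (t * f x - g x)\<^sup>2 / t" using that by simp
      then show ?thesis using that by (simp add: power2_diff field_simps power2_eq_square)
    qed
    then have "(\<integral>x. 2 * (f x * g x) \<partial>M) \<le> (\<integral>x. t * (f x)\<^sup>2 + (g x)\<^sup>2 / t \<partial>M)"
      using that g by (intro integral_mono) (auto intro!: sq_int_mult simp: sq_int_square)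
    then show ?thesis using that g by (simp add: nrm_square sq_int_square)
  qed
  have le: "(\<integral>x. f x * g x \<partial>M) \<le> nrm M f * nrm M g" if f: "sq_int M f" for f
  proof (rule field_le_epsilon)
    fix e :: real assume e: "e > 0"
    define F where "F = nrm M f" define G where "G = nrm M g"
    have FG: "F \<ge> 0" "G \<ge> 0" by (auto simp: F_def G_def)
    define d where "d = e / (F + G + e + 1)"
    have d: "d > 0" using FG e by (auto simp: d_def)
    have "d * (F + G + d) \<le> e"
    proof -
      have "d \<le> e" using FG e by (simp add: d_def divide_simps) 
      then have "d * (F + G + d) \<le> d * (F + G + e + 1)" using d by (intro mult_left_mono) auto
      also have "\<dots> = e" using FG e by (simp add: d_def)
      finally show ?thesis .
    qed
    \<comment> \<open>The optimal weight is \<open>G / F\<close>; the shift by \<open>d\<close>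
      keeps it defined and positive when a norm vanishes and costs at most
      \<open>d * (F + G + d)\<close>.\<close>
    define t where "t = (G + d) / (F + d)"
    have t: "t > 0" using FG d by (simp add: t_def)
    have "t * F\<^sup>2 \<le> (G + d) * (F + d)"
    proof -
      have "F\<^sup>2 \<le> (F + d)\<^sup>2" using FG d by (intro power_mono) auto
      then have "t * F\<^sup>2 \<le> t * (F + d)\<^sup>2" using t by simp
      also have "\<dots> = (G + d) * (F + d)" using FG d by (simp add: t_def power2_eq_square)
      finally show ?thesis .
    qed
    moreover have "G\<^sup>2 / t \<le> (G + d) * (F + d)"
    proof -
      have "G\<^sup>2 \<le> (G + d)\<^sup>2" using FG d by (intro power_mono) auto
      then have "G\<^sup>2 / t \<le> (G + d)\<^sup>2 / t" using t by (intro divide_right_mono) auto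
      also have "\<dots> = (G + d) * (F + d)" using FG d by (simp add: t_def power2_eq_square)
      finally show ?thesis .
    qed
    ultimately have "(\<integral>x. f x * g x \<partial>M) \<le> (G + d) * (F + d)"
      using *[OF t f] by (simp add: F_def G_def)
    also have "\<dots> = F * G + d * (F + G + d)" by (simp add: algebra_simps)
    finally show "(\<integral>x. f x * g x \<partial>M) \<le> nrm M f * nrm M g + e"
      using \<open>d * (F + G + d) \<le> e\<close> by (simp add: F_def G_def)
  qed
  have "- (\<integral>x. f x * g x \<partial>M) = (\<integral>x. (-1 * f x) * g x \<partial>M)" by simp
  also have "\<dots> \<le> nrm M f * nrm M g"
    using le[OF sq_int_cmult[OF f, of "-1"]] nrm_cmult[of M "-1" f] by simp
  finally show ?thesis using le[OF f] by simp
qed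

lemma nrm_triangle:
  assumes f: "sq_int M f" and g: "sq_int M g"
  shows "nrm M (\<lambda>x. f x + g x) \<le> nrm M f + nrm M g"
proof (rule power2_le_imp_le)
  have "(nrm M (\<lambda>x. f x + g x))\<^sup>2 = (\<integral>x. (f x)\<^sup>2 + (g x)\<^sup>2 + 2 * (f x * g x) \<partial>M)"
    by (simp add: nrm_square power2_sum mult.assoc)
  also have "\<dots> = (nrm M f)\<^sup>2 + (nrm M g)\<^sup>2 + 2 * (\<integral>x. f x * g x \<partial>M)"
    using f g sq_int_mult[OF f g] by (simp add: nrm_square sq_int_square)
  also have "\<dots> \<le> (nrm M f)\<^sup>2 + (nrm M g)\<^sup>2 + 2 * (nrm M f * nrm M g)"
    using Cauchy_Schwarz_integral[OF f g] by simp
  finally show "(nrm M (\<lambda>x. f x + g x))\<^sup>2 \<le> (nrm M f + nrm M g)\<^sup>2"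
    by (simp add: power2_sum)
qed auto

lemma nrm_minus_commute: "nrm M (\<lambda>x. f x - g x) = nrm M (\<lambda>x. g x - f x)"
  by (simp add: nrm_def power2_commute)

lemma nrm_triangle_diff:
  assumes f: "sq_int M f" and g: "sq_int M g"
  shows "nrm M (\<lambda>x. f x - g x) \<le> nrm M f + nrm M g"
  using nrm_triangle[OF f sq_int_cmult[OF g, of "-1"]] nrm_cmult[of M "-1" g] by simp

lemma nrm_triangle3:
  assumes "sq_int M f" "sq_int M g" "sq_int M h"
  shows "nrm M (\<lambda>x. f x - h x) \<le> nrm M (\<lambda>x. f x - g x) + nrm M (\<lambda>x. g x - h x)"
  using nrm_triangle[OF sq_int_diff[OF assms(1,2)] sq_int_diff[OF assms(2,3)]] by simp

subsection \<open>Lebesgue measure on the interval\<close>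

abbreviation \<mu> :: "real measure" where "\<mu> \<equiv> restrict_space lborel I"

lemma I_sets [simp, measurable]: "I \<in> sets borel" "I \<inter> space lborel \<in> sets lborel"
  by (auto simp: I_def)

lemma space_\<mu> [simp]: "space \<mu> = I"
  by (simp add: space_restrict_space)

lemma intI_eq: "intI g = integral\<^sup>L \<mu> g"
  by (simp add: intI_def set_lebesgue_integral_def integral_restrict_space)

lemma set_integrable_\<mu>: "set_integrable lborel I f \<longleftrightarrow> integrable \<mu> f"
  for f :: "real \<Rightarrow> real"
  using integrable_restrict_space[OF I_sets(2), of f] unfolding set_integrable_def by blast

lemma measurable_\<mu>: "set_borel_measurable lborel I f \<longleftrightarrow> f \<in> borel_measurable \<mu>"
  for f :: "real \<Rightarrow> real"
  using borel_measurable_restrict_space_iff[OF I_sets(2), of f] unfolding set_borel_measurable_def by blast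

lemma L2_eq: "L2 u \<longleftrightarrow> sq_int \<mu> u"
  by (simp add: L2_def sq_int_def measurable_\<mu> set_integrable_\<mu>)

lemma L2_norm_eq: "L2_norm u = nrm \<mu> u"
  by (simp add: L2_norm_def nrm_def intI_eq)

lemma AE_\<mu>: "(AE x in \<mu>. P x) \<longleftrightarrow> (AE x in lborel. x \<in> I \<longrightarrow> P x)"
  by (rule AE_restrict_space_iff) simp

lemma emeasure_\<mu>: "emeasure \<mu> I = 2"
  by (simp add: emeasure_restrict_space I_def)

lemma finite_measure_\<mu>: "finite_measure \<mu>"
  by (rule finite_measureI) (simp add: emeasure_\<mu>)

lemma measure_\<mu>: "measure \<mu> I = 2"
  by (simp add: measure_def emeasure_\<mu>)

lemma continuous_imp_measurable_\<mu>:
  "continuous_on I f \<Longrightarrow> f \<in> borel_measurable \<mu>"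
  for f :: "real \<Rightarrow> real"
  using borel_measurable_continuous_on_restrict[of I f]
  by (metis measurable_cong_sets sets_restrict_space_cong sets_lborel)

lemma bounded_integrable_\<mu>:
  fixes f :: "real \<Rightarrow> real"
  assumes "f \<in> borel_measurable \<mu>" "\<And>x. x \<in> I \<Longrightarrow> \<bar>f x\<bar> \<le> B"
  shows "integrable \<mu> f"
  by (rule finite_measure.integrable_const_bound[OF finite_measure_\<mu>, of f B])
     (use assms in auto)

lemma bounded_sq_int_\<mu>:
  fixes f :: "real \<Rightarrow> real"
  assumes "f \<in> borel_measurable \<mu>" "\<And>x. x \<in> I \<Longrightarrow> \<bar>f x\<bar> \<le> B"
  shows "sq_int \<mu> f"
  unfolding sq_int_def
proof
  show "integrable \<mu> (\<lambda>x. (f x)\<^sup>2)"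
  proof (rule bounded_integrable_\<mu>[of _ "B\<^sup>2"])
    fix x assume "x \<in> I"
    then show "\<bar>(f x)\<^sup>2\<bar> \<le> B\<^sup>2"
      using power_mono[OF assms(2)[of x], of 2] by simp
  qed (use assms in auto)
qed (use assms in auto)

lemma nrm_le_sup:
  fixes f :: "real \<Rightarrow> real"
  assumes "f \<in> borel_measurable \<mu>" "\<And>x. x \<in> I \<Longrightarrow> \<bar>f x\<bar> \<le> B"
  shows "nrm \<mu> f \<le> 2 * B"
proof (rule power2_le_imp_le)
  have B: "B \<ge> 0" using assms(2)[of 0] by (auto simp: I_def)
  have "(\<integral>x. (f x)\<^sup>2 \<partial>\<mu>) \<le> (\<integral>x. B\<^sup>2 \<partial>\<mu>)"
  proof (rule integral_mono)
    show "(f x)\<^sup>2 \<le> B\<^sup>2" if "x \<in> space \<mu>" for x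
      using power_mono[OF assms(2)[of x], of 2] that by simp
  qed (use bounded_sq_int_\<mu>[of f B] assms in \<open>auto simp: sq_int_def finite_measure.integrable_const[OF finite_measure_\<mu>]\<close>)
  also have "\<dots> = 2 * B\<^sup>2" by (simp add: measure_\<mu>)
  \<comment> \<open>The length 2 of the interval contributes the factor sqrt 2, rounded up to
    2.\<close>
  also have "\<dots> \<le> (2 * B)\<^sup>2" by (simp add: power_mult_distrib)
  finally show "(nrm \<mu> f)\<^sup>2 \<le> (2 * B)\<^sup>2"
    unfolding nrm_square .
  show "0 \<le> 2 * B" using B by simp
qed

lemma continuous_bounded_Icc:
  fixes f :: "real \<Rightarrow> real"
  assumes "continuous_on {-1..1} f"
  obtains B where "\<And>x. x \<in> {-1..1} \<Longrightarrow> \<bar>f x\<bar> \<le> B"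
  using compact_imp_bounded[OF compact_continuous_image[OF assms]]
  unfolding bounded_real by fast

lemma I_subset: "x \<in> I \<Longrightarrow> x \<in> {-1..1}"
  by (auto simp: I_def)

lemma continuous_measurable_\<mu>:
  fixes f :: "real \<Rightarrow> real"
  assumes "continuous_on {-1..1} f"
  shows "f \<in> borel_measurable \<mu>"
  using assms by (intro continuous_imp_measurable_\<mu>) (auto elim!: continuous_on_subset simp: I_def)

lemma continuous_integrable_\<mu>:
  fixes f :: "real \<Rightarrow> real"
  assumes "continuous_on {-1..1} f"
  shows "integrable \<mu> f"
proof -
  obtain B where "\<And>x. x \<in> {-1..1} \<Longrightarrow> \<bar>f x\<bar> \<le> B" using continuous_bounded_Icc[OF assms] by metis
  then show ?thesis
    by (intro bounded_integrable_\<mu>[of _ B] continuous_measurable_\<mu> assms I_subset) (auto simp: I_def)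
qed

lemma continuous_sq_int_\<mu>:
  fixes f :: "real \<Rightarrow> real"
  assumes "continuous_on {-1..1} f"
  shows "sq_int \<mu> f"
proof -
  obtain B where "\<And>x. x \<in> {-1..1} \<Longrightarrow> \<bar>f x\<bar> \<le> B" using continuous_bounded_Icc[OF assms] by metis
  then show ?thesis
    by (intro bounded_sq_int_\<mu>[of _ B] continuous_measurable_\<mu> assms I_subset) (auto simp: I_def)
qed

lemma sq_int_bounded_mult:
  fixes f b :: "real \<Rightarrow> real"
  assumes f: "sq_int \<mu> f" and b: "b \<in> borel_measurable \<mu>" "\<And>x. x \<in> I \<Longrightarrow> \<bar>b x\<bar> \<le> B"
  shows "sq_int \<mu> (\<lambda>x. b x * f x)"
  unfolding sq_int_def
proof
  show "integrable \<mu> (\<lambda>x. (b x * f x)\<^sup>2)"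
  proof (rule Bochner_Integration.integrable_bound)
    show "integrable \<mu> (\<lambda>x. B\<^sup>2 * (f x)\<^sup>2)" using f by (simp add: sq_int_def)
    show "AE x in \<mu>. norm ((b x * f x)\<^sup>2) \<le> norm (B\<^sup>2 * (f x)\<^sup>2)"
    proof (rule AE_I2)
      fix x assume "x \<in> space \<mu>"
      then have "\<bar>b x\<bar>\<^sup>2 \<le> B\<^sup>2" using b(2)[of x] by (intro power_mono) auto
      then show "norm ((b x * f x)\<^sup>2) \<le> norm (B\<^sup>2 * (f x)\<^sup>2)"
        by (simp add: power_mult_distrib mult_right_mono)
    qed
  qed (use f b in \<open>auto simp: sq_int_def\<close>)
qed (use f b in \<open>auto simp: sq_int_def\<close>)

lemma sq_int_continuous_mult:
  fixes f b :: "real \<Rightarrow> real"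
  assumes "sq_int \<mu> f" "continuous_on {-1..1} b"
  shows "sq_int \<mu> (\<lambda>x. b x * f x)"
proof -
  obtain B where "\<And>x. x \<in> {-1..1} \<Longrightarrow> \<bar>b x\<bar> \<le> B" using continuous_bounded_Icc[OF assms(2)] by metis
  then show ?thesis
    by (intro sq_int_bounded_mult[of _ _ B] continuous_measurable_\<mu> assms I_subset) (auto simp: I_def)
qed

text \<open>Differentiability is asked only in the open interval because the antiderivatives used
  later are built from \<open>arccos\<close>, which is merely continuous at the endpoints.\<close>

lemma integral_\<mu>_FTC:
  fixes f F :: "real \<Rightarrow> real"
  assumes "continuous_on {-1..1} f" "continuous_on {-1..1} F"
    "\<And>x. x \<in> I \<Longrightarrow> (F has_real_derivative f x) (at x)"
  shows "(\<integral>x. f x \<partial>\<mu>) = F 1 - F (-1)"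
proof -
  have "(f has_integral (F 1 - F (-1))) {-1..1}"
    by (intro fundamental_theorem_of_calculus_interior assms)
       (use assms(3) in \<open>auto simp: I_def has_real_derivative_iff_has_vector_derivative\<close>)
  then have "(f has_integral (F 1 - F (-1))) I"
    by (simp add: I_def has_integral_Icc_iff_Ioo)
  moreover have "set_integrable lborel I f"
    by (simp add: set_integrable_\<mu> continuous_integrable_\<mu> assms)
  ultimately show ?thesis
    using set_borel_integral_eq_integral(2) by (metis integral_unique intI_def intI_eq)
qed

subsection \<open>Weak derivatives\<close>

text \<open>Local integrability gives measurability on compact subintervals only; exhausting
  \<open>I\<close> by the intervals \<open>J n\<close> exhibits the function as a pointwise limit of
  measurable ones.\<close>

lemma loc_integrable_measurable:
  assumes "loc_integrable u"
  shows "u \<in> borel_measurable \<mu>"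
proof -
  define J where "J n = {-1 + 1 / (real n + 1) .. 1 - 1 / (real n + 1)}" for n
  have "(\<lambda>x. indicator I x *\<^sub>R u x) \<in> borel_measurable lborel"
  proof (rule borel_measurable_LIMSEQ_real)
    fix n
    have "set_integrable lborel (J n) u"
      using assms by (auto simp: loc_integrable_def J_def)
    then show "(\<lambda>x. indicator (J n) x *\<^sub>R u x) \<in> borel_measurable lborel"
      by (simp add: set_integrable_def)
  next
    fix x
    have "eventually (\<lambda>n. (x \<in> J n) = (x \<in> I)) sequentially"
    proof (cases "x \<in> I")
      case True
      have "(\<lambda>n. 1 / (real n + 1)) \<longlonglongrightarrow> 0" using LIMSEQ_inverse_real_of_nat by (simp add: inverse_eq_divide add.commute)
      moreover have "min (1 - x) (1 + x) > 0" using True by (auto simp: I_def)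
      ultimately have "eventually (\<lambda>n. 1 / (real n + 1) < min (1 - x) (1 + x)) sequentially"
        using order_tendstoD(2) by blast
      then show ?thesis by eventually_elim (use True in \<open>auto simp: J_def\<close>)
    next
      case False
      have "J n \<subseteq> I" for n by (auto simp: J_def I_def) (smt (verit) divide_pos_pos of_nat_0_le_iff)+
      then have "(x \<in> J n) = (x \<in> I)" for n using False by blast
      then show ?thesis by simp
    qed
    then show "(\<lambda>n. indicator (J n) x *\<^sub>R u x) \<longlonglongrightarrow> indicator I x *\<^sub>R u x"
      by (intro tendsto_eventually) (auto elim!: eventually_mono simp: indicator_def)
  qed
  then show ?thesis by (simp add: borel_measurable_restrict_space_iff)
qed

lemma integrable_loc_integrable: 
  assumes "integrable \<mu> u"
  shows "loc_integrable u"
  unfolding loc_integrable_def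
proof safe
  fix a b :: real assume *: "-1 < a" "b < 1"
  have "set_integrable lborel I u" using assms by (simp add: set_integrable_\<mu>)
  then show "set_integrable lborel {a..b} u"
    by (rule set_integrable_subset) (use * in \<open>auto simp: I_def\<close>)
qed

lemma loc_integrable_diff:
  "loc_integrable u \<Longrightarrow> loc_integrable v \<Longrightarrow> loc_integrable (\<lambda>x. u x - v x)"
  by (simp add: loc_integrable_def)

lemma loc_integrable_mult_compact:
  fixes a b :: real
  assumes u: "loc_integrable u" and ab: "-1 < a" "b < 1"
    and \<phi>: "continuous_on UNIV \<phi>" "\<And>x. x \<notin> {a..b} \<Longrightarrow> \<phi> x = 0"
  shows "integrable \<mu> (\<lambda>x. u x * \<phi> x)"
proof -
  obtain B where B: "\<And>x. x \<in> {-1..1} \<Longrightarrow> \<bar>\<phi> x\<bar> \<le> B"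
    using continuous_bounded_Icc[OF continuous_on_subset[OF \<phi>(1) subset_UNIV]] by blast
  show ?thesis
  proof (rule Bochner_Integration.integrable_bound)
    have "set_integrable lborel {a..b} u" using u ab by (auto simp: loc_integrable_def)
    then have "integrable lborel (\<lambda>x. indicator {a..b} x * u x)"
      by (simp add: set_integrable_def)
    then have "integrable lborel (\<lambda>x. indicator I x *\<^sub>R (indicator {a..b} x * u x))"
      by (intro integrable_mult_indicator) auto
    then show "integrable \<mu> (\<lambda>x. B * (indicator {a..b} x * u x))"
      by (auto simp: integrable_restrict_space)
    show "(\<lambda>x. u x * \<phi> x) \<in> borel_measurable \<mu>"
      using loc_integrable_measurable[OF u] continuous_measurable_\<mu>[of \<phi>] \<phi>(1) continuous_on_subset
      by (intro borel_measurable_times) auto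
    show "AE x in \<mu>. norm (u x * \<phi> x) \<le> norm (B * (indicator {a..b} x * u x))"
    proof (rule AE_I2)
      fix x assume "x \<in> space \<mu>"
      then have "\<bar>\<phi> x\<bar> \<le> \<bar>B\<bar>" using B[of x] I_subset[of x] by auto
      then show "norm (u x * \<phi> x) \<le> norm (B * (indicator {a..b} x * u x))"
        using \<phi>(2)[of x] by (auto simp: abs_mult indicator_def mult.commute intro!: mult_right_mono)
    qed
  qed
qed

lemma test_funE:
  assumes "test_fun \<phi>"
  obtains a b where "-1 < a" "b < 1" "\<And>x. x \<notin> {a..b} \<Longrightarrow> \<phi> x = 0" "\<And>x. x \<notin> {a..b} \<Longrightarrow> deriv \<phi> x = 0"
    "\<And>x. (\<phi> has_real_derivative deriv \<phi> x) (at x)" "continuous_on UNIV \<phi>" "continuous_on UNIV (deriv \<phi>)"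
proof -
  obtain a b where ab: "-1 < a" "b < 1" "\<And>x. x \<notin> {a..b} \<Longrightarrow> \<phi> x = 0" and s: "smooth \<phi>"
    using assms by (auto simp: test_fun_def)
  obtain \<phi>' where \<phi>': "smooth \<phi>'" "\<And>x. (\<phi> has_real_derivative \<phi>' x) (at x)"
    using smooth_deriv[OF s] by metis
  then have d: "deriv \<phi> = \<phi>'" by (auto intro: DERIV_imp_deriv)
  have c: "continuous_on UNIV f" if "smooth f" for f
    by (metis smooth_deriv[OF that] DERIV_isCont continuous_at_imp_continuous_on)
  have "\<phi>' x = 0" if "x \<notin> {a..b}" for x
  proof -
    have "((\<lambda>x. 0) has_real_derivative \<phi>' x) (at x)"
      by (rule has_field_derivative_transform_within_open[OF \<phi>'(2), of "- {a..b}"])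
         (use that ab in auto)
    then show ?thesis by (metis DERIV_unique DERIV_const)
  qed
  then show ?thesis using that ab d \<phi>' c s by metis
qed

lemma integrable_test:
  assumes "loc_integrable u" "test_fun \<phi>"
  shows "integrable \<mu> (\<lambda>x. u x * \<phi> x)" "integrable \<mu> (\<lambda>x. u x * deriv \<phi> x)"
  using assms by (auto elim!: test_funE intro!: loc_integrable_mult_compact)

lemma weak_deriv_diff:
  assumes "weak_deriv u g" "weak_deriv v h"
  shows "weak_deriv (\<lambda>x. u x - v x) (\<lambda>x. g x - h x)"
  unfolding weak_deriv_def
proof (intro conjI allI impI)
  fix \<phi> assume t: "test_fun \<phi>"
  note i = assms[unfolded weak_deriv_def]
  show "intI (\<lambda>x. (u x - v x) * deriv \<phi> x) = - intI (\<lambda>x. (g x - h x) * \<phi> x)"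
    using i t integrable_test[of u \<phi>] integrable_test[of v \<phi>] integrable_test[of g \<phi>] integrable_test[of h \<phi>]
    by (simp add: intI_eq left_diff_distrib)
qed (use assms in \<open>auto simp: weak_deriv_def intro!: loc_integrable_diff\<close>)

lemma weak_deriv_classical:
  assumes "continuous_on {-1..1} p" "continuous_on {-1..1} p'"
    "\<And>x. x \<in> I \<Longrightarrow> (p has_real_derivative p' x) (at x)"
  shows "weak_deriv p p'"
  unfolding weak_deriv_def
proof (intro conjI allI impI)
  fix \<phi> assume t: "test_fun \<phi>"
  obtain a b where ab: "-1 < a" "b < 1" "\<And>x. x \<notin> {a..b} \<Longrightarrow> \<phi> x = 0"
    and d: "\<And>x. (\<phi> has_real_derivative deriv \<phi> x) (at x)" and c: "continuous_on UNIV \<phi>" "continuous_on UNIV (deriv \<phi>)"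
    using test_funE[OF t] by metis
  have c': "continuous_on {-1..1} \<phi>" "continuous_on {-1..1} (deriv \<phi>)"
    using c continuous_on_subset by blast+
  have "(\<integral>x. p x * deriv \<phi> x + p' x * \<phi> x \<partial>\<mu>) = p 1 * \<phi> 1 - p (-1) * \<phi> (-1)"
    by (intro integral_\<mu>_FTC[where F="\<lambda>x. p x * \<phi> x"] continuous_intros assms c')
       (auto intro!: derivative_eq_intros assms d)
  also have "\<dots> = 0" using ab by simp
  also have "(\<integral>x. p x * deriv \<phi> x + p' x * \<phi> x \<partial>\<mu>) = (\<integral>x. p x * deriv \<phi> x \<partial>\<mu>) + (\<integral>x. p' x * \<phi> x \<partial>\<mu>)"
    by (intro Bochner_Integration.integral_add continuous_integrable_\<mu> continuous_intros assms c')
  finally show "intI (\<lambda>x. p x * deriv \<phi> x) = - intI (\<lambda>x. p' x * \<phi> x)"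
    by (simp add: intI_eq)
qed (intro integrable_loc_integrable continuous_integrable_\<mu> assms)+

text \<open>Open intervals form an intersection-stable generator of the Borel sets. The sets over
  which \<open>h\<close> integrates to 0 are closed under disjoint unions and, because the total
  integral is 0, under complements; so they include all Borel sets.\<close>

lemma AE_zero_if_interval_integrals_zero:
  fixes h :: "real \<Rightarrow> real"
  assumes h: "integrable lborel h" and tot: "integral\<^sup>L lborel h = 0"
    and 0: "\<And>a b. a < b \<Longrightarrow> (LINT x:{a<..<b}|lborel. h x) = 0"
  shows "AE x in lborel. h x = 0"
proof (rule density_unique_real[of lborel h "\<lambda>x. 0"])
  fix A :: "real set" assume "A \<in> sets lborel"
  then have "A \<in> sigma_sets UNIV (range (\<lambda>(a, b). box a b))"
    by (simp add: borel_eq_box)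
  then have "A \<in> sets lborel \<and> (LINT x:A|lborel. h x) = 0"
  proof (induction rule: sigma_sets_induct_disjoint[rotated 2, consumes 1, case_names basic empty compl union stable sub])
    case stable then show ?case by (auto simp: Int_stable_def box_Int_box)
  next
    case sub then show ?case by auto
  next
    case (basic A)
    then obtain a b where "A = {a<..<b}" by auto
    then show ?case using 0[of a b] by (cases "a < b") (auto simp: set_lebesgue_integral_def)
  next
    case empty then show ?case by (simp add: set_lebesgue_integral_def)
  next
    case (compl A)
    have "(LINT x:(UNIV - A)|lborel. h x) = (LINT x|lborel. h x - indicator A x *\<^sub>R h x)"
      unfolding set_lebesgue_integral_def by (intro Bochner_Integration.integral_cong) (auto simp: indicator_def)
    also have "\<dots> = 0"
      using compl h tot by (subst Bochner_Integration.integral_diff) (auto intro!: integrable_mult_indicator[where f=h, unfolded real_scaleR_def] simp: set_lebesgue_integral_def)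
    finally show ?case using compl by auto
  next
    case (union A)
    have "(LINT x:(\<Union>i. A i)|lborel. h x) = (\<Sum>i. (LINT x:A i|lborel. h x))"
      using union h
      by (intro lebesgue_integral_countable_add)
         (auto simp: disjoint_family_on_def set_integrable_def intro!: integrable_mult_indicator[where f=h, unfolded real_scaleR_def])
    then show ?case using union by auto
  qed
  then show "(LINT x:A|lborel. h x) = (LINT x:A|lborel. 0)" by simp
qed (use h in auto)

text \<open>Test functions converging to the indicator of an interval compactly inside
  \<open>I\<close> show, by dominated convergence, that \<open>h\<close> has integral 0 over each
  such interval. The interval criterion then applies to \<open>h\<close> cut off to such intervals,
  and countably many of them cover \<open>I\<close>.\<close>

lemma fundamental_lemma:
  assumes h: "loc_integrable h" and 0: "\<And>\<phi>. test_fun \<phi> \<Longrightarrow> (\<integral>x. h x * \<phi> x \<partial>\<mu>) = 0"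
  shows "AE x in \<mu>. h x = 0"
proof -
  obtain B where B: "smooth B" "\<And>t. t \<le> 0 \<Longrightarrow> B t = 0" "\<And>t. t \<ge> 1 \<Longrightarrow> B t = 1"
    "\<And>t. 0 \<le> B t" "\<And>t. B t \<le> 1" by (rule smooth_step) blast
  have int: "integrable lborel (\<lambda>x. indicator {c<..<d} x * h x)" if "-1 < c" "d < 1" for c d
  proof -
    have "set_integrable lborel {c<..<d} h"
      by (rule set_integrable_subset[of _ "{c..d}"]) (use h that in \<open>auto simp: loc_integrable_def\<close>)
    then show ?thesis by (simp add: set_integrable_def)
  qed
  have z: "(\<integral>x. indicator {c<..<d} x * h x \<partial>lborel) = 0" if cd: "-1 < c" "d < 1" for c d
  proof -
    \<comment> \<open>Vanishes outside \<open>{c<..<d}\<close> and equals 1 at distance at least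
      \<open>1 / Suc n\<close> from both ends.\<close>
    define \<phi> where "\<phi> n x = B (real (Suc n) * x + (- real (Suc n) * c)) * B ((- real (Suc n)) * x + real (Suc n) * d)" for n x
    have out: "\<phi> n x = 0" if "x \<notin> {c<..<d}" for n x
    proof -
      have "real (Suc n) * (x - c) \<le> 0 \<or> real (Suc n) * (d - x) \<le> 0"
        using that by (auto simp: mult_le_0_iff)
      then show ?thesis using B(2) by (auto simp: \<phi>_def algebra_simps)
    qed
    have t: "test_fun (\<phi> n)" for n
    proof -
      have "smooth (\<phi> n)" unfolding \<phi>_def by (intro smooth_mult smooth_affine B)
      moreover have "\<forall>x. x \<notin> {c..d} \<longrightarrow> \<phi> n x = 0" using out by force
      ultimately show ?thesis unfolding test_fun_def using cd by blast
    qed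
    have lim: "(\<lambda>n. \<phi> n x) \<longlonglongrightarrow> 1" if x: "x \<in> {c<..<d}" for x
    proof (rule tendsto_eventually)
      define r where "r = min (x - c) (d - x)"
      have r: "r > 0" using x by (auto simp: r_def)
      obtain N where N: "real N * r > 1" using reals_Archimedean3[OF r] by blast
      have "\<phi> n x = 1" if "n \<ge> N" for n
      proof -
        have "1 \<le> real (Suc n) * r" using N that r by (smt (verit) mult_right_mono of_nat_Suc of_nat_mono)
        moreover have "real (Suc n) * r \<le> real (Suc n) * (x - c)" "real (Suc n) * r \<le> real (Suc n) * (d - x)"
          by (auto simp: r_def intro!: mult_left_mono)
        ultimately have "1 \<le> real (Suc n) * (x - c)" "1 \<le> real (Suc n) * (d - x)" by linarith+
        then show ?thesis using B(3) by (auto simp: \<phi>_def algebra_simps)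
      qed
      then show "\<forall>\<^sub>F n in sequentially. \<phi> n x = 1"
        using eventually_sequentially by blast
    qed
    have "(\<lambda>n. \<integral>x. (indicator {c<..<d} x * h x) * \<phi> n x \<partial>lborel) \<longlonglongrightarrow> (\<integral>x. indicator {c<..<d} x * h x \<partial>lborel)"
    proof (rule integral_dominated_convergence[where w="\<lambda>x. \<bar>indicator {c<..<d} x * h x\<bar>"])
      show "(\<lambda>x. indicator {c<..<d} x * h x) \<in> borel_measurable lborel"
        using int[OF cd] by auto
      have "continuous_on UNIV (\<phi> n)" for n using test_funE[OF t[of n]] by metis
      then have "\<phi> n \<in> borel_measurable lborel" for n
        by (simp add: borel_measurable_continuous_onI)
      then show "(\<lambda>x. (indicator {c<..<d} x * h x) * \<phi> n x) \<in> borel_measurable lborel" for n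
        by (intro borel_measurable_times[OF borel_measurable_integrable[OF int[OF cd]]])
      show "AE x in lborel. (\<lambda>n. (indicator {c<..<d} x * h x) * \<phi> n x) \<longlonglongrightarrow> indicator {c<..<d} x * h x"
      proof (rule AE_I2)
        fix x show "(\<lambda>n. (indicator {c<..<d} x * h x) * \<phi> n x) \<longlonglongrightarrow> indicator {c<..<d} x * h x"
        proof (cases "x \<in> {c<..<d}")
          case True
          then show ?thesis using tendsto_mult[OF tendsto_const lim[OF True]] by force
        qed auto
      qed
      have "\<bar>\<phi> n x\<bar> \<le> 1" for n x
        unfolding \<phi>_def abs_mult using B(4,5) by (intro mult_le_one) auto
      then show "AE x in lborel. norm ((indicator {c<..<d} x * h x) * \<phi> n x) \<le> \<bar>indicator {c<..<d} x * h x\<bar>" for n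
        by (auto intro!: AE_I2 mult_left_le simp: abs_mult)
    qed (use int[OF cd] in auto)
    moreover have "(\<integral>x. (indicator {c<..<d} x * h x) * \<phi> n x \<partial>lborel) = 0" for n
    proof -
      have "(\<integral>x. h x * \<phi> n x \<partial>\<mu>) = (\<integral>x. (indicator {c<..<d} x * h x) * \<phi> n x \<partial>lborel)"
        unfolding integral_restrict_space[OF I_sets(2)]
        by (intro Bochner_Integration.integral_cong) (use out cd in \<open>auto simp: indicator_def I_def\<close>)
      then show ?thesis using 0[OF t] by simp
    qed
    ultimately show ?thesis by (simp add: LIMSEQ_const_iff)
  qed
  have ae: "AE x in lborel. indicator {c<..<d} x * h x = 0" if cd: "-1 < c" "d < 1" for c d
  proof (rule AE_zero_if_interval_integrals_zero[OF int[OF cd] z[OF cd]])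
    fix a b :: real assume "a < b"
    have "(LINT x:{a<..<b}|lborel. indicator {c<..<d} x * h x) = (\<integral>x. indicator {max a c<..<min b d} x * h x \<partial>lborel)"
      unfolding set_lebesgue_integral_def
      by (intro Bochner_Integration.integral_cong) (auto simp: indicator_def)
    also have "\<dots> = 0" by (rule z) (use cd in auto)
    finally show "(LINT x:{a<..<b}|lborel. indicator {c<..<d} x * h x) = 0" .
  qed
  have "AE x in lborel. \<forall>n. indicator {-1 + 1/real (Suc n)<..<1 - 1/real (Suc n)} x * h x = 0"
    unfolding AE_all_countable by (intro allI ae) auto
  then show ?thesis unfolding AE_\<mu>
  proof eventually_elim
    case (elim x)
    show ?case
    proof
      assume "x \<in> I"
      then have "min (1 - x) (1 + x) > 0" by (auto simp: I_def)
      then obtain n where "inverse (real (Suc n)) < min (1 - x) (1 + x)" using reals_Archimedean by blast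
      then have "x \<in> {-1 + 1/real (Suc n)<..<1 - 1/real (Suc n)}" by (auto simp: field_simps)
      then show "h x = 0" using elim[rule_format, of n] by simp
    qed
  qed
qed

lemma weak_deriv_unique:
  assumes "weak_deriv u g" "weak_deriv u h"
  shows "AE x in \<mu>. g x = h x"
proof -
  note a = assms[unfolded weak_deriv_def]
  have "AE x in \<mu>. g x - h x = 0"
  proof (rule fundamental_lemma)
    fix \<phi> assume t: "test_fun \<phi>"
    then show "(\<integral>x. (g x - h x) * \<phi> x \<partial>\<mu>) = 0"
      using a integrable_test[OF _ t, of g] integrable_test[OF _ t, of h]
      by (simp add: intI_eq left_diff_distrib)
  qed (use a in \<open>auto intro: loc_integrable_diff\<close>)
  then show ?thesis by eventually_elim simp
qed

lemma weak_deriv_wderiv: "has_weak_deriv u \<Longrightarrow> weak_deriv u (wderiv u)"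
  unfolding has_weak_deriv_def wderiv_def using someI_ex[of "weak_deriv u"] by blast

text \<open>\<open>wderiv\<close> is an arbitrary choice. This lemma makes the choice harmless: in
  every integral it may be replaced by any explicitly known weak derivative.\<close>

lemma wderiv_AE:
  assumes "weak_deriv u g"
  shows "AE x in \<mu>. wderiv u x = g x" "wderiv u \<in> borel_measurable \<mu>"
proof -
  have w: "weak_deriv u (wderiv u)"
    using assms by (intro weak_deriv_wderiv) (auto simp: has_weak_deriv_def)
  show "AE x in \<mu>. wderiv u x = g x" by (rule weak_deriv_unique[OF w assms])
  show "wderiv u \<in> borel_measurable \<mu>"
    using w by (intro loc_integrable_measurable) (auto simp: weak_deriv_def)
qed

subsection \<open>Density of test functions and of polynomials\<close>

lemma polynomial_continuous: "real_polynomial_function p \<Longrightarrow> continuous_on S p"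
  for p :: "real \<Rightarrow> real"
  by (metis continuous_on_polymonial_function real_polynomial_function_eq)

lemma DERIV_abs_diff_le:
  fixes D D' :: "real \<Rightarrow> real"
  assumes "continuous_on {-1..1} D" "\<And>x. x \<in> I \<Longrightarrow> (D has_real_derivative D' x) (at x)"
    and "\<And>x. x \<in> I \<Longrightarrow> \<bar>D' x\<bar> \<le> L" and xy: "-1 \<le> x" "x \<le> y" "y \<le> 1"
  shows "\<bar>D y - D x\<bar> \<le> L * (y - x)"
proof (cases "x = y")
  case False
  then have "x < y" using xy by simp
  moreover have "continuous_on {x..y} D" using assms(1) xy by (auto elim: continuous_on_subset)
  moreover have "(D has_derivative (*) (D' z)) (at z)" if "x < z" "z < y" for z
    using assms(2)[of z] that xy by (auto simp: I_def has_field_derivative_def)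
  ultimately obtain z where z: "x < z" "z < y" "D y - D x = D' z * (y - x)"
    using mvt[of x y D "\<lambda>z. (*) (D' z)"] by auto
  then show ?thesis using assms(3)[of z] xy \<open>x < y\<close>
    by (auto simp: I_def abs_mult intro!: mult_right_mono)
qed simp

lemma polynomial_antiderivative:
  fixes q :: "real \<Rightarrow> real"
  assumes "real_polynomial_function q"
  obtains P where "real_polynomial_function P" "\<And>x. (P has_real_derivative q x) (at x)"
proof -
  obtain c n where q: "q = (\<lambda>x. \<Sum>i\<le>n. c i * x^i)"
    using assms real_polynomial_function_iff_sum by auto
  have id: "real_polynomial_function (\<lambda>x::real. x)"
    by (rule real_polynomial_function.intros(1)) simp
  show ?thesis
  proof (rule that[of "\<lambda>x. \<Sum>i\<le>n. (c i / real (Suc i)) * x^Suc i"])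
    show "real_polynomial_function (\<lambda>x. \<Sum>i\<le>n. (c i / real (Suc i)) * x^Suc i)"
      by (intro real_polynomial_function_sum real_polynomial_function.intros(2-) real_polynomial_function_power id finite_atMost)
    show "((\<lambda>x. \<Sum>i\<le>n. (c i / real (Suc i)) * x^Suc i) has_real_derivative q x) (at x)" for x
      unfolding q by (rule DERIV_sum) (auto intro!: derivative_eq_intros simp del: power_Suc)
  qed
qed

text \<open>A uniform approximation of the derivative is integrated, which also approximates the
  function; a linear correction then restores both zero endpoint values.\<close>

lemma C1_polynomial_approx:
  assumes c: "continuous_on {-1..1} \<Psi>" "continuous_on {-1..1} \<Psi>'"
    and d: "\<And>x. x \<in> I \<Longrightarrow> (\<Psi> has_real_derivative \<Psi>' x) (at x)"
    and 0: "\<Psi> (-1) = 0" "\<Psi> 1 = 0" and e: "e > 0"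
  obtains p p' where "real_polynomial_function p" "real_polynomial_function p'"
    "\<And>x. (p has_real_derivative p' x) (at x)" "p (-1) = 0" "p 1 = 0"
    "\<And>x. x \<in> I \<Longrightarrow> \<bar>\<Psi> x - p x\<bar> \<le> e" "\<And>x. x \<in> I \<Longrightarrow> \<bar>\<Psi>' x - p' x\<bar> \<le> e"
proof -
  obtain q where q: "real_polynomial_function q" "\<And>x. x \<in> {-1..1} \<Longrightarrow> \<bar>\<Psi>' x - q x\<bar> < e/4"
    using Stone_Weierstrass_real_polynomial_function[of "{-1..1}" \<Psi>' "e/4"] c e by auto
  obtain P where P: "real_polynomial_function P" "\<And>x. (P has_real_derivative q x) (at x)"
    using polynomial_antiderivative[OF q(1)] by blast
  have id: "real_polynomial_function (\<lambda>x::real. x)"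
    by (rule real_polynomial_function.intros(1)) simp
  define D where "D x = \<Psi> x - P x" for x
  have D: "\<bar>D y - D x\<bar> \<le> e/4 * (y - x)" if "-1 \<le> x" "x \<le> y" "y \<le> 1" for x y
  proof (rule DERIV_abs_diff_le[of D "\<lambda>x. \<Psi>' x - q x"])
    show "continuous_on {-1..1} D" unfolding D_def
      by (intro continuous_intros c polynomial_continuous P)
    show "(D has_real_derivative \<Psi>' x - q x) (at x)" if "x \<in> I" for x
      unfolding D_def by (intro derivative_intros d P that)
    show "\<bar>\<Psi>' x - q x\<bar> \<le> e/4" if "x \<in> I" for x
      using q(2)[of x] that by (auto simp: I_def)
  qed (use that in auto)
  \<comment> \<open>The slope of the correction. It is small because the exact \<open>\<Psi>\<close>
    has equal endpoint values, so \<open>P 1 - P (-1)\<close> is pure approximation error.\<close>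
  define m where "m = (P 1 - P (-1)) / 2"
  have m: "\<bar>m\<bar> \<le> e/4" using D[of "-1" 1] 0 by (simp add: D_def m_def abs_minus_commute)
  show ?thesis
  proof (rule that[of "\<lambda>x. P x + (- P (-1) + (-m) * (x + 1))" "\<lambda>x. q x + (-m)"])
    show "real_polynomial_function (\<lambda>x. P x + (- P (-1) + (-m) * (x + 1)))"
      by (intro real_polynomial_function.intros(2-) P id)
    show "real_polynomial_function (\<lambda>x. q x + (-m))"
      by (intro real_polynomial_function.intros(2-) q)
    show "((\<lambda>x. P x + (- P (-1) + (-m) * (x + 1))) has_real_derivative q x + (-m)) (at x)" for x
      by (auto intro!: derivative_eq_intros P)
    show "P 1 + (- P (-1) + (-m) * (1 + 1)) = 0" by (simp add: m_def field_simps)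
    show "\<bar>\<Psi> x - (P x + (- P (-1) + (-m) * (x + 1)))\<bar> \<le> e" if "x \<in> I" for x
    proof -
      have x: "-1 \<le> x" "x \<le> 1" using that by (auto simp: I_def)
      have "\<Psi> x - (P x + (- P (-1) + (-m) * (x + 1))) = (D x - D (-1)) + m * (x + 1)"
        using 0 by (simp add: D_def)
      moreover have "\<bar>D x - D (-1)\<bar> \<le> e/4 * 2"
        by (rule order_trans[OF D mult_left_mono]) (use x e in auto)
      moreover have "\<bar>m * (x + 1)\<bar> \<le> e/4 * 2"
        unfolding abs_mult by (rule mult_mono) (use m x in auto)
      ultimately show ?thesis by linarith
    qed
    show "\<bar>\<Psi>' x - (q x + (-m))\<bar> \<le> e" if "x \<in> I" for x
      using q(2)[OF I_subset[OF that]] m e by linarith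
  qed simp
qed

lemma nrm_tendsto_zero:
  fixes f :: "nat \<Rightarrow> real \<Rightarrow> real"
  assumes "\<And>n. f n \<in> borel_measurable \<mu>" "\<And>n x. x \<in> I \<Longrightarrow> \<bar>f n x\<bar> \<le> K"
    "\<And>x. x \<in> I \<Longrightarrow> \<forall>\<^sub>F n in sequentially. f n x = 0"
  shows "(\<lambda>n. nrm \<mu> (f n)) \<longlonglongrightarrow> 0"
proof -
  have "(\<lambda>n. \<integral>x. (f n x)\<^sup>2 \<partial>\<mu>) \<longlonglongrightarrow> (\<integral>x. 0 \<partial>\<mu>)"
  proof (rule integral_dominated_convergence[where w="\<lambda>x. K\<^sup>2"])
    show "AE x in \<mu>. (\<lambda>n. (f n x)\<^sup>2) \<longlonglongrightarrow> 0"
      by (intro AE_I2 tendsto_eventually) (use assms(3) in \<open>auto elim!: eventually_mono\<close>)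
    show "AE x in \<mu>. norm ((f n x)\<^sup>2) \<le> K\<^sup>2" for n
    proof (rule AE_I2)
      fix x assume "x \<in> space \<mu>"
      then show "norm ((f n x)\<^sup>2) \<le> K\<^sup>2" using power_mono[OF assms(2)[of x n], of 2] by simp
    qed
  qed (use assms in \<open>auto simp: finite_measure.integrable_const[OF finite_measure_\<mu>]\<close>)
  then have "(\<lambda>n. sqrt (\<integral>x. (f n x)\<^sup>2 \<partial>\<mu>)) \<longlonglongrightarrow> sqrt 0" by (intro tendsto_real_sqrt) simp
  then show ?thesis by (simp add: nrm_def)
qed

text \<open>Multiply by a cut-off \<open>\<kappa>\<close>: as \<open>p\<close> vanishes at \<open>\<plusminus>1\<close>, the term \<open>p \<kappa>'\<close> stays bounded although \<open>\<kappa>'\<close> does not.\<close>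
lemma polynomial_test_approx:
  assumes p: "real_polynomial_function p" "real_polynomial_function p'"
    "\<And>x. (p has_real_derivative p' x) (at x)" "p (-1) = 0" "p 1 = 0" and e: "e > 0"
  obtains \<phi> where "test_fun \<phi>" "nrm \<mu> (\<lambda>x. p x - \<phi> x) \<le> e" "nrm \<mu> (\<lambda>x. p' x - deriv \<phi> x) \<le> e"
proof -
  obtain B B' where B: "smooth B" "\<And>t. t \<le> 0 \<Longrightarrow> B t = 0" "\<And>t. t \<ge> 1 \<Longrightarrow> B t = 1"
    "\<And>t. 0 \<le> B t" "\<And>t. B t \<le> 1" "\<And>t. (B has_real_derivative B' t) (at t)" "continuous_on UNIV B'"
    "\<And>t. t \<notin> {0..1} \<Longrightarrow> B' t = 0" by (rule smooth_step) blast
  have B1: "\<bar>B t\<bar> \<le> 1" for t using B(4,5)[of t] by simp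
  have Bc: "continuous_on UNIV B" using B(6) by (meson DERIV_isCont continuous_at_imp_continuous_on)
  obtain K where K: "\<And>t. t \<in> {-1..1} \<Longrightarrow> \<bar>B' t\<bar> \<le> K"
    using continuous_bounded_Icc[OF continuous_on_subset[OF B(7) subset_UNIV]] by blast
  obtain L where L: "\<And>x. x \<in> {-1..1} \<Longrightarrow> \<bar>p' x\<bar> \<le> L"
    using continuous_bounded_Icc[OF polynomial_continuous[OF p(2)]] by blast
  have L0: "0 \<le> L" using L[of 0] by simp
  have K0: "0 \<le> K" using K[of 0] by simp
  have plip: "\<bar>p y - p x\<bar> \<le> L * (y - x)" if "-1 \<le> x" "x \<le> y" "y \<le> 1" for x y
    by (rule DERIV_abs_diff_le[of p p' L x y])
       (use that L[OF I_subset] p in \<open>auto intro: polynomial_continuous\<close>)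
  define r where "r n = real n + 2" for n
  have r: "r n > 0" for n by (simp add: r_def)
  \<comment> \<open>\<open>B (s n x)\<close> rises from 0 to 1 while the distance of x from -1 grows
    from \<open>1 / r n\<close> to \<open>2 / r n\<close>; \<open>t n\<close> does the same at the
    endpoint 1. Hence the support stays strictly inside \<open>I\<close>.\<close>
  define s where "s n x = r n * x + (r n - 1)" for n x
  define t where "t n x = (- r n) * x + (r n - 1)" for n x
  define \<kappa> where "\<kappa> n x = B (s n x) * B (t n x)" for n x
  define \<kappa>' where "\<kappa>' n x = r n * (B' (s n x) * B (t n x)) + (- r n) * (B (s n x) * B' (t n x))" for n x
  have d\<kappa>: "(\<kappa> n has_real_derivative \<kappa>' n x) (at x)" for n x
    unfolding \<kappa>_def \<kappa>'_def s_def t_def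
    by (auto intro!: derivative_eq_intros DERIV_chain2[of B] B(6) simp: algebra_simps)
  define \<phi> where "\<phi> n x = p x * \<kappa> n x" for n x
  have d\<phi>: "(\<phi> n has_real_derivative p' x * \<kappa> n x + p x * \<kappa>' n x) (at x)" for n x
    unfolding \<phi>_def by (auto intro!: derivative_eq_intros p d\<kappa>)
  then have deriv\<phi>: "deriv (\<phi> n) = (\<lambda>x. p' x * \<kappa> n x + p x * \<kappa>' n x)" for n
    by (auto intro: DERIV_imp_deriv)
  have test: "test_fun (\<phi> n)" for n
  proof -
    have "smooth (\<phi> n)" unfolding \<phi>_def \<kappa>_def s_def t_def
      by (intro smooth_mult smooth_affine B smooth_polynomial p)
    moreover have "\<phi> n x = 0" if "x \<notin> {- 1 + 1 / r n..1 - 1 / r n}" for x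
    proof -
      have "s n x \<le> 0 \<or> t n x \<le> 0"
        using that r[of n] by (auto simp: s_def t_def field_simps not_le)
      then show ?thesis using B(2) by (auto simp: \<phi>_def \<kappa>_def)
    qed
    moreover have "-1 < -1 + 1 / r n" "1 - 1 / r n < 1" using r[of n] by auto
    ultimately show ?thesis unfolding test_fun_def by blast
  qed
  have far: "\<forall>\<^sub>F n in sequentially. s n x > 1 \<and> t n x > 1" if x: "x \<in> I" for x
  proof -
    define d where "d = min (1 + x) (1 - x)"
    have d: "d > 0" using x by (auto simp: d_def I_def)
    obtain N where N: "real N * d > 2" using reals_Archimedean3[OF d] by blast
    show ?thesis unfolding eventually_sequentially
    proof (intro exI allI impI)
      fix n assume "N \<le> n"
      then have "real N * d \<le> r n * d" using d by (intro mult_right_mono) (auto simp: r_def)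
      then have "2 < r n * d" using N by linarith
      moreover have "r n * d \<le> r n * (1 + x)" "r n * d \<le> r n * (1 - x)"
        using r[of n] by (auto simp: d_def)
      ultimately show "s n x > 1 \<and> t n x > 1" by (simp add: s_def t_def algebra_simps)
    qed
  qed
  have \<kappa>1: "\<bar>1 - \<kappa> n x\<bar> \<le> 1" for n x
    unfolding \<kappa>_def using B(4,5) mult_le_one[of "B (s n x)" "B (t n x)"] by (simp add: mult_nonneg_nonneg)
  have Kall: "\<bar>B' t\<bar> \<le> K" for t using K[of t] B(8)[of t] K0 by (cases "t \<in> {0..1}") auto
  have BK: "\<bar>B' s\<bar> * \<bar>B t\<bar> \<le> K" "\<bar>B t\<bar> * \<bar>B' s\<bar> \<le> K" for s t
    using mult_mono[OF Kall[of s] B1[of t]] K0 by (auto simp: mult.commute)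
  \<comment> \<open>Where \<open>B' (s n x)\<close> can be nonzero, x is within
    \<open>2 / r n\<close> of -1. There \<open>p\<close>, being Lipschitz and zero at -1, is at most
    \<open>2 * L / r n\<close>, which cancels the factor \<open>r n\<close>.\<close>
  have b1: "\<bar>p x * (r n * (B' (s n x) * B (t n x)))\<bar> \<le> 2 * L * K" if x: "x \<in> I" for n x
  proof (cases "s n x \<in> {0..1}")
    case True
    then have "r n * (x + 1) \<le> 2" by (simp add: s_def algebra_simps)
    moreover have "\<bar>p x\<bar> \<le> L * (x + 1)" using plip[of "-1" x] x p(4) by (auto simp: I_def)
    ultimately have "r n * \<bar>p x\<bar> \<le> r n * (L * (x + 1))" "L * (r n * (x + 1)) \<le> L * 2"
      using r[of n] L0 by (auto intro!: mult_left_mono simp del: mult_le_cancel_left_pos)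
    then have "r n * \<bar>p x\<bar> \<le> 2 * L" by (simp add: mult.left_commute mult.commute)
    then have "(r n * \<bar>p x\<bar>) * (\<bar>B' (s n x)\<bar> * \<bar>B (t n x)\<bar>) \<le> (2 * L) * K"
      by (rule mult_mono) (use L0 K0 BK in auto)
    then show ?thesis using r[of n] by (simp add: abs_mult ac_simps)
  qed (use B(8) L0 K0 in simp)
  have b2: "\<bar>p x * ((- r n) * (B (s n x) * B' (t n x)))\<bar> \<le> 2 * L * K" if x: "x \<in> I" for n x
  proof (cases "t n x \<in> {0..1}")
    case True
    then have "r n * (1 - x) \<le> 2" by (simp add: t_def algebra_simps)
    moreover have "\<bar>p x\<bar> \<le> L * (1 - x)" using plip[of x 1] x p(5) by (auto simp: I_def)
    ultimately have "r n * \<bar>p x\<bar> \<le> r n * (L * (1 - x))" "L * (r n * (1 - x)) \<le> L * 2"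
      using r[of n] L0 by (auto intro!: mult_left_mono simp del: mult_le_cancel_left_pos)
    then have "r n * \<bar>p x\<bar> \<le> 2 * L" by (simp add: mult.left_commute mult.commute)
    then have "(r n * \<bar>p x\<bar>) * (\<bar>B (s n x)\<bar> * \<bar>B' (t n x)\<bar>) \<le> (2 * L) * K"
      by (rule mult_mono) (use L0 K0 BK in auto)
    then show ?thesis using r[of n] by (simp add: abs_mult ac_simps)
  qed (use B(8) L0 K0 in simp)
  have cs: "continuous_on S (\<phi> n)" "continuous_on S (deriv (\<phi> n))" for S n
    using test_funE[OF test[of n]] continuous_on_subset by (metis subset_UNIV)+
  have lim1: "(\<lambda>n. nrm \<mu> (\<lambda>x. p x - \<phi> n x)) \<longlonglongrightarrow> 0"
  proof (rule nrm_tendsto_zero)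
    show "(\<lambda>x. p x - \<phi> n x) \<in> borel_measurable \<mu>" for n
      by (intro continuous_measurable_\<mu> continuous_intros cs polynomial_continuous p)
    show "\<bar>p x - \<phi> n x\<bar> \<le> 2 * L" if x: "x \<in> I" for n x
    proof -
      have "\<bar>p x\<bar> \<le> L * (x + 1)" using plip[of "-1" x] x p(4) by (auto simp: I_def)
      also have "\<dots> \<le> L * 2" using x L0 by (intro mult_left_mono) (auto simp: I_def)
      finally have "\<bar>p x\<bar> * \<bar>1 - \<kappa> n x\<bar> \<le> (L * 2) * 1" using L0 by (intro mult_mono \<kappa>1) auto
      then show ?thesis by (simp add: \<phi>_def abs_mult[symmetric] right_diff_distrib)
    qed
    show "\<forall>\<^sub>F n in sequentially. p x - \<phi> n x = 0" if "x \<in> I" for x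
      using far[OF that] by eventually_elim (use B(3) in \<open>simp add: \<phi>_def \<kappa>_def\<close>)
  qed
  have lim2: "(\<lambda>n. nrm \<mu> (\<lambda>x. p' x - deriv (\<phi> n) x)) \<longlonglongrightarrow> 0"
  proof (rule nrm_tendsto_zero)
    show "(\<lambda>x. p' x - deriv (\<phi> n) x) \<in> borel_measurable \<mu>" for n
      by (intro continuous_measurable_\<mu> continuous_intros cs polynomial_continuous p)
    show "\<bar>p' x - deriv (\<phi> n) x\<bar> \<le> L + 4 * L * K" if x: "x \<in> I" for n x
    proof -
      have "\<bar>p' x\<bar> * \<bar>1 - \<kappa> n x\<bar> \<le> L * 1" using L0 x by (intro mult_mono \<kappa>1 L I_subset) auto
      then have "\<bar>p' x * (1 - \<kappa> n x)\<bar> \<le> L" by (simp add: abs_mult)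
      moreover have "p' x - deriv (\<phi> n) x = p' x * (1 - \<kappa> n x)
          - p x * (r n * (B' (s n x) * B (t n x))) - p x * ((- r n) * (B (s n x) * B' (t n x)))"
        by (simp add: deriv\<phi> \<kappa>'_def algebra_simps)
      ultimately show ?thesis using b1[OF x, of n] b2[OF x, of n] by linarith
    qed
    show "\<forall>\<^sub>F n in sequentially. p' x - deriv (\<phi> n) x = 0" if "x \<in> I" for x
      using far[OF that] by eventually_elim (use B(3,8) in \<open>simp add: deriv\<phi> \<kappa>_def \<kappa>'_def\<close>)
  qed
  have "\<forall>\<^sub>F n in sequentially. nrm \<mu> (\<lambda>x. p x - \<phi> n x) < e \<and> nrm \<mu> (\<lambda>x. p' x - deriv (\<phi> n) x) < e"
    using order_tendstoD(2)[OF lim1 e] order_tendstoD(2)[OF lim2 e] by eventually_elim simp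
  then obtain n where "nrm \<mu> (\<lambda>x. p x - \<phi> n x) < e" "nrm \<mu> (\<lambda>x. p' x - deriv (\<phi> n) x) < e"
    unfolding eventually_sequentially by blast
  then show ?thesis using that[OF test[of n]] by simp
qed

text \<open>Both sides are continuous in \<Psi> for the norm of \<open>H^1\<close>, and \<Psi> is
  approximated there by polynomials vanishing at the endpoints and these by test functions. The
  boundary terms vanish through \<Psi> alone, so the rule applies to all the weak derivatives of the
  solution.\<close>

lemma weak_deriv_integration_by_parts:
  assumes w: "weak_deriv u g" and u: "sq_int \<mu> u" and g: "sq_int \<mu> g"
    and c: "continuous_on {-1..1} \<Psi>" "continuous_on {-1..1} \<Psi>'"
    and d: "\<And>x. x \<in> I \<Longrightarrow> (\<Psi> has_real_derivative \<Psi>' x) (at x)"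
    and 0: "\<Psi> (-1) = 0" "\<Psi> 1 = 0"
  shows "(\<integral>x. u x * \<Psi>' x \<partial>\<mu>) = - (\<integral>x. g x * \<Psi> x \<partial>\<mu>)"
proof -
  define A where "A = (\<integral>x. u x * \<Psi>' x \<partial>\<mu>) + (\<integral>x. g x * \<Psi> x \<partial>\<mu>)"
  have sc: "sq_int \<mu> \<Psi>" "sq_int \<mu> \<Psi>'" using c by (auto intro: continuous_sq_int_\<mu>)
  have "\<bar>A\<bar> \<le> 0 + e" if e: "e > 0" for e
  proof -
    \<comment> \<open>Each approximation error will be \<open>3 * \<delta>\<close>:
      \<open>2 * \<delta>\<close> from the uniform bound by \<open>nrm_le_sup\<close> and
      \<open>\<delta>\<close> from the cut-off.\<close>
    define \<delta> where "\<delta> = e / (3 * (nrm \<mu> u + nrm \<mu> g + 1))"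
    have pos: "nrm \<mu> u + nrm \<mu> g + 1 > 0" by (simp add: add_nonneg_pos)
    then have \<delta>: "\<delta> > 0" using e by (simp add: \<delta>_def)
    obtain p p' where p: "real_polynomial_function p" "real_polynomial_function p'"
      "\<And>x. (p has_real_derivative p' x) (at x)" "p (-1) = 0" "p 1 = 0"
      "\<And>x. x \<in> I \<Longrightarrow> \<bar>\<Psi> x - p x\<bar> \<le> \<delta>" "\<And>x. x \<in> I \<Longrightarrow> \<bar>\<Psi>' x - p' x\<bar> \<le> \<delta>"
      using C1_polynomial_approx[OF c d 0 \<delta>] by blast
    obtain \<phi> where \<phi>: "test_fun \<phi>" "nrm \<mu> (\<lambda>x. p x - \<phi> x) \<le> \<delta>" "nrm \<mu> (\<lambda>x. p' x - deriv \<phi> x) \<le> \<delta>"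
      using polynomial_test_approx[OF p(1-5) \<delta>] by blast
    have cc: "continuous_on {-1..1} p" "continuous_on {-1..1} p'" "continuous_on {-1..1} \<phi>" "continuous_on {-1..1} (deriv \<phi>)"
      using test_funE[OF \<phi>(1)] continuous_on_subset[OF _ subset_UNIV] by (metis polynomial_continuous p(1,2))+
    note sq = cc[THEN continuous_sq_int_\<mu>]
    have 1: "nrm \<mu> (\<lambda>x. \<Psi> x - \<phi> x) \<le> 3 * \<delta>"
      using nrm_triangle3[OF sc(1) sq(1) sq(3)] \<phi>(2)
        nrm_le_sup[OF borel_measurable_diff[OF sc(1)[THEN sq_int_measurable] sq(1)[THEN sq_int_measurable]] p(6)] by simp
    have 2: "nrm \<mu> (\<lambda>x. \<Psi>' x - deriv \<phi> x) \<le> 3 * \<delta>"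
      using nrm_triangle3[OF sc(2) sq(2) sq(4)] \<phi>(3)
        nrm_le_sup[OF borel_measurable_diff[OF sc(2)[THEN sq_int_measurable] sq(2)[THEN sq_int_measurable]] p(7)] by simp
    have "(\<integral>x. u x * deriv \<phi> x \<partial>\<mu>) = - (\<integral>x. g x * \<phi> x \<partial>\<mu>)"
      using w \<phi>(1) by (simp add: weak_deriv_def intI_eq)
    then have A: "A = (\<integral>x. u x * (\<Psi>' x - deriv \<phi> x) \<partial>\<mu>) + (\<integral>x. g x * (\<Psi> x - \<phi> x) \<partial>\<mu>)"
      unfolding A_def right_diff_distrib
      using u g sc sq by (simp add: sq_int_mult)
    have "\<bar>A\<bar> \<le> nrm \<mu> u * nrm \<mu> (\<lambda>x. \<Psi>' x - deriv \<phi> x) + nrm \<mu> g * nrm \<mu> (\<lambda>x. \<Psi> x - \<phi> x)"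
      unfolding A by (intro order_trans[OF abs_triangle_ineq] add_mono Cauchy_Schwarz_integral u g sq_int_diff sc sq)
    also have "\<dots> \<le> nrm \<mu> u * (3 * \<delta>) + nrm \<mu> g * (3 * \<delta>)"
      by (intro add_mono mult_left_mono 1 2) auto
    also have "\<dots> = (nrm \<mu> u + nrm \<mu> g) * (3 * \<delta>)" by (simp add: distrib_right)
    also have "\<dots> \<le> (nrm \<mu> u + nrm \<mu> g + 1) * (3 * \<delta>)" using \<delta> by (intro mult_right_mono) auto
    also have "\<dots> = e" using pos unfolding \<delta>_def by (simp del: distrib_left_numeral distrib_right_numeral)
    finally show ?thesis by simp
  qed
  then have "\<bar>A\<bar> \<le> 0" by (rule field_le_epsilon)
  then show ?thesis by (simp add: A_def)
qed

subsection \<open>The energy space\<close>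

text \<open>With the square root of the weight as a factor, weighted norms become plain \<open>L\<^sup>2\<close> norms.\<close>
definition rw :: "real \<Rightarrow> real" where "rw x = sqrt (omega x)"

lemma omega_bounds: "x \<in> I \<Longrightarrow> 0 < omega x" "omega x \<le> 1"
  by (auto simp: omega_def I_def abs_square_less_1 abs_less_iff)

lemma rw_square: "x \<in> I \<Longrightarrow> rw x * rw x = omega x" "x \<in> I \<Longrightarrow> (rw x)\<^sup>2 = omega x"
  using omega_bounds[of x] by (auto simp: rw_def)

lemma continuous_omega: "continuous_on S omega"
  unfolding omega_def[abs_def] by (intro continuous_intros)

lemma continuous_rw: "continuous_on S rw"
  unfolding rw_def[abs_def] by (intro continuous_intros continuous_omega)

lemma rw_bounds: "x \<in> I \<Longrightarrow> 0 < rw x" "x \<in> I \<Longrightarrow> \<bar>rw x\<bar> \<le> 1"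
  using omega_bounds[of x] by (auto simp: rw_def)

lemma rw_measurable [measurable]: "rw \<in> borel_measurable \<mu>"
  by (intro continuous_measurable_\<mu> continuous_rw)

lemma rw_sq_int: "sq_int \<mu> f \<Longrightarrow> sq_int \<mu> (\<lambda>x. rw x * f x)"
  by (intro sq_int_continuous_mult continuous_rw)

lemma nrm_rw_le:
  assumes "sq_int \<mu> f" shows "nrm \<mu> (\<lambda>x. rw x * f x) \<le> nrm \<mu> f"
  unfolding nrm_def
proof (intro real_sqrt_le_mono integral_mono)
  fix x assume "x \<in> space \<mu>"
  then have "(rw x)\<^sup>2 \<le> 1" using rw_square(2)[of x] omega_bounds(2)[of x] by simp
  then show "(rw x * f x)\<^sup>2 \<le> (f x)\<^sup>2" by (simp add: power_mult_distrib mult_left_le_one_le)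
qed (use assms rw_sq_int[OF assms] in \<open>auto simp: sq_int_square\<close>)

lemma V_norm_eq:
  assumes "weak_deriv u g"
  shows "V_norm u = nrm \<mu> (\<lambda>x. rw x * g x)"
proof -
  have "V_norm u = nrm \<mu> (\<lambda>x. rw x * wderiv u x)"
    unfolding V_norm_def nrm_def intI_eq
    by (intro arg_cong[of _ _ sqrt] Bochner_Integration.integral_cong) (auto simp: power_mult_distrib rw_square)
  also have "\<dots> = nrm \<mu> (\<lambda>x. rw x * g x)"
    using wderiv_AE[OF assms] assms
    by (intro nrm_cong_AE borel_measurable_times rw_measurable)
       (auto simp: weak_deriv_def intro: loc_integrable_measurable)
  finally show ?thesis .
qed

lemma a_eq:
  assumes "weak_deriv u g" "weak_deriv v h"
  shows "a u v = (\<integral>x. omega x * g x * h x \<partial>\<mu>)"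
  unfolding a_def intI_eq
proof (rule integral_cong_AE)
  note m = continuous_measurable_\<mu>[OF continuous_omega] wderiv_AE(2)[OF assms(1)] wderiv_AE(2)[OF assms(2)]
     assms[unfolded weak_deriv_def, THEN conjunct2, THEN conjunct1, THEN loc_integrable_measurable]
  show "(\<lambda>x. omega x * wderiv u x * wderiv v x) \<in> borel_measurable \<mu>"
    "(\<lambda>x. omega x * g x * h x) \<in> borel_measurable \<mu>" by (intro borel_measurable_times m)+
  show "AE x in \<mu>. omega x * wderiv u x * wderiv v x = omega x * g x * h x"
    using wderiv_AE(1)[OF assms(1)] wderiv_AE(1)[OF assms(2)] by eventually_elim simp
qed

lemma tendsto_0_le_bound:
  fixes f g :: "nat \<Rightarrow> real"
  assumes "\<And>n. f n \<le> g n" "\<And>n. 0 \<le> f n" "g \<longlonglongrightarrow> 0"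
  shows "f \<longlonglongrightarrow> 0"
  by (rule tendsto_sandwich[OF _ _ tendsto_const assms(3)]) (use assms in auto)

text \<open>Makes discrete test functions admissible in the continuous problem, which is what yields
  Galerkin orthogonality.\<close>

lemma polynomial_in_V:
  assumes p: "real_polynomial_function p" "real_polynomial_function p'"
    "\<And>x. (p has_real_derivative p' x) (at x)" "p (-1) = 0" "p 1 = 0"
  shows "p \<in> V"
proof -
  have w: "weak_deriv p p'"
    by (rule weak_deriv_classical) (auto intro: polynomial_continuous p)
  have sp: "sq_int \<mu> p" "sq_int \<mu> p'"
    using p by (auto intro: continuous_sq_int_\<mu> polynomial_continuous)
  note ae = wderiv_AE[OF w]
  have m: "p' \<in> borel_measurable \<mu>" by (intro continuous_measurable_\<mu> polynomial_continuous p)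
  have om: "omega \<in> borel_measurable \<mu>" by (intro continuous_measurable_\<mu> continuous_omega)
  have i: "integrable \<mu> (\<lambda>x. omega x * (p' x)\<^sup>2)"
    by (intro continuous_integrable_\<mu> continuous_intros continuous_omega polynomial_continuous p)
  have 1: "integrable \<mu> (\<lambda>x. omega x * (wderiv p x)\<^sup>2)"
    by (rule integrable_cong_AE_imp[OF i]) (use ae om in \<open>auto elim!: eventually_mono\<close>)
  have "\<exists>\<phi>. test_fun \<phi> \<and> nrm \<mu> (\<lambda>x. p x - \<phi> x) \<le> 1 / Suc n \<and> nrm \<mu> (\<lambda>x. p' x - deriv \<phi> x) \<le> 1 / Suc n" for n :: nat
    using polynomial_test_approx[OF p, of "1 / Suc n"] by (metis of_nat_0_less_iff zero_less_Suc zero_less_divide_1_iff)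
  then obtain \<phi> where \<phi>: "\<And>n. test_fun (\<phi> n)" "\<And>n. nrm \<mu> (\<lambda>x. p x - \<phi> n x) \<le> 1 / Suc n"
    "\<And>n. nrm \<mu> (\<lambda>x. p' x - deriv (\<phi> n) x) \<le> 1 / Suc n" for n :: nat
    by metis
  have sphi: "sq_int \<mu> (\<phi> n)" "sq_int \<mu> (deriv (\<phi> n))" for n
    using test_funE[OF \<phi>(1)[of n]] continuous_on_subset[OF _ subset_UNIV] by (metis continuous_sq_int_\<mu>)+
  have "intI (\<lambda>x. (p x - \<phi> n x)\<^sup>2 + omega x * (wderiv p x - deriv (\<phi> n) x)\<^sup>2) \<le> 2 * (1 / Suc n)\<^sup>2" for n
  proof -
    have "intI (\<lambda>x. (p x - \<phi> n x)\<^sup>2 + omega x * (wderiv p x - deriv (\<phi> n) x)\<^sup>2)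
       = (\<integral>x. (p x - \<phi> n x)\<^sup>2 + (rw x * (p' x - deriv (\<phi> n) x))\<^sup>2 \<partial>\<mu>)"
      unfolding intI_eq
    proof (rule integral_cong_AE)
      show "AE x in \<mu>. (p x - \<phi> n x)\<^sup>2 + omega x * (wderiv p x - deriv (\<phi> n) x)\<^sup>2 =
            (p x - \<phi> n x)\<^sup>2 + (rw x * (p' x - deriv (\<phi> n) x))\<^sup>2"
        using ae(1) AE_space by eventually_elim (simp add: rw_square power_mult_distrib)
    qed (intro borel_measurable_add borel_measurable_power borel_measurable_times borel_measurable_diff
          ae(2) m om rw_measurable sphi sp sq_int_measurable)+
    also have "\<dots> = (nrm \<mu> (\<lambda>x. p x - \<phi> n x))\<^sup>2 + (nrm \<mu> (\<lambda>x. rw x * (p' x - deriv (\<phi> n) x)))\<^sup>2"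
      unfolding nrm_square
      by (intro Bochner_Integration.integral_add sq_int_square rw_sq_int sq_int_diff sp sphi)
    also have "\<dots> \<le> (1 / Suc n)\<^sup>2 + (1 / Suc n)\<^sup>2"
      by (intro add_mono power_mono \<phi> order_trans[OF nrm_rw_le \<phi>(3)] sq_int_diff sp sphi) auto
    finally show ?thesis by simp
  qed
  moreover have "0 \<le> intI (\<lambda>x. (p x - \<phi> n x)\<^sup>2 + omega x * (wderiv p x - deriv (\<phi> n) x)\<^sup>2)" for n
    unfolding intI_eq
    by (intro integral_nonneg_AE AE_I2 add_nonneg_nonneg mult_nonneg_nonneg zero_le_power2)
       (simp add: omega_bounds less_imp_le)
  moreover have "(\<lambda>n. 2 * (1 / real (Suc n))\<^sup>2) \<longlonglongrightarrow> 0"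
    using LIMSEQ_inverse_real_of_nat by (simp add: inverse_eq_divide del: of_nat_Suc)
  ultimately have "(\<lambda>n. intI (\<lambda>x. (p x - \<phi> n x)\<^sup>2 + omega x * (wderiv p x - deriv (\<phi> n) x)\<^sup>2)) \<longlonglongrightarrow> 0"
    by (rule tendsto_0_le_bound)
  then have "\<exists>\<phi>. (\<forall>n. test_fun (\<phi> n)) \<and>
      (\<lambda>n. intI (\<lambda>x. (p x - \<phi> n x)\<^sup>2 + omega x * (wderiv p x - deriv (\<phi> n) x)\<^sup>2)) \<longlonglongrightarrow> 0"
    using \<phi>(1) by blast
  moreover have "has_weak_deriv p" using w has_weak_deriv_def by blast
  ultimately show ?thesis
    using sp(1) 1 unfolding V_def L2_eq set_integrable_\<mu> by blast
qed

text \<open>Trades the test functions in the definition of \<open>V\<close> for polynomials, which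
  have finite Chebyshev expansions while still vanishing at the endpoints.\<close>

lemma V_polynomial_approx:
  assumes u: "u \<in> V" "weak_deriv u g" and e: "e > 0"
  obtains p p' where "real_polynomial_function p" "real_polynomial_function p'"
    "\<And>x. (p has_real_derivative p' x) (at x)" "p (-1) = 0" "p 1 = 0"
    "nrm \<mu> (\<lambda>x. u x - p x) \<le> e" "nrm \<mu> (\<lambda>x. rw x * (g x - p' x)) \<le> e"
proof -
  note ae = wderiv_AE[OF u(2)]
  have gm: "g \<in> borel_measurable \<mu>"
    using u(2) by (simp add: weak_deriv_def loc_integrable_measurable)
  have su: "sq_int \<mu> u" using u by (simp add: V_def L2_eq)
  have sg: "sq_int \<mu> (\<lambda>x. rw x * wderiv u x)"
  proof -
    have "integrable \<mu> (\<lambda>x. omega x * (wderiv u x)\<^sup>2)" using u by (simp add: V_def set_integrable_\<mu>)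
    also have "?this \<longleftrightarrow> integrable \<mu> (\<lambda>x. (rw x * wderiv u x)\<^sup>2)"
      by (intro Bochner_Integration.integrable_cong) (auto simp: power_mult_distrib rw_square)
    finally show ?thesis using ae(2) by (simp add: sq_int_def)
  qed
  obtain \<phi> :: "nat \<Rightarrow> real \<Rightarrow> real" where \<phi>: "\<And>n. test_fun (\<phi> n)"
    "(\<lambda>n. intI (\<lambda>x. (u x - \<phi> n x)\<^sup>2 + omega x * (wderiv u x - deriv (\<phi> n) x)\<^sup>2)) \<longlonglongrightarrow> 0"
    using u by (auto simp: V_def)
  \<comment> \<open>One third of \<open>e\<close> pays for the test function, two thirds for its
    polynomial approximation, whose uniform error \<open>e/3\<close> is doubled by
    \<open>nrm_le_sup\<close>.\<close>
  have "(e/3)\<^sup>2 > 0" using e by simp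
  from order_tendstoD(2)[OF \<phi>(2) this] obtain n where
    n: "intI (\<lambda>x. (u x - \<phi> n x)\<^sup>2 + omega x * (wderiv u x - deriv (\<phi> n) x)\<^sup>2) < (e/3)\<^sup>2"
    unfolding eventually_sequentially by blast
  have c: "continuous_on {-1..1} (\<phi> n)" "continuous_on {-1..1} (deriv (\<phi> n))"
    using test_funE[OF \<phi>(1)[of n]] continuous_on_subset[OF _ subset_UNIV] by metis+
  note sphi = c[THEN continuous_sq_int_\<mu>]
  have sd: "sq_int \<mu> (\<lambda>x. rw x * (wderiv u x - deriv (\<phi> n) x))"
    unfolding right_diff_distrib by (intro sq_int_diff sg rw_sq_int sphi)
  have "intI (\<lambda>x. (u x - \<phi> n x)\<^sup>2 + omega x * (wderiv u x - deriv (\<phi> n) x)\<^sup>2)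
     = (\<integral>x. (u x - \<phi> n x)\<^sup>2 + (rw x * (wderiv u x - deriv (\<phi> n) x))\<^sup>2 \<partial>\<mu>)"
    unfolding intI_eq by (intro Bochner_Integration.integral_cong) (auto simp: power_mult_distrib rw_square)
  also have "\<dots> = (nrm \<mu> (\<lambda>x. u x - \<phi> n x))\<^sup>2 + (nrm \<mu> (\<lambda>x. rw x * (wderiv u x - deriv (\<phi> n) x)))\<^sup>2"
    unfolding nrm_square
    by (intro Bochner_Integration.integral_add sq_int_square sd sq_int_diff su sphi)
  finally have "(nrm \<mu> (\<lambda>x. u x - \<phi> n x))\<^sup>2 + (nrm \<mu> (\<lambda>x. rw x * (wderiv u x - deriv (\<phi> n) x)))\<^sup>2 < (e/3)\<^sup>2"
    using n by simp
  then have "(nrm \<mu> (\<lambda>x. u x - \<phi> n x))\<^sup>2 < (e/3)\<^sup>2" "(nrm \<mu> (\<lambda>x. rw x * (wderiv u x - deriv (\<phi> n) x)))\<^sup>2 < (e/3)\<^sup>2"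
    using zero_le_power2 by (smt (verit))+
  then have n1: "nrm \<mu> (\<lambda>x. u x - \<phi> n x) < e/3" and n2: "nrm \<mu> (\<lambda>x. rw x * (wderiv u x - deriv (\<phi> n) x)) < e/3"
    using e by (auto dest!: power_less_imp_less_base)
  have e3: "e/3 > 0" using e by simp
  have phi1: "\<phi> n (-1) = 0" "\<phi> n 1 = 0" and dphi: "\<And>x. x \<in> I \<Longrightarrow> (\<phi> n has_real_derivative deriv (\<phi> n) x) (at x)"
    using test_funE[OF \<phi>(1)[of n]] by (metis atLeastAtMost_iff not_less)+
  obtain p p' where p: "real_polynomial_function p" "real_polynomial_function p'"
    "\<And>x. (p has_real_derivative p' x) (at x)" "p (-1) = 0" "p 1 = 0"
    "\<And>x. x \<in> I \<Longrightarrow> \<bar>\<phi> n x - p x\<bar> \<le> e/3" "\<And>x. x \<in> I \<Longrightarrow> \<bar>deriv (\<phi> n) x - p' x\<bar> \<le> e/3"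
    using C1_polynomial_approx[OF c dphi phi1 e3] by blast
  have sp: "sq_int \<mu> p" "sq_int \<mu> p'"
    using p by (auto intro: continuous_sq_int_\<mu> polynomial_continuous)
  show ?thesis
  proof (rule that[OF p(1-5)])
    have "nrm \<mu> (\<lambda>x. \<phi> n x - p x) \<le> 2 * (e/3)"
      by (intro nrm_le_sup borel_measurable_diff sq_int_measurable sp sphi p(6))
    then show "nrm \<mu> (\<lambda>x. u x - p x) \<le> e"
      using nrm_triangle3[OF su sphi(1) sp(1)] n1 by simp
    have "nrm \<mu> (\<lambda>x. rw x * (deriv (\<phi> n) x - p' x)) \<le> nrm \<mu> (\<lambda>x. deriv (\<phi> n) x - p' x)"
      by (intro nrm_rw_le sq_int_diff sp sphi)
    also have "\<dots> \<le> 2 * (e/3)"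
      by (intro nrm_le_sup borel_measurable_diff sq_int_measurable sp sphi p(7))
    finally have "nrm \<mu> (\<lambda>x. rw x * wderiv u x - rw x * p' x) \<le> e"
      using nrm_triangle3[OF sg rw_sq_int[OF sphi(2)] rw_sq_int[OF sp(2)]] n2 by (simp add: right_diff_distrib)
    also have "nrm \<mu> (\<lambda>x. rw x * wderiv u x - rw x * p' x) = nrm \<mu> (\<lambda>x. rw x * (g x - p' x))"
      using ae(1) by (intro nrm_cong_AE borel_measurable_times borel_measurable_diff rw_measurable ae(2) gm sp sq_int_measurable)
        (auto simp: right_diff_distrib elim!: eventually_mono)
    finally show "nrm \<mu> (\<lambda>x. rw x * (g x - p' x)) \<le> e" .
  qed
qed

subsection \<open>Chebyshev polynomials\<close>

text \<open>The index is shifted: \<open>chebU k\<close> is the Chebyshev polynomial of the second kind of degree \<open>k - 1\<close>,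
  so that \<open>omega * chebU k\<close> becomes \<open>sin (k \<theta>)\<close> under \<open>x = cos \<theta>\<close>.\<close>
fun chebU :: "nat \<Rightarrow> real \<Rightarrow> real" where
  "chebU 0 x = 0"
| "chebU (Suc 0) x = 1"
| "chebU (Suc (Suc n)) x = 2 * x * chebU (Suc n) x - chebU n x"

lemma cheb_cos: "x \<in> {-1..1} \<Longrightarrow> cheb k x = cos (real k * arccos x)"
proof (induction k x rule: cheb.induct)
  case (3 n x)
  define t where "t = arccos x"
  have x: "x = cos t" using 3 by (simp add: t_def)
  have "cos (real (Suc n) * t + t) + cos (real (Suc n) * t - t) = 2 * cos t * cos (real (Suc n) * t)"
    by (simp add: cos_add cos_diff)
  then have "cos (real (Suc (Suc n)) * t) + cos (real n * t) = 2 * x * cos (real (Suc n) * t)"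
    by (simp add: x algebra_simps)
  then show ?case using 3 by (simp add: t_def)
qed auto

lemma chebU_sin: "x \<in> {-1..1} \<Longrightarrow> omega x * chebU k x = sin (real k * arccos x)"
proof (induction k x rule: chebU.induct)
  case (2 x) then show ?case by (simp add: omega_def sin_arccos)
next
  case (3 n x)
  define t where "t = arccos x"
  have x: "x = cos t" using 3 by (simp add: t_def)
  have "sin (real (Suc n) * t + t) + sin (real (Suc n) * t - t) = 2 * cos t * sin (real (Suc n) * t)"
    by (simp add: sin_add sin_diff)
  then have "sin (real (Suc (Suc n)) * t) + sin (real n * t) = 2 * x * sin (real (Suc n) * t)"
    by (simp add: x algebra_simps)
  moreover have "omega x * chebU (Suc (Suc n)) x = 2 * x * (omega x * chebU (Suc n) x) - omega x * chebU n x"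
    by (simp add: algebra_simps)
  ultimately show ?case using 3 by (simp add: t_def)
qed auto

lemma polynomial_ident: "real_polynomial_function (\<lambda>x::real. x)"
  by (rule real_polynomial_function.intros(1)) simp

lemma cheb_Suc_Suc: "cheb (Suc (Suc n)) = (\<lambda>x. (2 * x) * cheb (Suc n) x - cheb n x)"
  "cheb 0 = (\<lambda>x. 1)" "cheb (Suc 0) = (\<lambda>x. x)"
  by auto

lemma chebU_Suc_Suc: "chebU (Suc (Suc n)) = (\<lambda>x. (2 * x) * chebU (Suc n) x - chebU n x)"
  "chebU 0 = (\<lambda>x. 0)" "chebU (Suc 0) = (\<lambda>x. 1)"
  by auto

lemma polynomial_cheb: "real_polynomial_function (cheb k)"
proof (induction k rule: induct_nat_012)
  case (ge2 n)
  then show ?case unfolding cheb_Suc_Suc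
    by (intro real_polynomial_function_diff real_polynomial_function.intros(2-) polynomial_ident)
qed (auto simp: cheb_Suc_Suc intro: real_polynomial_function.intros polynomial_ident)

lemma polynomial_chebU: "real_polynomial_function (chebU k)"
proof (induction k rule: induct_nat_012)
  case (ge2 n)
  then show ?case unfolding chebU_Suc_Suc
    by (intro real_polynomial_function_diff real_polynomial_function.intros(2-) polynomial_ident)
qed (auto simp: chebU_Suc_Suc intro: real_polynomial_function.intros)

text \<open>Rewrites the extra term \<open>2 * cheb (Suc n) x\<close> that the product rule creates
  in the recurrence, which closes the induction in \<open>DERIV_cheb\<close>.\<close>

lemma cheb_eq_chebU: "cheb (Suc k) x = x * chebU (Suc k) x - chebU k x"
proof (induction k rule: induct_nat_012)
  case (ge2 n)
  have "cheb (Suc (Suc (Suc n))) x = 2 * x * cheb (Suc (Suc n)) x - cheb (Suc n) x"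
    by (rule cheb.simps)
  also have "\<dots> = 2 * x * (x * chebU (Suc (Suc n)) x - chebU (Suc n) x) - (x * chebU (Suc n) x - chebU n x)"
    by (simp only: ge2)
  also have "\<dots> = x * (2 * x * chebU (Suc (Suc n)) x - chebU (Suc n) x) - (2 * x * chebU (Suc n) x - chebU n x)"
    by (simp add: algebra_simps del: chebU.simps)
  finally show ?case by (simp only: chebU.simps)
qed (auto simp: algebra_simps)

lemma DERIV_cheb: "(cheb k has_real_derivative real k * chebU k x) (at x)"
proof (induction k rule: induct_nat_012)
  case (ge2 n)
  show ?case unfolding cheb_Suc_Suc
    by (rule derivative_eq_intros ge2 refl)+ (simp add: cheb_eq_chebU algebra_simps)
qed (auto simp: cheb_Suc_Suc intro: derivative_eq_intros)

lemma cheb_one [simp]: "cheb k 1 = 1"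
  by (induction k rule: induct_nat_012) auto

lemma cheb_minus_one: "cheb k (-1) = (-1) ^ k"
  by (induction k rule: induct_nat_012) auto

lemma abs_cheb_le: "x \<in> {-1..1} \<Longrightarrow> \<bar>cheb k x\<bar> \<le> 1"
  by (simp add: cheb_cos)

lemma continuous_cheb: "continuous_on S (cheb k)" "continuous_on S (chebU k)"
  by (intro polynomial_continuous polynomial_cheb polynomial_chebU)+

lemma mult_cheb: "x * cheb (Suc k) x = (cheb (Suc (Suc k)) x + cheb k x) / 2"
  by simp

inductive_set cheb_span :: "(real \<Rightarrow> real) set" where
  cheb: "cheb k \<in> cheb_span"
| add: "f \<in> cheb_span \<Longrightarrow> g \<in> cheb_span \<Longrightarrow> (\<lambda>x. f x + g x) \<in> cheb_span"
| cmult: "f \<in> cheb_span \<Longrightarrow> (\<lambda>x. c * f x) \<in> cheb_span"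

lemma cheb_span_mult_x: "f \<in> cheb_span \<Longrightarrow> (\<lambda>x. x * f x) \<in> cheb_span"
proof (induction rule: cheb_span.induct)
  case (cheb k)
  show ?case
  proof (cases k)
    case 0 then show ?thesis using cheb_span.cheb[of 1] by (simp add: cheb_Suc_Suc)
  next
    case (Suc l)
    have "(\<lambda>x. (1/2) * (cheb (Suc (Suc l)) x + cheb l x)) \<in> cheb_span"
      by (intro cheb_span.intros)
    also have "(\<lambda>x. (1/2) * (cheb (Suc (Suc l)) x + cheb l x)) = (\<lambda>x. x * cheb k x)"
      unfolding Suc mult_cheb by simp
    finally show ?thesis .
  qed
next
  case (add f g) then show ?case using cheb_span.add[OF add.IH] by (simp add: distrib_left)
next
  case (cmult f c) then show ?case using cheb_span.cmult[OF cmult.IH, of c] by (simp add: mult.left_commute)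
qed

lemma polynomial_cheb_span:
  assumes "real_polynomial_function (p :: real \<Rightarrow> real)"
  shows "p \<in> cheb_span"
proof -
  obtain c n where p: "p = (\<lambda>x. \<Sum>i\<le>n. c i * x^i)"
    using assms real_polynomial_function_iff_sum by auto
  have pow: "(\<lambda>x. x ^ i) \<in> cheb_span" for i
  proof (induction i)
    case 0 then show ?case using cheb_span.cheb[of 0] by (simp add: cheb_Suc_Suc)
  next
    case (Suc i) then show ?case using cheb_span_mult_x by simp
  qed
  have "(\<lambda>x. \<Sum>i\<le>n. c i * x^i) \<in> cheb_span"
  proof (induction n)
    case 0 then show ?case using cheb_span.cmult[OF pow[of 0], of "c 0"] by simp
  next
    case (Suc n)
    then show ?case using cheb_span.add[OF Suc cheb_span.cmult[OF pow[of "Suc n"], of "c (Suc n)"]] by simp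
  qed
  then show ?thesis using p by simp
qed

text \<open>One coefficient sequence serves all large \<open>M\<close>. This lets expansions of
  different lengths be added, and later be compared with every sufficiently long partial
  sum.\<close>

lemma cheb_span_sum:
  assumes "f \<in> cheb_span"
  shows "\<exists>n c. \<forall>M\<ge>n. f = (\<lambda>x. \<Sum>k\<le>M. c k * cheb k x)"
  using assms
proof (induction rule: cheb_span.induct)
  case (cheb k)
  have "cheb k = (\<lambda>x. \<Sum>i\<le>M. (if i = k then 1 else 0) * cheb i x)" if "M \<ge> k" for M
  proof
    fix x
    have "(\<Sum>i\<le>M. (if i = k then 1 else 0) * cheb i x) = (\<Sum>i\<le>M. if i = k then cheb i x else 0)"
      by (intro sum.cong) auto
    also have "\<dots> = cheb k x" by (subst sum.delta) (use that in auto)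
    finally show "cheb k x = (\<Sum>i\<le>M. (if i = k then 1 else 0) * cheb i x)" by (rule sym)
  qed
  then show ?case by (intro exI[of _ "k"] exI[of _ "\<lambda>i. if i = k then 1 else 0"] allI impI)
next
  case (add f g)
  then obtain n c n' c' where *: "\<forall>M\<ge>n. f = (\<lambda>x. \<Sum>k\<le>M. c k * cheb k x)" "\<forall>M\<ge>n'. g = (\<lambda>x. \<Sum>k\<le>M. c' k * cheb k x)"
    by blast
  have "(\<lambda>x. f x + g x) = (\<lambda>x. \<Sum>k\<le>M. (c k + c' k) * cheb k x)" if "M \<ge> max n n'" for M
    using *(1)[rule_format, of M] *(2)[rule_format, of M] that by (simp add: distrib_right sum.distrib)
  then show ?case by (intro exI[of _ "max n n'"] exI[of _ "\<lambda>k. c k + c' k"] allI impI)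
next
  case (cmult f d)
  then obtain n c where *: "\<forall>M\<ge>n. f = (\<lambda>x. \<Sum>k\<le>M. c k * cheb k x)"
    by blast
  have "(\<lambda>x. d * f x) = (\<lambda>x. \<Sum>k\<le>M. (d * c k) * cheb k x)" if "M \<ge> n" for M
    using *[rule_format, of M] that by (simp add: sum_distrib_left mult.assoc)
  then show ?case by (intro exI[of _ "n"] exI[of _ "\<lambda>k. d * c k"] allI impI)
qed

subsection \<open>Orthogonality\<close>

text \<open>Antiderivative of \<open>cos (n \<theta>)\<close> with respect to \<open>\<theta> = arccos x\<close>, vanishing at \<open>x = 1\<close>.\<close>
definition anti :: "int \<Rightarrow> real \<Rightarrow> real" where
  "anti n x = (if n = 0 then arccos x else sin (n * arccos x) / n)"

lemma continuous_arccos: "continuous_on {-1..1} arccos"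
  by (rule continuous_on_arccos') 

lemma anti_continuous: "continuous_on {-1..1} (anti n)"
  unfolding anti_def[abs_def] by (cases "n = 0") (auto intro!: continuous_intros continuous_arccos)

lemma anti_deriv:
  assumes "x \<in> I"
  shows "(anti n has_real_derivative - (cos (n * arccos x) / omega x)) (at x)"
proof -
  have x: "-1 < x" "x < 1" using assms by (auto simp: I_def)
  show ?thesis
  proof (cases "n = 0")
    case True
    then show ?thesis unfolding anti_def[abs_def] omega_def
      using DERIV_arccos[OF x] by (simp add: inverse_eq_divide)
  next
    case False
    then show ?thesis unfolding anti_def[abs_def] omega_def
      by (auto intro!: derivative_eq_intros DERIV_arccos x simp: inverse_eq_divide)
  qed
qed

lemma anti_endpoints: "anti n 1 = 0" "anti n (-1) = (if n = 0 then pi else 0)"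
  by (auto simp: anti_def sin_npi_int mult.commute)

text \<open>No change of variables is performed: the product-to-sum formula turns the integrand into
  a difference of cosines divided by \<open>omega\<close>, whose antiderivatives are the functions
  \<open>anti\<close>. Only \<open>j = k\<close> produces an \<open>anti 0\<close>, hence a nonzero
  value.\<close>

lemma chebU_orthogonal:
  assumes "1 \<le> j" "1 \<le> k"
  shows "(\<integral>x. omega x * chebU j x * chebU k x \<partial>\<mu>) = (if j = k then pi / 2 else 0)"
proof -
  define F where "F x = (anti (int j + int k) x - anti (int j - int k) x) / 2" for x
  have "(\<integral>x. omega x * chebU j x * chebU k x \<partial>\<mu>) = F 1 - F (-1)"
  proof (rule integral_\<mu>_FTC)
    show "continuous_on {-1..1} (\<lambda>x. omega x * chebU j x * chebU k x)"
      by (intro continuous_intros continuous_omega continuous_cheb)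
    show "continuous_on {-1..1} F" unfolding F_def by (intro continuous_intros anti_continuous) auto
    fix x assume x: "x \<in> I"
    define t where "t = arccos x"
    have w: "omega x > 0" using omega_bounds(1)[OF x] .
    have "(F has_real_derivative (- (cos ((int j + int k) * t) / omega x) - - (cos ((int j - int k) * t) / omega x)) / 2) (at x)"
      unfolding F_def t_def by (rule DERIV_cdivide[OF DERIV_diff[OF anti_deriv[OF x] anti_deriv[OF x]]])
    also have "(- (cos ((int j + int k) * t) / omega x) - - (cos ((int j - int k) * t) / omega x)) / 2 = (cos (j * t - k * t) - cos (j * t + k * t)) / 2 / omega x"
      by (simp add: distrib_right left_diff_distrib diff_divide_distrib)
    also have "(cos (j * t - k * t) - cos (j * t + k * t)) / 2 = sin (j * t) * sin (k * t)"
      by (simp only: sin_times_sin)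
    also have "sin (j * t) * sin (k * t) / omega x = (omega x * chebU j x) * (omega x * chebU k x) / omega x"
      unfolding t_def chebU_sin[OF I_subset[OF x]] ..
    also have "\<dots> = omega x * chebU j x * chebU k x" using w by simp
    finally show "(F has_real_derivative omega x * chebU j x * chebU k x) (at x)" .
  qed
  also have "F 1 - F (-1) = (if j = k then pi / 2 else 0)"
    using assms by (simp add: F_def anti_endpoints)
  finally show ?thesis .
qed

text \<open>The factor \<open>1 / omega\<close> is unbounded at the endpoints, so this is a gauge
  integral: its fundamental theorem only needs the antiderivative to be continuous up to the
  boundary.\<close>

lemma cheb_weighted_integral:
  assumes "1 \<le> j" "1 \<le> k"
  shows "((\<lambda>x. cheb j x * cheb k x / omega x) has_integral (if j = k then pi / 2 else 0)) I"
proof -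
  define F where "F x = - (anti (int j + int k) x + anti (int j - int k) x) / 2" for x
  have "((\<lambda>x. cheb j x * cheb k x / omega x) has_integral (F 1 - F (-1))) {-1..1}"
  proof (rule fundamental_theorem_of_calculus_interior)
    show "continuous_on {-1..1} F" unfolding F_def by (intro continuous_intros anti_continuous) auto
    fix x assume "x \<in> {-1<..<(1::real)}"
    then have x: "x \<in> I" by (simp add: I_def)
    define t where "t = arccos x"
    have "(F has_real_derivative (- (- (cos ((int j + int k) * t) / omega x) + - (cos ((int j - int k) * t) / omega x)) / 2)) (at x)"
      unfolding F_def t_def by (rule DERIV_cdivide[OF DERIV_minus[OF DERIV_add[OF anti_deriv[OF x] anti_deriv[OF x]]]])
    also have "(- (- (cos ((int j + int k) * t) / omega x) + - (cos ((int j - int k) * t) / omega x)) / 2) = (cos (j * t - k * t) + cos (j * t + k * t)) / 2 / omega x"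
      by (simp add: distrib_right left_diff_distrib add_divide_distrib)
    also have "(cos (j * t - k * t) + cos (j * t + k * t)) / 2 = cos (j * t) * cos (k * t)"
      by (simp only: cos_times_cos)
    also have "cos (j * t) * cos (k * t) / omega x = cheb j x * cheb k x / omega x"
      unfolding t_def cheb_cos[OF I_subset[OF x]] ..
    finally show "(F has_vector_derivative cheb j x * cheb k x / omega x) (at x)"
      by (simp add: has_real_derivative_iff_has_vector_derivative)
  qed simp
  moreover have "F 1 - F (-1) = (if j = k then pi / 2 else 0)"
    using assms by (simp add: F_def anti_endpoints)
  ultimately show ?thesis by (simp add: I_def has_integral_Icc_iff_Ioo)
qed

lemma double_sum_diagonal:
  fixes c :: "nat \<Rightarrow> real"
  assumes "finite K"
  shows "(\<Sum>j\<in>K. \<Sum>k\<in>K. c j * c k * (if j = k then s else 0)) = s * (\<Sum>k\<in>K. (c k)\<^sup>2)"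
proof -
  have "(\<Sum>k\<in>K. c j * c k * (if j = k then s else 0)) = s * (c j)\<^sup>2" if "j \<in> K" for j
  proof -
    have "(\<Sum>k\<in>K. c j * c k * (if j = k then s else 0)) = (\<Sum>k\<in>K. if j = k then c j * c k * s else 0)"
      by (intro sum.cong) auto
    also have "\<dots> = s * (c j)\<^sup>2" using assms that by (simp add: power2_eq_square)
    finally show ?thesis .
  qed
  then show ?thesis by (simp add: sum_distrib_left)
qed

text \<open>Orthogonality gives equality for the weight \<open>1 / omega\<close>, and this weight is
  at least 1.\<close>

lemma cheb_sum_nrm_le:
  assumes K: "finite K" "\<And>k. k \<in> K \<Longrightarrow> 1 \<le> k"
  shows "(nrm \<mu> (\<lambda>x. \<Sum>k\<in>K. c k * cheb k x))\<^sup>2 \<le> pi / 2 * (\<Sum>k\<in>K. (c k)\<^sup>2)"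
proof -
  define f where "f x = (\<Sum>k\<in>K. c k * cheb k x)" for x
  have "((\<lambda>x. \<Sum>j\<in>K. \<Sum>k\<in>K. (c j * c k) * (cheb j x * cheb k x / omega x)) has_integral
     (\<Sum>j\<in>K. \<Sum>k\<in>K. (c j * c k) * (if j = k then pi / 2 else 0))) I"
    by (intro has_integral_sum K has_integral_mult_right cheb_weighted_integral)
  also have "(\<lambda>x. \<Sum>j\<in>K. \<Sum>k\<in>K. (c j * c k) * (cheb j x * cheb k x / omega x)) = (\<lambda>x. (f x)\<^sup>2 / omega x)"
    unfolding f_def power2_eq_square sum_product sum_divide_distrib by (simp add: ac_simps)
  finally have 1: "((\<lambda>x. (f x)\<^sup>2 / omega x) has_integral (pi / 2 * (\<Sum>k\<in>K. (c k)\<^sup>2))) I"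
    using K by (simp add: double_sum_diagonal)
  have "set_integrable lborel I (\<lambda>x. (f x)\<^sup>2)"
    unfolding set_integrable_\<mu> f_def by (intro continuous_integrable_\<mu> continuous_intros continuous_cheb)
  from set_borel_integral_eq_integral[OF this] have "((\<lambda>x. (f x)\<^sup>2) has_integral (\<integral>x. (f x)\<^sup>2 \<partial>\<mu>)) I"
    by (metis has_integral_integral intI_def intI_eq)
  then have "(\<integral>x. (f x)\<^sup>2 \<partial>\<mu>) \<le> pi / 2 * (\<Sum>k\<in>K. (c k)\<^sup>2)"
  proof (rule has_integral_le[OF _ 1])
    fix x assume "x \<in> I"
    then show "(f x)\<^sup>2 \<le> (f x)\<^sup>2 / omega x"
      using omega_bounds[of x] by (simp add: field_simps mult_left_le_one_le)
  qed
  then show ?thesis by (simp add: nrm_square f_def)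
qed

text \<open>\<open>fc h k\<close> is the sine coefficient \<open>\<integral> h(x) sin (k \<theta>) dx\<close>. Unlike \<open>\<integral> h T\<^sub>k / \<omega>\<close> it is defined for every
  square integrable \<open>h\<close>, in particular for the highest weak derivative of \<open>u\<close>.\<close>
definition fc :: "(real \<Rightarrow> real) \<Rightarrow> nat \<Rightarrow> real" where
  "fc h k = (\<integral>x. (rw x * h x) * (rw x * chebU k x) \<partial>\<mu>)"

lemma chebU_sq_int: "sq_int \<mu> (\<lambda>x. rw x * chebU k x)"
  by (intro continuous_sq_int_\<mu> continuous_intros continuous_rw continuous_cheb)

lemma rw_chebU_orthogonal:
  assumes "1 \<le> j" "1 \<le> k"
  shows "(\<integral>x. (rw x * chebU j x) * (rw x * chebU k x) \<partial>\<mu>) = (if j = k then pi / 2 else 0)"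
proof -
  have "(\<integral>x. (rw x * chebU j x) * (rw x * chebU k x) \<partial>\<mu>) = (\<integral>x. omega x * chebU j x * chebU k x \<partial>\<mu>)"
    by (intro Bochner_Integration.integral_cong) (simp_all add: rw_square(1)[symmetric])
  then show ?thesis using chebU_orthogonal[OF assms] by simp
qed

text \<open>One quadratic identity in the coefficients \<open>c\<close>; Bessel's inequality, the
  norm of a partial sum and the best approximation property are all read off from it.\<close>

lemma chebU_expansion_nrm:
  assumes z: "sq_int \<mu> (\<lambda>x. rw x * h x)" and K: "finite K" "\<And>k. k \<in> K \<Longrightarrow> 1 \<le> k"
  shows "(nrm \<mu> (\<lambda>x. rw x * (h x - (\<Sum>k\<in>K. c k * chebU k x))))\<^sup>2 =
     (nrm \<mu> (\<lambda>x. rw x * h x))\<^sup>2 - 2 * (\<Sum>k\<in>K. c k * fc h k) + pi / 2 * (\<Sum>k\<in>K. (c k)\<^sup>2)"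
proof -
  let ?z = "\<lambda>x. rw x * h x"
  let ?s = "\<lambda>k x. rw x * chebU k x"
  let ?S = "\<lambda>x. \<Sum>k\<in>K. c k * ?s k x"
  have S: "sq_int \<mu> ?S" by (intro sq_int_sum sq_int_cmult chebU_sq_int)
  have eq: "rw x * (h x - (\<Sum>k\<in>K. c k * chebU k x)) = ?z x - ?S x" for x
    by (simp add: right_diff_distrib sum_distrib_left mult.left_commute)
  have "(\<integral>x. (?z x - ?S x)\<^sup>2 \<partial>\<mu>) = (\<integral>x. (?z x)\<^sup>2 - 2 * (?z x * ?S x) + ?S x * ?S x \<partial>\<mu>)"
    by (intro Bochner_Integration.integral_cong) (auto simp: power2_eq_square algebra_simps)
  also have "\<dots> = (\<integral>x. (?z x)\<^sup>2 \<partial>\<mu>) - 2 * (\<integral>x. ?z x * ?S x \<partial>\<mu>) + (\<integral>x. ?S x * ?S x \<partial>\<mu>)"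
    using sq_int_square[OF z] sq_int_mult[OF z S] sq_int_mult[OF S S]
    by (simp add: Bochner_Integration.integral_add Bochner_Integration.integral_diff)
  also have "(\<integral>x. ?z x * ?S x \<partial>\<mu>) = (\<Sum>k\<in>K. c k * fc h k)"
  proof -
    have "(\<integral>x. ?z x * ?S x \<partial>\<mu>) = (\<integral>x. (\<Sum>k\<in>K. c k * (?z x * ?s k x)) \<partial>\<mu>)"
      by (intro Bochner_Integration.integral_cong) (auto simp: sum_distrib_left ac_simps)
    also have "\<dots> = (\<Sum>k\<in>K. (\<integral>x. c k * (?z x * ?s k x) \<partial>\<mu>))"
      by (intro Bochner_Integration.integral_sum integrable_mult_right sq_int_mult z chebU_sq_int)
    also have "\<dots> = (\<Sum>k\<in>K. c k * fc h k)" unfolding fc_def by simp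
    finally show ?thesis .
  qed
  also have "(\<integral>x. ?S x * ?S x \<partial>\<mu>) = pi / 2 * (\<Sum>k\<in>K. (c k)\<^sup>2)"
  proof -
    have "(\<integral>x. ?S x * ?S x \<partial>\<mu>) = (\<integral>x. (\<Sum>j\<in>K. \<Sum>k\<in>K. (c j * c k) * (?s j x * ?s k x)) \<partial>\<mu>)"
      by (intro Bochner_Integration.integral_cong) (auto simp: sum_product ac_simps)
    also have "\<dots> = (\<Sum>j\<in>K. \<Sum>k\<in>K. (\<integral>x. (c j * c k) * (?s j x * ?s k x) \<partial>\<mu>))"
      by (subst Bochner_Integration.integral_sum) (auto intro!: sum.cong Bochner_Integration.integral_sum Bochner_Integration.integrable_sum integrable_mult_right sq_int_mult chebU_sq_int simp del: integral_mult_right_zero)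
    also have "\<dots> = (\<Sum>j\<in>K. \<Sum>k\<in>K. (c j * c k) * (if j = k then pi / 2 else 0))"
      unfolding integral_mult_right_zero
      by (intro sum.cong refl) (simp only: rw_chebU_orthogonal K(2))
    finally show ?thesis using K by (simp only: double_sum_diagonal)
  qed
  finally show ?thesis unfolding nrm_square eq .
qed

lemma Bessel:
  assumes z: "sq_int \<mu> (\<lambda>x. rw x * h x)" and K: "finite K" "\<And>k. k \<in> K \<Longrightarrow> 1 \<le> k"
  shows "(\<Sum>k\<in>K. (fc h k)\<^sup>2) \<le> pi / 2 * (nrm \<mu> (\<lambda>x. rw x * h x))\<^sup>2"
proof -
  define S where "S = (\<Sum>k\<in>K. (fc h k)\<^sup>2)"
  define Z where "Z = (nrm \<mu> (\<lambda>x. rw x * h x))\<^sup>2"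
  \<comment> \<open>Each function \<open>rw * chebU k\<close> has squared norm
    \<open>pi / 2\<close>, so the Fourier coefficient, which minimises the quadratic, is
    \<open>2 / pi * fc h k\<close>.\<close>
  have 1: "(\<Sum>k\<in>K. (2 / pi * fc h k) * fc h k) = 2 / pi * S"
    unfolding S_def by (simp add: sum_distrib_left power2_eq_square mult.assoc)
  have 2: "(\<Sum>k\<in>K. (2 / pi * fc h k)\<^sup>2) = 4 / pi\<^sup>2 * S"
    unfolding S_def by (simp add: sum_distrib_left power_mult_distrib power_divide)
  have "0 \<le> (nrm \<mu> (\<lambda>x. rw x * (h x - (\<Sum>k\<in>K. (2 / pi * fc h k) * chebU k x))))\<^sup>2" by simp
  also have "\<dots> = Z - 2 * (2 / pi * S) + pi / 2 * (4 / pi\<^sup>2 * S)"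
    using chebU_expansion_nrm[OF assms, of "\<lambda>k. 2 / pi * fc h k"] by (simp only: 1 2 Z_def)
  also have "\<dots> = Z - 2 / pi * S" by (simp add: field_simps power2_eq_square)
  finally show ?thesis unfolding S_def[symmetric] Z_def[symmetric] by (simp add: field_simps)
qed

subsection \<open>Decay of the coefficients of smooth functions\<close>

lemma fc_sin:
  "fc h k = (\<integral>x. h x * sin (real k * arccos x) \<partial>\<mu>)"
  unfolding fc_def
proof (intro Bochner_Integration.integral_cong refl)
  fix x assume "x \<in> space \<mu>"
  then have "(rw x * h x) * (rw x * chebU k x) = h x * (omega x * chebU k x)"
    by (simp add: rw_square(1)[symmetric])
  also have "omega x * chebU k x = sin (real k * arccos x)"
    using \<open>x \<in> space \<mu>\<close> by (intro chebU_sin I_subset) simp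
  finally show "(rw x * h x) * (rw x * chebU k x) = h x * sin (real k * arccos x)" .
qed

text \<open>In x, the function \<open>sin (k \<theta>)\<close> has the antiderivative \<open>(sin
  ((k+1) \<theta>) / (k+1) - sin ((k-1) \<theta>) / (k-1)) / 2\<close>, which vanishes at both
  endpoints. For \<open>k = 1\<close> the second term would become \<theta> itself, nonzero at -1;
  hence \<open>2 \<le> k\<close>.\<close>

lemma fc_weak_deriv:
  assumes w: "weak_deriv u g" and u: "sq_int \<mu> u" and g: "sq_int \<mu> g" and k: "2 \<le> k"
  shows "fc u k = (fc g (k - 1) / real (k - 1) - fc g (k + 1) / real (k + 1)) / 2"
proof -
  define \<Psi> where "\<Psi> x = (anti (int (k + 1)) x - anti (int (k - 1)) x) / 2" for x
  have \<Psi>: "\<Psi> x = (sin (real (k + 1) * arccos x) / real (k + 1) - sin (real (k - 1) * arccos x) / real (k - 1)) / 2" for x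
    using k by (simp add: \<Psi>_def anti_def)
  have s: "sq_int \<mu> (\<lambda>x. sin (real j * arccos x))" for j
    by (intro continuous_sq_int_\<mu> continuous_intros continuous_arccos)
  have "(\<integral>x. u x * sin (real k * arccos x) \<partial>\<mu>) = - (\<integral>x. g x * \<Psi> x \<partial>\<mu>)"
  proof (rule weak_deriv_integration_by_parts[OF w u g])
    show "continuous_on {-1..1} \<Psi>" unfolding \<Psi>_def by (intro continuous_intros anti_continuous) auto
    show "continuous_on {-1..1} (\<lambda>x. sin (real k * arccos x))"
      by (intro continuous_intros continuous_arccos)
    show "\<Psi> (-1) = 0" "\<Psi> 1 = 0" using k by (auto simp: \<Psi>_def anti_endpoints)
    fix x assume x: "x \<in> I"
    define t where "t = arccos x"
    have st: "sin t = omega x" using x by (simp add: t_def omega_def sin_arccos I_def)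
    have w: "omega x > 0" using omega_bounds(1)[OF x] .
    have "(\<Psi> has_real_derivative (- (cos (int (k + 1) * t) / omega x) - - (cos (int (k - 1) * t) / omega x)) / 2) (at x)"
      unfolding \<Psi>_def t_def by (rule DERIV_cdivide[OF DERIV_diff[OF anti_deriv[OF x] anti_deriv[OF x]]])
    also have "(- (cos (int (k + 1) * t) / omega x) - - (cos (int (k - 1) * t) / omega x)) / 2
        = (cos (k * t - t) - cos (k * t + t)) / 2 / omega x"
      using k by (simp add: of_nat_diff algebra_simps diff_divide_distrib)
    also have "(cos (k * t - t) - cos (k * t + t)) / 2 = sin (k * t) * omega x"
      unfolding st[symmetric] by (simp add: sin_times_sin)
    finally show "(\<Psi> has_real_derivative sin (real k * arccos x)) (at x)"
      using w by (simp add: t_def)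
  qed
  also have "(\<integral>x. g x * \<Psi> x \<partial>\<mu>) = (\<integral>x. (g x * sin (real (k + 1) * arccos x)) * (1 / (2 * real (k + 1)))
      - (g x * sin (real (k - 1) * arccos x)) * (1 / (2 * real (k - 1))) \<partial>\<mu>)"
  proof -
    have "h * ((A / p - B / q) / 2) = (h * A) * (1 / (2 * p)) - (h * B) * (1 / (2 * q))" for h A p B q :: real
      by (simp add: right_diff_distrib diff_divide_distrib)
    then show ?thesis unfolding \<Psi> by (simp only:)
  qed
  also have "\<dots> = fc g (k + 1) * (1 / (2 * real (k + 1))) - fc g (k - 1) * (1 / (2 * real (k - 1)))"
    unfolding fc_sin
    by (subst Bochner_Integration.integral_diff)
       (intro integrable_mult_left sq_int_mult g s | simp only: integral_mult_left_zero)+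
  also have "- (A * (1 / (2 * p)) - B * (1 / (2 * q))) = (B / q - A / p) / 2" for A p B q :: real
    by (simp add: diff_divide_distrib)
  finally show ?thesis unfolding fc_sin[of u] .
qed

text \<open>Both denominators \<open>k - 1\<close> and \<open>k + 1\<close> are at least N, which
  gains \<open>N^2\<close>. Squaring the halved difference leaves half of each neighbouring square,
  so the two shifted sums together cost no constant; the index window only widens by one on each
  side.\<close>

lemma fc_tail_step:
  assumes w: "weak_deriv u g" and u: "sq_int \<mu> u" and g: "sq_int \<mu> g" and N: "2 \<le> N"
  shows "(\<Sum>k\<in>{N<..n}. (fc u k)\<^sup>2) \<le> (\<Sum>k\<in>{N-1<..n+1}. (fc g k)\<^sup>2) / (real N)\<^sup>2"
proof -
  let ?G = "\<Sum>k\<in>{N-1<..n+1}. (fc g k)\<^sup>2"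
  have "(fc u k)\<^sup>2 \<le> ((fc g (k-1))\<^sup>2 + (fc g (k+1))\<^sup>2) / (2 * (real N)\<^sup>2)" if k: "k \<in> {N<..n}" for k
  proof -
    define x where "x = fc g (k - 1) / real (k - 1)"
    define y where "y = fc g (k + 1) / real (k + 1)"
    have "fc u k = (x - y) / 2"
      unfolding x_def y_def by (rule fc_weak_deriv[OF w u g]) (use k N in auto)
    then have "(fc u k)\<^sup>2 = ((x - y) / 2)\<^sup>2" by (simp only:)
    also have "\<dots> \<le> (x\<^sup>2 + y\<^sup>2) / 2"
      using zero_le_power2[of "x + y"] by (simp add: power2_eq_square field_simps)
    also have "x\<^sup>2 \<le> (fc g (k - 1))\<^sup>2 / (real N)\<^sup>2"
      unfolding x_def power_divide using k N by (intro divide_left_mono power_mono) auto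
    also have "y\<^sup>2 \<le> (fc g (k + 1))\<^sup>2 / (real N)\<^sup>2"
      unfolding y_def power_divide using k N by (intro divide_left_mono power_mono) auto
    finally show ?thesis by (simp add: add_divide_distrib mult.commute)
  qed
  then have "(\<Sum>k\<in>{N<..n}. (fc u k)\<^sup>2) \<le> (\<Sum>k\<in>{N<..n}. ((fc g (k-1))\<^sup>2 + (fc g (k+1))\<^sup>2) / (2 * (real N)\<^sup>2))"
    by (rule sum_mono)
  also have "\<dots> = ((\<Sum>k\<in>{N<..n}. (fc g (k-1))\<^sup>2) + (\<Sum>k\<in>{N<..n}. (fc g (k+1))\<^sup>2)) / (2 * (real N)\<^sup>2)"
    unfolding sum_divide_distrib[symmetric] sum.distrib ..
  also have "(\<Sum>k\<in>{N<..n}. (fc g (k-1))\<^sup>2) \<le> ?G"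
  proof -
    have "(\<Sum>k\<in>{N<..n}. (fc g (k-1))\<^sup>2) = (\<Sum>k\<in>(\<lambda>k. k - 1) ` {N<..n}. (fc g k)\<^sup>2)"
      by (subst sum.reindex) (auto simp: inj_on_def)
    also have "\<dots> \<le> ?G" by (rule sum_mono2) (use N in auto)
    finally show ?thesis .
  qed
  also have "(\<Sum>k\<in>{N<..n}. (fc g (k+1))\<^sup>2) \<le> ?G"
  proof -
    have "(\<Sum>k\<in>{N<..n}. (fc g (k+1))\<^sup>2) = (\<Sum>k\<in>(\<lambda>k. k + 1) ` {N<..n}. (fc g k)\<^sup>2)"
      by (subst sum.reindex) (auto simp: inj_on_def)
    also have "\<dots> \<le> ?G" by (rule sum_mono2) (use N in auto)
    finally show ?thesis .
  qed
  also have "(?G + ?G) / (2 * (real N)\<^sup>2) = ?G / (real N)\<^sup>2" by simp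
  finally show ?thesis by (simp add: divide_right_mono)
qed

lemma fc_tail_bounded:
  assumes "sq_int \<mu> u" "nrm \<mu> u \<le> H"
  shows "(\<Sum>k\<in>{N<..n}. (fc u k)\<^sup>2) \<le> 2 * H\<^sup>2"
proof -
  have "(\<Sum>k\<in>{N<..n}. (fc u k)\<^sup>2) \<le> pi / 2 * (nrm \<mu> (\<lambda>x. rw x * u x))\<^sup>2"
    by (rule Bessel) (auto intro: rw_sq_int assms)
  also have "\<dots> \<le> 2 * H\<^sup>2"
    using pi_less_4 order_trans[OF nrm_rw_le assms(2)] assms by (intro mult_mono power_mono) auto
  finally show ?thesis .
qed

text \<open>Starting from Bessel's inequality for the top derivative \<open>g m\<close>, each step
  down gains \<open>N^2\<close> but replaces N by N - 1; \<open>i < N\<close> keeps the shifted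
  index positive.\<close>

lemma fc_tail_large:
  assumes w: "\<And>j. j < m \<Longrightarrow> weak_deriv (g j) (g (Suc j))" and s: "\<And>j. j \<le> m \<Longrightarrow> sq_int \<mu> (g j)"
    and H: "\<And>j. j \<le> m \<Longrightarrow> nrm \<mu> (g j) \<le> H"
  shows "i \<le> m \<Longrightarrow> i < N \<Longrightarrow> (\<Sum>k\<in>{N<..n}. (fc (g (m - i)) k)\<^sup>2) \<le> 2 * 4 ^ (i * i) * H\<^sup>2 / real N ^ (2 * i)"
proof (induction i arbitrary: N n)
  case 0
  then show ?case using fc_tail_bounded[OF s H, of m N n] by simp
next
  case (Suc i)
  have eq: "m - i = Suc (m - Suc i)" using Suc by simp
  have "(\<Sum>k\<in>{N<..n}. (fc (g (m - Suc i)) k)\<^sup>2) \<le> (\<Sum>k\<in>{N-1<..n+1}. (fc (g (m - i)) k)\<^sup>2) / (real N)\<^sup>2"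
    unfolding eq by (rule fc_tail_step) (use Suc w s in auto)
  also have "\<dots> \<le> (2 * 4 ^ (i * i) * H\<^sup>2 / real (N - 1) ^ (2 * i)) / (real N)\<^sup>2"
    by (intro divide_right_mono Suc.IH) (use Suc in auto)
  \<comment> \<open>From \<open>N - 1 \<ge> N / 2\<close>: returning to powers of N costs
    \<open>4 ^ i\<close>, which accumulates to the factor \<open>4 ^ (i * i)\<close>.\<close>
  also have "\<dots> \<le> (2 * 4 ^ (i * i) * H\<^sup>2 / (real N / 2) ^ (2 * i)) / (real N)\<^sup>2"
    by (intro divide_right_mono divide_left_mono power_mono mult_pos_pos zero_less_power) (use Suc in auto)
  also have "\<dots> = 2 * 4 ^ (i * i + i) * H\<^sup>2 / real N ^ (2 * Suc i)"
  proof -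
    have "(2::real) ^ i * 2 ^ i = 4 ^ i" by (simp add: power_mult_distrib[symmetric])
    then show ?thesis by (simp add: power_divide power_add power_mult power2_eq_square field_simps)
  qed
  also have "\<dots> \<le> 2 * 4 ^ (Suc i * Suc i) * H\<^sup>2 / real N ^ (2 * Suc i)"
    by (intro divide_right_mono mult_right_mono mult_left_mono power_increasing) auto
  finally show ?case .
qed

text \<open>For \<open>N \<le> m\<close> the recurrence cannot be iterated often enough; there plain
  boundedness suffices, since \<open>m / N \<ge> 1\<close> supplies the missing powers. This is the
  origin of the summand \<open>real m ^ (2 * m)\<close>.\<close>

lemma fc_tail:
  assumes w: "\<And>j. j < m \<Longrightarrow> weak_deriv (g j) (g (Suc j))" and s: "\<And>j. j \<le> m \<Longrightarrow> sq_int \<mu> (g j)"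
    and H: "\<And>j. j \<le> m \<Longrightarrow> nrm \<mu> (g j) \<le> H" and i: "i \<le> m" and N: "1 \<le> N"
  shows "(\<Sum>k\<in>{N<..n}. (fc (g (m - i)) k)\<^sup>2) \<le> 2 * (4 ^ (m * m) + real m ^ (2 * m)) * H\<^sup>2 / real N ^ (2 * i)"
proof (cases "m < N")
  case True
  have "(\<Sum>k\<in>{N<..n}. (fc (g (m - i)) k)\<^sup>2) \<le> 2 * 4 ^ (i * i) * H\<^sup>2 / real N ^ (2 * i)"
    by (rule fc_tail_large) (use assms True in auto)
  also have "\<dots> \<le> 2 * (4 ^ (m * m) + real m ^ (2 * m)) * H\<^sup>2 / real N ^ (2 * i)"
  proof (intro divide_right_mono mult_right_mono mult_left_mono)
    have "(4::real) ^ (i * i) \<le> 4 ^ (m * m)" using i by (intro power_increasing mult_le_mono) auto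
    then show "(4::real) ^ (i * i) \<le> 4 ^ (m * m) + real m ^ (2 * m)" by (simp add: add_increasing2)
  qed auto
  finally show ?thesis .
next
  case False
  have "(\<Sum>k\<in>{N<..n}. (fc (g (m - i)) k)\<^sup>2) \<le> 2 * H\<^sup>2"
    by (rule fc_tail_bounded) (use s H in auto)
  also have "\<dots> \<le> 2 * H\<^sup>2 * (real m ^ (2 * i) / real N ^ (2 * i))"
  proof -
    have "real N ^ (2 * i) \<le> real m ^ (2 * i)" using False by (intro power_mono) auto
    then have "1 \<le> real m ^ (2 * i) / real N ^ (2 * i)" using N by simp
    then have "2 * H\<^sup>2 * 1 \<le> 2 * H\<^sup>2 * (real m ^ (2 * i) / real N ^ (2 * i))"
      by (rule mult_left_mono) simp
    then show ?thesis unfolding mult_1_right .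
  qed
  also have "\<dots> = 2 * real m ^ (2 * i) * H\<^sup>2 / real N ^ (2 * i)" by simp
  also have "\<dots> \<le> 2 * (4 ^ (m * m) + real m ^ (2 * m)) * H\<^sup>2 / real N ^ (2 * i)"
  proof (intro divide_right_mono mult_right_mono mult_left_mono)
    have "real m ^ (2 * i) \<le> real m ^ (2 * m)" using i False N by (intro power_increasing) auto
    then show "real m ^ (2 * i) \<le> 4 ^ (m * m) + real m ^ (2 * m)" by (simp add: add_increasing)
  qed auto
  finally show ?thesis .
qed

subsection \<open>Expansion of energy functions\<close>

lemma rw_nonzero: "x \<in> I \<Longrightarrow> omega x \<noteq> 0" "x \<in> I \<Longrightarrow> rw x \<noteq> 0"
  using omega_bounds(1)[of x] rw_bounds(1)[of x] by auto

text \<open>\<open>1 / omega\<close> is the derivative of \<open>- arccos\<close>, and a nonnegative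
  gauge integrable function is absolutely integrable. By Cauchy-Schwarz the energy norm thus bounds
  the integral of a derivative, which is how it controls endpoint values.\<close>

lemma inverse_rw_sq_int: "sq_int \<mu> (\<lambda>x. 1 / rw x)"
proof -
  have "((\<lambda>x. 1 / omega x) has_integral (- anti 0 1 - - anti 0 (-1))) {-1..1}"
  proof (rule fundamental_theorem_of_calculus_interior)
    show "continuous_on {-1..1} (\<lambda>x. - anti 0 x)" by (intro continuous_intros anti_continuous)
    fix x assume "x \<in> {-1<..<(1::real)}"
    then have x: "x \<in> I" by (simp add: I_def)
    show "((\<lambda>x. - anti 0 x) has_vector_derivative 1 / omega x) (at x)"
      using DERIV_minus[OF anti_deriv[OF x, of 0]] by (simp add: has_real_derivative_iff_has_vector_derivative)
  qed simp
  then have "((\<lambda>x. 1 / omega x) has_integral (- anti 0 1 - - anti 0 (-1))) I"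
    unfolding I_def by (rule has_integral_Icc_iff_Ioo[THEN iffD1])
  then have "(\<lambda>x. 1 / omega x) integrable_on I" by (rule has_integral_integrable)
  then have "(\<lambda>x. 1 / omega x) absolutely_integrable_on I"
    by (rule nonnegative_absolutely_integrable_1) (simp add: omega_bounds(1) less_imp_le)
  then have i: "integrable lebesgue (\<lambda>x. indicator I x *\<^sub>R (1 / omega x))"
    by (simp add: set_integrable_def)
  have m: "(\<lambda>x. 1 / omega x) \<in> borel_measurable \<mu>" "(\<lambda>x. 1 / rw x) \<in> borel_measurable \<mu>"
    by (intro continuous_imp_measurable_\<mu> continuous_on_divide continuous_on_const continuous_omega continuous_rw;
        simp add: rw_nonzero)+
  from m(1) have "(\<lambda>x. indicator I x *\<^sub>R (1 / omega x)) \<in> borel_measurable lborel"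
    unfolding borel_measurable_restrict_space_iff[OF I_sets(2)] .
  with i have "integrable lborel (\<lambda>x. indicator I x *\<^sub>R (1 / omega x))"
    using integrable_completion by blast
  then have "integrable \<mu> (\<lambda>x. 1 / omega x)"
    unfolding integrable_restrict_space[OF I_sets(2)] .
  also have "?this \<longleftrightarrow> integrable \<mu> (\<lambda>x. (1 / rw x)\<^sup>2)"
    by (intro Bochner_Integration.integrable_cong) (auto simp: power_divide rw_square)
  finally show ?thesis using m(2) by (simp add: sq_int_def)
qed

lemma weighted_L1_bound:
  assumes "sq_int \<mu> (\<lambda>x. rw x * f x)"
  shows "\<bar>\<integral>x. f x \<partial>\<mu>\<bar> \<le> nrm \<mu> (\<lambda>x. rw x * f x) * nrm \<mu> (\<lambda>x. 1 / rw x)"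
proof -
  have "(\<integral>x. f x \<partial>\<mu>) = (\<integral>x. (rw x * f x) * (1 / rw x) \<partial>\<mu>)"
    by (intro Bochner_Integration.integral_cong refl) (simp add: rw_nonzero)
  then show ?thesis using Cauchy_Schwarz_integral[OF assms inverse_rw_sq_int] by simp
qed

text \<open>Since \<open>w 1 = 0\<close>, the value at x is an integral of \<open>w'\<close>,
  bounded by the integral of its absolute value over all of \<open>I\<close> and so by the energy
  norm.\<close>

lemma sup_le_weighted_nrm:
  assumes w: "\<And>x. (w has_real_derivative w' x) (at x)" "continuous_on {-1..1} w'" "w 1 = 0" and x: "x \<in> I"
  shows "\<bar>w x\<bar> \<le> nrm \<mu> (\<lambda>x. rw x * w' x) * nrm \<mu> (\<lambda>x. 1 / rw x)"
proof -
  have xx: "-1 < x" "x < 1" using x by (auto simp: I_def)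
  have c: "continuous_on {x..1} w'" "continuous_on {x..1} (\<lambda>x. \<bar>w' x\<bar>)" "continuous_on {-1..1} (\<lambda>x. \<bar>w' x\<bar>)"
    using xx w(2) by (auto intro!: continuous_intros elim: continuous_on_subset)
  have "(w' has_integral (w 1 - w x)) {x..1}"
    by (rule fundamental_theorem_of_calculus)
       (use xx w(1) in \<open>auto simp: has_real_derivative_iff_has_vector_derivative intro: has_vector_derivative_at_within\<close>)
  then have "\<bar>w x\<bar> = \<bar>integral {x..1} w'\<bar>" using w(3) by (simp add: integral_unique)
  also have "\<dots> \<le> integral {x..1} (\<lambda>x. \<bar>w' x\<bar>)"
    using integral_norm_bound_integral[of w' "{x..1}" "\<lambda>x. \<bar>w' x\<bar>"] c
    by (simp add: integrable_continuous_real)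
  also have "\<dots> \<le> integral {-1..1} (\<lambda>x. \<bar>w' x\<bar>)"
    using xx c by (intro integral_subset_le integrable_continuous_real) auto
  also have "\<dots> = integral I (\<lambda>x. \<bar>w' x\<bar>)"
    by (simp add: I_def integral_open_interval_real)
  also have "\<dots> = (\<integral>x. \<bar>w' x\<bar> \<partial>\<mu>)"
    using set_borel_integral_eq_integral(2)[of I "\<lambda>x. \<bar>w' x\<bar>"] continuous_integrable_\<mu>[OF c(3)]
    by (simp add: set_integrable_\<mu> intI_def[symmetric] intI_eq)
  also have "\<dots> \<le> \<bar>\<integral>x. \<bar>w' x\<bar> \<partial>\<mu>\<bar>" by simp
  also have "\<dots> \<le> nrm \<mu> (\<lambda>x. rw x * \<bar>w' x\<bar>) * nrm \<mu> (\<lambda>x. 1 / rw x)"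
    by (intro weighted_L1_bound continuous_sq_int_\<mu> continuous_intros continuous_rw c)
  also have "nrm \<mu> (\<lambda>x. rw x * \<bar>w' x\<bar>) = nrm \<mu> (\<lambda>x. rw x * w' x)"
    by (simp add: nrm_def power_mult_distrib)
  finally show ?thesis .
qed

text \<open>The Chebyshev series belonging to a derivative \<epsilon>, with the normalisation
  \<open>2 / pi\<close>. The derivative does not determine the \<open>T_0\<close> term, so uses over
  \<open>{1..n}\<close> subtract the value at 1 instead.\<close>

definition cheb_part :: "(real \<Rightarrow> real) \<Rightarrow> nat set \<Rightarrow> real \<Rightarrow> real" where
  "cheb_part \<epsilon> K x = (\<Sum>k\<in>K. (2 / pi * fc \<epsilon> k / real k) * cheb k x)"

definition chebU_part :: "(real \<Rightarrow> real) \<Rightarrow> nat set \<Rightarrow> real \<Rightarrow> real" where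
  "chebU_part \<epsilon> K x = (\<Sum>k\<in>K. (2 / pi * fc \<epsilon> k) * chebU k x)"

lemma continuous_parts: "continuous_on S (cheb_part \<epsilon> K)" "continuous_on S (chebU_part \<epsilon> K)"
  unfolding cheb_part_def chebU_part_def by (intro continuous_intros continuous_cheb)+

lemma DERIV_cheb_part:
  assumes "\<And>k. k \<in> K \<Longrightarrow> 1 \<le> k"
  shows "(cheb_part \<epsilon> K has_real_derivative chebU_part \<epsilon> K x) (at x)"
  unfolding cheb_part_def chebU_part_def
proof (rule DERIV_sum)
  fix k assume "k \<in> K"
  then have k: "real k \<noteq> 0" using assms[of k] by simp
  have "((\<lambda>x. (2 / pi * fc \<epsilon> k / real k) * cheb k x) has_real_derivative (2 / pi * fc \<epsilon> k / real k) * (real k * chebU k x)) (at x)"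
    by (intro DERIV_cmult DERIV_cheb)
  moreover have "(2 / pi * fc \<epsilon> k / real k) * (real k * chebU k x) = 2 / pi * fc \<epsilon> k * chebU k x"
    using k by simp
  ultimately show "((\<lambda>x. (2 / pi * fc \<epsilon> k / real k) * cheb k x) has_real_derivative 2 / pi * fc \<epsilon> k * chebU k x) (at x)"
    by (simp only:)
qed

lemma chebU_part_nrm:
  assumes K: "finite K" "\<And>k. k \<in> K \<Longrightarrow> 1 \<le> k"
  shows "(nrm \<mu> (\<lambda>x. rw x * chebU_part \<epsilon> K x))\<^sup>2 = 2 / pi * (\<Sum>k\<in>K. (fc \<epsilon> k)\<^sup>2)"
proof -
  define S where "S = (\<Sum>k\<in>K. (fc \<epsilon> k)\<^sup>2)"
  have 2: "(\<Sum>k\<in>K. (2 / pi * fc \<epsilon> k)\<^sup>2) = 4 / pi\<^sup>2 * S"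
    unfolding S_def by (simp add: sum_distrib_left power_mult_distrib power_divide)
  have 0: "fc (\<lambda>x. 0) k = 0" for k by (simp add: fc_def)
  have n0: "nrm \<mu> (\<lambda>x. 0) = 0" by (simp add: nrm_def)
  have s0: "sq_int \<mu> (\<lambda>x. rw x * 0)" by (simp add: sq_int_zero)
  have "(nrm \<mu> (\<lambda>x. rw x * (0 - chebU_part \<epsilon> K x)))\<^sup>2 = pi / 2 * (4 / pi\<^sup>2 * S)"
    using chebU_expansion_nrm[OF s0 K, of "\<lambda>k. 2 / pi * fc \<epsilon> k"]
    unfolding chebU_part_def 2 by (simp only: 0 n0 mult_zero_right sum.neutral_const) simp
  also have "\<dots> = 2 / pi * S" by (simp add: field_simps power2_eq_square)
  finally have "(nrm \<mu> (\<lambda>x. rw x * (0 - chebU_part \<epsilon> K x)))\<^sup>2 = 2 / pi * S" .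
  moreover have "nrm \<mu> (\<lambda>x. rw x * (0 - chebU_part \<epsilon> K x)) = nrm \<mu> (\<lambda>x. rw x * chebU_part \<epsilon> K x)"
    by (simp add: nrm_def)
  ultimately show ?thesis by (simp only: S_def)
qed

text \<open>Orthogonality decouples the quadratic in the coefficients, and in each of them
  \<open>2 / pi * fc \<epsilon> k\<close> is the minimiser, by completing the square.\<close>

lemma chebU_part_best:
  assumes z: "sq_int \<mu> (\<lambda>x. rw x * \<epsilon> x)" and K: "finite K" "\<And>k. k \<in> K \<Longrightarrow> 1 \<le> k"
  shows "nrm \<mu> (\<lambda>x. rw x * (\<epsilon> x - chebU_part \<epsilon> K x)) \<le> nrm \<mu> (\<lambda>x. rw x * (\<epsilon> x - (\<Sum>k\<in>K. c k * chebU k x)))"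
proof (rule power2_le_imp_le)
  have "- 2 * ((2 / pi * z) * z) + pi / 2 * (2 / pi * z)\<^sup>2 \<le> - 2 * (d * z) + pi / 2 * d\<^sup>2" for d z :: real
  proof -
    have "0 \<le> pi / 2 * (d - 2 / pi * z)\<^sup>2" by simp
    also have "\<dots> = (- 2 * (d * z) + pi / 2 * d\<^sup>2) - (- 2 * ((2 / pi * z) * z) + pi / 2 * (2 / pi * z)\<^sup>2)"
      by (simp add: power2_eq_square field_simps)
    finally show ?thesis by simp
  qed
  then have "(\<Sum>k\<in>K. - 2 * ((2 / pi * fc \<epsilon> k) * fc \<epsilon> k) + pi / 2 * (2 / pi * fc \<epsilon> k)\<^sup>2)
     \<le> (\<Sum>k\<in>K. - 2 * (c k * fc \<epsilon> k) + pi / 2 * (c k)\<^sup>2)"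
    by (rule sum_mono)
  then show "(nrm \<mu> (\<lambda>x. rw x * (\<epsilon> x - chebU_part \<epsilon> K x)))\<^sup>2 \<le> (nrm \<mu> (\<lambda>x. rw x * (\<epsilon> x - (\<Sum>k\<in>K. c k * chebU k x))))\<^sup>2"
    using chebU_expansion_nrm[OF assms, of "\<lambda>k. 2 / pi * fc \<epsilon> k"] chebU_expansion_nrm[OF assms, of c]
    unfolding chebU_part_def sum.distrib sum_distrib_left[symmetric] by linarith
qed simp

text \<open>\<open>\<epsilon>\<close> plays the role of the derivative of \<open>e\<close>; both are limits of polynomials vanishing at \<open>\<plusminus>1\<close>.\<close>
definition energy_approx :: "(real \<Rightarrow> real) \<Rightarrow> (real \<Rightarrow> real) \<Rightarrow> bool" where
  "energy_approx e \<epsilon> \<longleftrightarrow> sq_int \<mu> e \<and> \<epsilon> \<in> borel_measurable \<mu> \<and> sq_int \<mu> (\<lambda>x. rw x * \<epsilon> x) \<and>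
    (\<forall>\<delta>>0. \<exists>p p'. real_polynomial_function p \<and> real_polynomial_function p' \<and>
      (\<forall>x. (p has_real_derivative p' x) (at x)) \<and> p (-1) = 0 \<and> p 1 = 0 \<and>
      nrm \<mu> (\<lambda>x. e x - p x) \<le> \<delta> \<and> nrm \<mu> (\<lambda>x. rw x * (\<epsilon> x - p' x)) \<le> \<delta>)"

lemma polynomial_deriv_chebU:
  assumes p: "real_polynomial_function p" "\<And>x. (p has_real_derivative p' x) (at x)"
  shows "\<exists>n c. \<forall>M\<ge>n. p' = (\<lambda>x. \<Sum>k\<in>{1..M}. c k * chebU k x)"
proof -
  obtain n c where c: "\<And>M. M \<ge> n \<Longrightarrow> p = (\<lambda>x. \<Sum>k\<le>M. c k * cheb k x)"
    using cheb_span_sum[OF polynomial_cheb_span[OF p(1)]] by blast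
  have "p' = (\<lambda>x. \<Sum>k\<in>{1..M}. (c k * real k) * chebU k x)" if "M \<ge> n" for M
  proof
    fix x
    have "(p has_real_derivative (\<Sum>k\<le>M. c k * (real k * chebU k x))) (at x)"
      unfolding c[OF that] by (intro DERIV_sum DERIV_cmult DERIV_cheb)
    then have "p' x = (\<Sum>k\<le>M. c k * (real k * chebU k x))" using p(2) DERIV_unique by blast
    also have "\<dots> = (\<Sum>k\<in>{1..M}. c k * (real k * chebU k x))"
      by (rule sum.mono_neutral_right) (auto simp: not_le)
    finally show "p' x = (\<Sum>k\<in>{1..M}. (c k * real k) * chebU k x)" by (simp add: mult.assoc)
  qed
  then show ?thesis by (intro exI[of _ n] exI[of _ "\<lambda>k. c k * real k"] allI impI)
qed

text \<open>Once n is large, the derivative of an approximating polynomial \<open>p\<close> lies in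
  the span of the first n functions \<open>chebU\<close>, so the partial sum \<open>Q\<close> is at
  least as close to \<epsilon> as \<open>p'\<close>. Then \<open>p' - Q\<close> is small in the
  weighted norm, which controls both the endpoint difference of \<open>R\<close>, because
  \<open>p\<close> vanishes at both ends, and the uniform distance of \<open>p\<close> to
  \<open>R - R 1\<close>.\<close>

lemma energy_expansion:
  assumes E: "energy_approx e \<epsilon>" and \<delta>: "\<delta> > 0"
  shows "\<exists>n0. \<forall>n\<ge>n0. nrm \<mu> (\<lambda>x. rw x * (\<epsilon> x - chebU_part \<epsilon> {1..n} x)) \<le> \<delta> \<and>
     \<bar>cheb_part \<epsilon> {1..n} 1 - cheb_part \<epsilon> {1..n} (-1)\<bar> \<le> \<delta> \<and>
     nrm \<mu> (\<lambda>x. e x - (cheb_part \<epsilon> {1..n} x - cheb_part \<epsilon> {1..n} 1)) \<le> \<delta>"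
proof -
  define K where "K = nrm \<mu> (\<lambda>x. 1 / rw x)"
  have K0: "0 \<le> K" by (simp add: K_def)
  note E' = E[unfolded energy_approx_def]
  have se: "sq_int \<mu> e" and s\<epsilon>: "sq_int \<mu> (\<lambda>x. rw x * \<epsilon> x)" and m\<epsilon>: "\<epsilon> \<in> borel_measurable \<mu>" using E' by auto
  \<comment> \<open>The three errors will be \<open>d\<close>, \<open>2 * d * K\<close> and
    \<open>d + 4 * d * K\<close>; this choice gives \<open>6 * d * K + 2 * d = \<delta>\<close>,
    which covers each of them.\<close>
  define d where "d = \<delta> / (2 * K + 2 * (2 * K) + 2)"
  have d: "d > 0" using K0 \<delta> by (simp add: d_def)
  have dle: "d \<le> \<delta>" "2 * d * K \<le> \<delta>" "d + 2 * (2 * d * K) \<le> \<delta>"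
  proof -
    have eq: "d * (2 * K + 2 * (2 * K) + 2) = \<delta>" using K0 by (simp add: d_def)
    have "0 \<le> d * K" using d K0 by simp
    moreover have "6 * (d * K) + 2 * d = \<delta>" using eq by (simp add: algebra_simps)
    ultimately show "d \<le> \<delta>" "2 * d * K \<le> \<delta>" "d + 2 * (2 * d * K) \<le> \<delta>"
      using d by (simp_all add: mult.assoc)
  qed
  obtain p p' where p: "real_polynomial_function p" "real_polynomial_function p'"
      "\<And>x. (p has_real_derivative p' x) (at x)" "p (-1) = 0" "p 1 = 0"
      "nrm \<mu> (\<lambda>x. e x - p x) \<le> d" "nrm \<mu> (\<lambda>x. rw x * (\<epsilon> x - p' x)) \<le> d"
    using E' d by blast
  have cp: "continuous_on S p" "continuous_on S p'" for S
    using p polynomial_continuous by auto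
  obtain n0 c where c: "\<And>n. n \<ge> n0 \<Longrightarrow> p' = (\<lambda>x. \<Sum>k\<in>{1..n}. c k * chebU k x)"
    using polynomial_deriv_chebU[OF p(1,3)] by blast
  have "nrm \<mu> (\<lambda>x. rw x * (\<epsilon> x - chebU_part \<epsilon> {1..n} x)) \<le> \<delta> \<and>
     \<bar>cheb_part \<epsilon> {1..n} 1 - cheb_part \<epsilon> {1..n} (-1)\<bar> \<le> \<delta> \<and>
     nrm \<mu> (\<lambda>x. e x - (cheb_part \<epsilon> {1..n} x - cheb_part \<epsilon> {1..n} 1)) \<le> \<delta>" if n: "n \<ge> n0" for n
  proof -
    define Q where "Q = chebU_part \<epsilon> {1..n}"
    define R where "R = cheb_part \<epsilon> {1..n}"
    have cQ: "continuous_on S Q" "continuous_on S R" for S unfolding Q_def R_def by (rule continuous_parts)+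
    have dR: "(R has_real_derivative Q x) (at x)" for x unfolding Q_def R_def by (rule DERIV_cheb_part) simp
    have sp': "sq_int \<mu> (\<lambda>x. rw x * p' x)" and sQ: "sq_int \<mu> (\<lambda>x. rw x * Q x)"
      by (intro continuous_sq_int_\<mu> continuous_intros continuous_rw cp cQ)+
    have "nrm \<mu> (\<lambda>x. rw x * (\<epsilon> x - Q x)) \<le> nrm \<mu> (\<lambda>x. rw x * (\<epsilon> x - (\<Sum>k\<in>{1..n}. c k * chebU k x)))"
      unfolding Q_def by (rule chebU_part_best[OF s\<epsilon>]) auto
    also have "\<dots> \<le> d" using p(7) unfolding c[OF n] .
    finally have 1: "nrm \<mu> (\<lambda>x. rw x * (\<epsilon> x - Q x)) \<le> d" .
    have 2: "nrm \<mu> (\<lambda>x. rw x * (p' x - Q x)) \<le> 2 * d"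
    proof -
      have "nrm \<mu> (\<lambda>x. rw x * p' x - rw x * Q x) \<le> nrm \<mu> (\<lambda>x. rw x * p' x - rw x * \<epsilon> x) + nrm \<mu> (\<lambda>x. rw x * \<epsilon> x - rw x * Q x)"
        by (rule nrm_triangle3[OF sp' s\<epsilon> sQ])
      also have "nrm \<mu> (\<lambda>x. rw x * p' x - rw x * \<epsilon> x) = nrm \<mu> (\<lambda>x. rw x * \<epsilon> x - rw x * p' x)"
        by (rule nrm_minus_commute)
      finally show ?thesis using 1 p(7) by (simp add: right_diff_distrib)
    qed
    have "R 1 - R (-1) = (\<integral>x. Q x \<partial>\<mu>)"
      by (rule integral_\<mu>_FTC[symmetric]) (use cQ dR in auto)
    moreover have "p 1 - p (-1) = (\<integral>x. p' x \<partial>\<mu>)"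
      by (rule integral_\<mu>_FTC[symmetric]) (use cp p in auto)
    ultimately have "R 1 - R (-1) = - (\<integral>x. p' x - Q x \<partial>\<mu>)"
      using p(4,5) continuous_integrable_\<mu>[OF cp(2)] continuous_integrable_\<mu>[OF cQ(1)] by simp
    also have "\<bar>\<dots>\<bar> \<le> nrm \<mu> (\<lambda>x. rw x * (p' x - Q x)) * K"
      unfolding abs_minus_cancel K_def
      by (intro weighted_L1_bound continuous_sq_int_\<mu> continuous_intros continuous_rw cp cQ)
    also have "\<dots> \<le> 2 * d * K" using 2 K0 by (rule mult_right_mono)
    finally have 3: "\<bar>R 1 - R (-1)\<bar> \<le> 2 * d * K" .
    have "\<bar>p x - (R x - R 1)\<bar> \<le> 2 * d * K" if "x \<in> I" for x
    proof -
      have "\<bar>p x - (R x - R 1)\<bar> \<le> nrm \<mu> (\<lambda>x. rw x * (p' x - Q x)) * nrm \<mu> (\<lambda>x. 1 / rw x)"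
        by (rule sup_le_weighted_nrm[OF _ _ _ that])
           (use p(5) in \<open>auto intro!: derivative_eq_intros p(3) dR continuous_intros cp cQ\<close>)
      also have "\<dots> \<le> 2 * d * K" using 2 K0 unfolding K_def by (rule mult_right_mono)
      finally show ?thesis .
    qed
    then have 4: "nrm \<mu> (\<lambda>x. p x - (R x - R 1)) \<le> 2 * (2 * d * K)"
      by (intro nrm_le_sup continuous_measurable_\<mu> continuous_intros cp cQ)
    have "nrm \<mu> (\<lambda>x. e x - (R x - R 1)) \<le> nrm \<mu> (\<lambda>x. e x - p x) + nrm \<mu> (\<lambda>x. p x - (R x - R 1))"
      by (intro nrm_triangle3 se continuous_sq_int_\<mu> continuous_intros cp cQ)
    then show ?thesis using 1 3 4 dle p(6) unfolding Q_def[symmetric] R_def[symmetric] by linarith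
  qed
  then show ?thesis by blast
qed

subsection \<open>The error of a Galerkin projection\<close>

text \<open>Letting \<open>n \<rightarrow> \<infinity>\<close> in \<open>cheb_part \<epsilon> {1..n} 1 - cheb_part \<epsilon> {1..n} (-1)\<close>, whose low part \<open>h\<close> is odd, bounds
  \<open>h 1\<close> and thereby \<open>l\<close> by the endpoint values of the tails.\<close>
lemma Galerkin_error:
  assumes E: "energy_approx e \<epsilon>" and N: "1 \<le> N"
    and head: "\<And>k. 1 \<le> k \<Longrightarrow> k \<le> N \<Longrightarrow> real k * fc \<epsilon> k = (if odd k then l else 0)"
    and tail: "\<And>n. (\<Sum>k\<in>{N<..n}. (fc \<epsilon> k)\<^sup>2) \<le> T\<^sup>2" and T: "0 \<le> T"
    and ends: "\<And>n. \<bar>\<Sum>k\<in>{N<..n}. fc \<epsilon> k / real k\<bar> \<le> D" "\<And>n. \<bar>\<Sum>k\<in>{N<..n}. (-1)^k * fc \<epsilon> k / real k\<bar> \<le> D"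
  shows "nrm \<mu> (\<lambda>x. rw x * \<epsilon> x) \<le> 2 * D + T" "nrm \<mu> e \<le> 6 * D + T / real N"
proof -
  note E' = E[unfolded energy_approx_def]
  have se: "sq_int \<mu> e" and s\<epsilon>: "sq_int \<mu> (\<lambda>x. rw x * \<epsilon> x)" using E' by auto
  have D0: "0 \<le> D" using ends(1)[of 0] by simp
  have pi2: "2 / pi \<le> 1" "0 < 2 / pi" using pi_ge_two by auto
  have fck: "fc \<epsilon> k = (if odd k then l / real k else 0)" if "1 \<le> k" "k \<le> N" for k
    using head[OF that] that by (auto simp: field_simps split: if_splits)
  define Od where "Od = {k\<in>{1..N}. odd k}"
  have Od: "finite Od" "1 \<in> Od" "\<And>k. k \<in> Od \<Longrightarrow> 1 \<le> k" using N by (auto simp: Od_def)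
  \<comment> \<open>Since \<open>1 \<in> Od\<close>, this sum is at least 1, uniformly in N, so a
    bound on \<open>h 1\<close> is a bound on \<open>l\<close>.\<close>
  define \<sigma> where "\<sigma> = (\<Sum>k\<in>Od. 1 / (real k)\<^sup>2)"
  have \<sigma>: "1 \<le> \<sigma>"
    unfolding \<sigma>_def using member_le_sum[of 1 Od "\<lambda>k. 1 / (real k)\<^sup>2"] Od by auto
  define h where "h = cheb_part \<epsilon> {1..N}"
  have h: "h x = 2 / pi * l * (\<Sum>k\<in>Od. cheb k x / (real k)\<^sup>2)" for x
  proof -
    have "h x = (\<Sum>k\<in>Od. (2 / pi * fc \<epsilon> k / real k) * cheb k x)"
      unfolding h_def cheb_part_def Od_def by (rule sum.mono_neutral_right) (auto simp: fck)
    also have "\<dots> = (\<Sum>k\<in>Od. 2 / pi * l * (cheb k x / (real k)\<^sup>2))"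
      by (intro sum.cong) (auto simp: fck Od_def power2_eq_square)
    finally show ?thesis by (simp add: sum_distrib_left)
  qed
  have h1: "h 1 = 2 / pi * l * \<sigma>" by (simp add: h \<sigma>_def)
  have hm1: "h (-1) = - h 1"
    unfolding h by (simp add: Od_def cheb_minus_one sum_negf)
  have hx: "\<bar>h x\<bar> \<le> \<bar>h 1\<bar>" if "x \<in> I" for x
  proof -
    have "\<bar>\<Sum>k\<in>Od. cheb k x / (real k)\<^sup>2\<bar> \<le> (\<Sum>k\<in>Od. 1 / (real k)\<^sup>2)"
      by (intro order_trans[OF sum_abs] sum_mono) (auto intro!: divide_right_mono abs_cheb_le I_subset that)
    then have "\<bar>\<Sum>k\<in>Od. cheb k x / (real k)\<^sup>2\<bar> \<le> \<bar>\<sigma>\<bar>" using \<sigma> by (simp add: \<sigma>_def)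
    then show ?thesis unfolding h1 unfolding h abs_mult by (intro mult_left_mono) auto
  qed
  define t where "t n = cheb_part \<epsilon> {N<..n}" for n
  have split: "(\<Sum>k\<in>{1..n}. f k) = (\<Sum>k\<in>{1..N}. f k) + (\<Sum>k\<in>{N<..n}. f k)" if "N \<le> n" for n and f :: "nat \<Rightarrow> real"
  proof -
    have "{1..n} = {1..N} \<union> {N<..n}" using that by auto
    moreover have "{1..N} \<inter> {N<..n} = {}" by auto
    ultimately show ?thesis by (simp only: sum.union_disjoint finite_atLeastAtMost finite_greaterThanAtMost)
  qed
  have R: "cheb_part \<epsilon> {1..n} x = h x + t n x" if "N \<le> n" for n x
    unfolding h_def t_def cheb_part_def by (rule split[OF that])
  have t1: "\<bar>t n 1\<bar> \<le> D" "\<bar>t n (-1)\<bar> \<le> D" for n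
  proof -
    have "t n 1 = 2 / pi * (\<Sum>k\<in>{N<..n}. fc \<epsilon> k / real k)" 
      "t n (-1) = 2 / pi * (\<Sum>k\<in>{N<..n}. (-1)^k * fc \<epsilon> k / real k)"
      unfolding t_def cheb_part_def sum_distrib_left by (simp_all add: cheb_minus_one ac_simps)
    moreover have "\<bar>2 / pi * y\<bar> \<le> D" if "\<bar>y\<bar> \<le> D" for y
      using mult_mono[OF pi2(1) that] by (simp add: abs_mult)
    ultimately show "\<bar>t n 1\<bar> \<le> D" "\<bar>t n (-1)\<bar> \<le> D" using ends by metis+
  qed
  have h1D: "\<bar>h 1\<bar> \<le> D"
  proof (rule field_le_epsilon)
    fix \<delta> :: real assume \<delta>: "\<delta> > 0"
    then obtain n0 where n0: "\<And>n. n \<ge> n0 \<Longrightarrow> \<bar>cheb_part \<epsilon> {1..n} 1 - cheb_part \<epsilon> {1..n} (-1)\<bar> \<le> \<delta>"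
      using energy_expansion[OF E \<delta>] by blast
    \<comment> \<open>As \<open>h (-1) = - h 1\<close>, the endpoint difference of the partial sum
      is \<open>2 * h 1 + t n 1 - t n (-1)\<close>.\<close>
    show "\<bar>h 1\<bar> \<le> D + \<delta>"
      using n0[of "max n0 N"] t1[of "max n0 N"] hm1 unfolding R[OF max.cobounded2] by linarith
  qed
  \<comment> \<open>The coefficient of \<open>T_k\<close> carries a factor \<open>1 / k\<close>, at
    most \<open>1 / N\<close> in the tail: this is the gain of the \<open>L^2\<close> bound over the
    energy bound.\<close>
  have tn: "nrm \<mu> (t n) \<le> T / real N" for n
  proof (rule power2_le_imp_le)
    have "(nrm \<mu> (t n))\<^sup>2 \<le> pi / 2 * (\<Sum>k\<in>{N<..n}. (2 / pi * fc \<epsilon> k / real k)\<^sup>2)"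
      unfolding t_def cheb_part_def[abs_def] by (rule cheb_sum_nrm_le) auto
    also have "\<dots> \<le> pi / 2 * (\<Sum>k\<in>{N<..n}. (4 / pi\<^sup>2) / (real N)\<^sup>2 * (fc \<epsilon> k)\<^sup>2)"
    proof (intro mult_left_mono sum_mono)
      fix k assume k: "k \<in> {N<..n}"
      have "(2 / pi * fc \<epsilon> k / real k)\<^sup>2 = (2 / pi * fc \<epsilon> k)\<^sup>2 / (real k)\<^sup>2" by (rule power_divide)
      also have "\<dots> \<le> (2 / pi * fc \<epsilon> k)\<^sup>2 / (real N)\<^sup>2"
        using k N by (intro divide_left_mono power_mono) auto
      finally show "(2 / pi * fc \<epsilon> k / real k)\<^sup>2 \<le> (4 / pi\<^sup>2) / (real N)\<^sup>2 * (fc \<epsilon> k)\<^sup>2"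
        by (simp add: power_mult_distrib power_divide)
    qed auto
    also have "\<dots> = 2 / pi * ((\<Sum>k\<in>{N<..n}. (fc \<epsilon> k)\<^sup>2) / (real N)\<^sup>2)"
      unfolding sum_distrib_left[symmetric] by (simp add: power2_eq_square field_simps)
    also have "\<dots> \<le> 1 * (T\<^sup>2 / (real N)\<^sup>2)"
      using pi2 tail by (intro mult_mono divide_right_mono divide_nonneg_nonneg sum_nonneg) auto
    finally show "(nrm \<mu> (t n))\<^sup>2 \<le> (T / real N)\<^sup>2" by (simp add: power_divide)
  qed (use T in auto)
  have sq: "sq_int \<mu> h" "sq_int \<mu> (t n)" "sq_int \<mu> (\<lambda>x. c)" for n c
    unfolding h_def t_def by (intro continuous_sq_int_\<mu> continuous_parts continuous_intros)+
  show "nrm \<mu> e \<le> 6 * D + T / real N"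
  proof (rule field_le_epsilon)
    fix \<delta> :: real assume \<delta>: "\<delta> > 0"
    then obtain n0 where n0: "\<And>n. n \<ge> n0 \<Longrightarrow> nrm \<mu> (\<lambda>x. e x - (cheb_part \<epsilon> {1..n} x - cheb_part \<epsilon> {1..n} 1)) \<le> \<delta>"
      using energy_expansion[OF E \<delta>] by blast
    define n where "n = max n0 N"
    \<comment> \<open>The missing \<open>T_0\<close> term, chosen so that the partial sum vanishes
      at 1. The bound \<open>6 * D\<close> is \<open>2 * D\<close> for \<open>h\<close> plus
      \<open>4 * D\<close> for this constant.\<close>
    define c where "c = h 1 + t n 1"
    have 1: "nrm \<mu> (\<lambda>x. e x - (h x + t n x - c)) \<le> \<delta>"
      using n0[of n] unfolding n_def c_def R[OF max.cobounded2] by simp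
    have s2: "sq_int \<mu> (\<lambda>x. h x + t n x - c)" by (intro sq_int_diff sq_int_add sq)
    have "nrm \<mu> e \<le> nrm \<mu> (\<lambda>x. e x - (h x + t n x - c)) + nrm \<mu> (\<lambda>x. h x + t n x - c)"
      using nrm_triangle[OF sq_int_diff[OF se s2] s2] by simp
    also have "nrm \<mu> (\<lambda>x. h x + t n x - c) \<le> nrm \<mu> (\<lambda>x. h x + t n x) + nrm \<mu> (\<lambda>x. c)"
      by (intro nrm_triangle_diff sq_int_add sq)
    also have "nrm \<mu> (\<lambda>x. h x + t n x) \<le> nrm \<mu> h + nrm \<mu> (t n)"
      by (intro nrm_triangle sq)
    also have "nrm \<mu> h \<le> 2 * D"
      by (rule nrm_le_sup) (use hx h1D sq in \<open>auto simp: sq_int_measurable intro: order_trans\<close>)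
    also have "nrm \<mu> (\<lambda>x. c) \<le> 2 * (2 * D)"
      by (rule nrm_le_sup) (use h1D t1(1)[of n] in \<open>auto simp: c_def\<close>)
    finally show "nrm \<mu> e \<le> 6 * D + T / real N + \<delta>" using 1 tn[of n] by linarith
  qed
  have Q: "nrm \<mu> (\<lambda>x. rw x * chebU_part \<epsilon> {1..n} x) \<le> 2 * D + T" if n: "N \<le> n" for n
  proof (rule power2_le_imp_le)
    have "(\<Sum>k\<in>{1..N}. (fc \<epsilon> k)\<^sup>2) = (\<Sum>k\<in>Od. (fc \<epsilon> k)\<^sup>2)"
      unfolding Od_def by (rule sum.mono_neutral_right) (auto simp: fck)
    also have "\<dots> = (\<Sum>k\<in>Od. l\<^sup>2 * (1 / (real k)\<^sup>2))"
      by (intro sum.cong) (auto simp: fck Od_def power_divide)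
    also have "\<dots> = l\<^sup>2 * \<sigma>" by (simp add: \<sigma>_def sum_distrib_left)
    \<comment> \<open>Since \<open>\<sigma> \<ge> 1\<close>, the head energy
      \<open>l^2 \<sigma>\<close> is at most \<open>(l \<sigma>)^2\<close>, a multiple of the
      endpoint value \<open>h 1\<close> squared.\<close>
    also have "\<dots> \<le> l\<^sup>2 * (\<sigma> * \<sigma>)"
      using \<sigma> mult_left_mono[of 1 \<sigma> \<sigma>] by (intro mult_left_mono) auto
    also have "\<dots> = (pi / 2)\<^sup>2 * \<bar>h 1\<bar>\<^sup>2" by (simp add: h1 power2_eq_square)
    also have "\<dots> \<le> 2\<^sup>2 * D\<^sup>2"
      using pi_less_4 h1D by (intro mult_mono power_mono) auto
    finally have "(\<Sum>k\<in>{1..n}. (fc \<epsilon> k)\<^sup>2) \<le> 4 * D\<^sup>2 + T\<^sup>2"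
      using split[OF n, of "\<lambda>k. (fc \<epsilon> k)\<^sup>2"] tail[of n] by simp
    then have "2 / pi * (\<Sum>k\<in>{1..n}. (fc \<epsilon> k)\<^sup>2) \<le> 1 * (4 * D\<^sup>2 + T\<^sup>2)"
      using pi2 by (intro mult_mono sum_nonneg) auto
    then have "(nrm \<mu> (\<lambda>x. rw x * chebU_part \<epsilon> {1..n} x))\<^sup>2 \<le> 4 * D\<^sup>2 + T\<^sup>2"
      by (subst chebU_part_nrm) auto
    also have "\<dots> \<le> (2 * D + T)\<^sup>2" using D0 T by (simp add: power2_sum power_mult_distrib)
    finally show "(nrm \<mu> (\<lambda>x. rw x * chebU_part \<epsilon> {1..n} x))\<^sup>2 \<le> (2 * D + T)\<^sup>2" .
  qed (use D0 T in auto)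
  show "nrm \<mu> (\<lambda>x. rw x * \<epsilon> x) \<le> 2 * D + T"
  proof (rule field_le_epsilon)
    fix \<delta> :: real assume \<delta>: "\<delta> > 0"
    then obtain n0 where n0: "\<And>n. n \<ge> n0 \<Longrightarrow> nrm \<mu> (\<lambda>x. rw x * (\<epsilon> x - chebU_part \<epsilon> {1..n} x)) \<le> \<delta>"
      using energy_expansion[OF E \<delta>] by blast
    define n where "n = max n0 N"
    have s2: "sq_int \<mu> (\<lambda>x. rw x * chebU_part \<epsilon> {1..n} x)"
      by (intro continuous_sq_int_\<mu> continuous_parts continuous_intros continuous_rw)
    have "nrm \<mu> (\<lambda>x. rw x * \<epsilon> x) \<le> nrm \<mu> (\<lambda>x. rw x * \<epsilon> x - rw x * chebU_part \<epsilon> {1..n} x) + nrm \<mu> (\<lambda>x. rw x * chebU_part \<epsilon> {1..n} x)"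
      using nrm_triangle[OF sq_int_diff[OF s\<epsilon> s2] s2] by simp
    then show "nrm \<mu> (\<lambda>x. rw x * \<epsilon> x) \<le> 2 * D + T + \<delta>"
      using n0[of n] Q[of n] by (simp add: n_def right_diff_distrib)
  qed
qed

text \<open>Summation by parts with step 2; the relevant weights are \<open>w k = T\<^sub>k(\<plusminus>1)\<close>.\<close>
lemma alternating_abel_bound:
  fixes d w :: "nat \<Rightarrow> real"
  assumes w: "\<And>k. \<bar>w k\<bar> \<le> 1" "\<And>k. w (k + 2) = w k" and d: "\<And>k. N \<le> k \<Longrightarrow> \<bar>d k\<bar> \<le> D" and N: "1 \<le> N"
  shows "\<bar>\<Sum>k\<in>{N<..n}. w k * ((d (k - 1) - d (k + 1)) / 2) / real k\<bar> \<le> 2 * D / real N"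
proof (cases "N \<le> n")
  case True
  have D0: "0 \<le> D" using d[of N] by simp
  \<comment> \<open>Shifting the index by 2 leaves two boundary terms at each end, collected in
    \<open>b\<close>. The increments \<open>1 / (n+1) - 1 / (n+3)\<close> of the weights telescope
    to differences of \<open>r\<close>, and \<open>D * r\<close> also bounds
    \<open>b\<close>.\<close>
  define b where "b n = w (n + 1) * d n / (real n + 1) + w (n + 2) * d (n + 1) / (real n + 2)" for n
  define r where "r n = 1 / (real n + 1) + 1 / (real n + 2)" for n
  have wd: "\<bar>w j * d k / x\<bar> \<le> D * (1 / x)" if "N \<le> k" "x > 0" for j k x
  proof -
    have "\<bar>w j\<bar> * \<bar>d k\<bar> \<le> 1 * D" by (intro mult_mono w d that) auto
    then show ?thesis using that by (simp add: abs_mult divide_right_mono)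
  qed
  \<comment> \<open>Passing from n to n + 1 adds only \<open>- w (n+1) * d (n+2)\<close> times the
    increment of the weights; the periodicity of \<open>w\<close> cancels everything else against
    \<open>b\<close>.\<close>
  have "\<bar>(\<Sum>k\<in>{N<..n}. w k * (d (k - 1) - d (k + 1)) / real k) + b n - b N\<bar> \<le> D * (r N - r n)"
    using True
  proof (induction n rule: dec_induct)
    case base show ?case by simp
  next
    case (step n)
    define S where "S = (\<Sum>k\<in>{N<..n}. w k * (d (k - 1) - d (k + 1)) / real k) + b n - b N"
    define q where "q = 1 / (real n + 1) - 1 / (real n + 3)"
    have q: "q \<ge> 0" by (simp add: q_def frac_le)
    have "{N<..Suc n} = insert (Suc n) {N<..n}" using step by auto
    then have "(\<Sum>k\<in>{N<..Suc n}. w k * (d (k - 1) - d (k + 1)) / real k) + b (Suc n) - b N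
       = S + (w (Suc n) * (d n - d (n + 2)) / (real n + 1) + b (Suc n) - b n)"
      by (simp add: S_def add.commute)
    also have "w (Suc n) * (d n - d (n + 2)) / (real n + 1) + b (Suc n) - b n = - (w (n + 1) * d (n + 2) * q)"
      using w(2)[of "n + 1"]
      by (simp add: b_def q_def numeral_3_eq_3 algebra_simps diff_divide_distrib)
    finally have eq: "(\<Sum>k\<in>{N<..Suc n}. w k * (d (k - 1) - d (k + 1)) / real k) + b (Suc n) - b N
       = S - w (n + 1) * d (n + 2) * q" by simp
    have "\<bar>w (n + 1)\<bar> * \<bar>d (n + 2)\<bar> * \<bar>q\<bar> \<le> 1 * D * \<bar>q\<bar>" using step
      by (intro mult_right_mono mult_mono w d) auto
    then have "\<bar>w (n + 1) * d (n + 2) * q\<bar> \<le> D * q" using q by (simp add: abs_mult)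
    moreover have "\<bar>S\<bar> \<le> D * (r N - r n)" using step.IH by (simp add: S_def)
    moreover have "D * (r N - r (Suc n)) = D * (r N - r n) + D * q"
      by (simp add: r_def q_def algebra_simps)
    ultimately show ?case unfolding eq by linarith
  qed
  moreover have b: "\<bar>b j\<bar> \<le> D * r j" if "N \<le> j" for j
    unfolding b_def r_def distrib_left
    by (intro order_trans[OF abs_triangle_ineq] add_mono wd) (use that in auto)
  ultimately have "\<bar>\<Sum>k\<in>{N<..n}. w k * (d (k - 1) - d (k + 1)) / real k\<bar> \<le> 2 * (D * r N)"
    using b[OF True] b[OF order_refl] unfolding right_diff_distrib by linarith
  moreover have "D * r N \<le> D * (2 / real N)"
  proof (rule mult_left_mono[OF _ D0])
    have "1 / (real N + 1) \<le> 1 / real N" "1 / (real N + 2) \<le> 1 / real N"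
      using N by (auto intro!: divide_left_mono)
    then show "r N \<le> 2 / real N" by (simp add: r_def)
  qed
  moreover have "(\<Sum>k\<in>{N<..n}. w k * ((d (k - 1) - d (k + 1)) / 2) / real k)
      = (\<Sum>k\<in>{N<..n}. w k * (d (k - 1) - d (k + 1)) / real k) / 2"
    by (simp add: sum_divide_distrib mult.commute)
  ultimately show ?thesis by simp
qed (use d[of N] in simp)

subsection \<open>The discrete spaces\<close>

definition dphi :: "nat \<Rightarrow> real \<Rightarrow> real" where
  "dphi n x = real (n + 2) * chebU (n + 2) x - real n * chebU n x"

lemma DERIV_phi: "(phi n has_real_derivative dphi n x) (at x)"
  unfolding phi_def[abs_def] dphi_def by (intro DERIV_diff DERIV_cheb)

lemma polynomial_phi: "real_polynomial_function (phi n)" "real_polynomial_function (dphi n)"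
  unfolding phi_def[abs_def] dphi_def[abs_def]
  by (intro real_polynomial_function_diff real_polynomial_function.intros(2-) polynomial_cheb polynomial_chebU)+

lemma phi_endpoints: "phi n (-1) = 0" "phi n 1 = 0"
  by (simp_all only: phi_def cheb_one cheb_minus_one) (simp_all add: power_add)

lemma VN_elem:
  assumes "v \<in> VN N"
  obtains c where "real_polynomial_function v" "v (-1) = 0" "v 1 = 0"
    "real_polynomial_function (\<lambda>x. \<Sum>n\<le>N - 2. c n * dphi n x)"
    "\<And>x. (v has_real_derivative (\<Sum>n\<le>N - 2. c n * dphi n x)) (at x)"
proof -
  obtain c where v: "v = (\<lambda>x. \<Sum>n\<le>N - 2. c n * phi n x)" using assms by (auto simp: VN_def)
  show ?thesis
  proof (rule that[of c])
    show "real_polynomial_function v" "real_polynomial_function (\<lambda>x. \<Sum>n\<le>N - 2. c n * dphi n x)"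
      unfolding v by (intro real_polynomial_function_sum real_polynomial_function.intros(2-) polynomial_phi finite_atMost)+
    show "v (-1) = 0" "v 1 = 0" by (simp_all add: v phi_endpoints)
    show "(v has_real_derivative (\<Sum>n\<le>N - 2. c n * dphi n x)) (at x)" for x
      unfolding v by (intro DERIV_sum DERIV_cmult DERIV_phi)
  qed
qed

lemma VN_subset_V: "VN N \<subseteq> V"
  by (auto elim!: VN_elem intro: polynomial_in_V)

lemma phi_in_VN:
  assumes "n \<le> N - 2" shows "phi n \<in> VN N"
proof -
  have "phi n x = (\<Sum>i\<le>N - 2. (if i = n then 1 else 0) * phi i x)" for x
  proof -
    have "(\<Sum>i\<le>N - 2. (if i = n then 1 else 0) * phi i x) = (\<Sum>i\<le>N - 2. if i = n then phi i x else 0)"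
      by (intro sum.cong) auto
    also have "\<dots> = phi n x" by (subst sum.delta) (use assms in auto)
    finally show ?thesis by (rule sym)
  qed
  then have "phi n = (\<lambda>x. \<Sum>i\<le>N - 2. (if i = n then 1 else 0) * phi i x)" by (rule ext)
  then show ?thesis unfolding VN_def by (intro CollectI exI[of _ "\<lambda>i. if i = n then 1 else 0"])
qed

lemma polynomial_weak_deriv:
  assumes "real_polynomial_function p" "real_polynomial_function p'" "\<And>x. (p has_real_derivative p' x) (at x)"
  shows "weak_deriv p p'"
  by (rule weak_deriv_classical) (auto intro: polynomial_continuous assms)

lemma rw_polynomial_sq_int: "real_polynomial_function p \<Longrightarrow> sq_int \<mu> (\<lambda>x. rw x * p x)"
  by (intro continuous_sq_int_\<mu> continuous_intros continuous_rw polynomial_continuous)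

lemma a_eq_rw:
  assumes "weak_deriv u g" "weak_deriv v h"
  shows "a u v = (\<integral>x. (rw x * g x) * (rw x * h x) \<partial>\<mu>)"
  unfolding a_eq[OF assms]
  by (intro Bochner_Integration.integral_cong refl) (simp add: rw_square(1)[symmetric])

lemma fc_diff:
  assumes "sq_int \<mu> (\<lambda>x. rw x * f x)" "sq_int \<mu> (\<lambda>x. rw x * h x)"
  shows "fc (\<lambda>x. f x - h x) k = fc f k - fc h k"
  using sq_int_mult[OF assms(1) chebU_sq_int[of k]] sq_int_mult[OF assms(2) chebU_sq_int[of k]]
  by (simp add: fc_def right_diff_distrib left_diff_distrib)

text \<open>Turns testing with \<open>phi n\<close> into a two-term relation between sine
  coefficients; for \<open>n = 0\<close> the second term disappears.\<close>

lemma integral_dphi: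
  assumes "sq_int \<mu> (\<lambda>x. rw x * f x)"
  shows "(\<integral>x. (rw x * f x) * (rw x * dphi n x) \<partial>\<mu>) = real (n + 2) * fc f (n + 2) - real n * fc f n"
proof -
  have "(\<integral>x. (rw x * f x) * (rw x * dphi n x) \<partial>\<mu>) =
     (\<integral>x. real (n + 2) * ((rw x * f x) * (rw x * chebU (n + 2) x)) - real n * ((rw x * f x) * (rw x * chebU n x)) \<partial>\<mu>)"
    unfolding dphi_def by (intro Bochner_Integration.integral_cong refl) (simp only: right_diff_distrib ac_simps)
  also have "\<dots> = real (n + 2) * fc f (n + 2) - real n * fc f n"
    unfolding fc_def
    by (subst Bochner_Integration.integral_diff)
       (intro integrable_mult_right sq_int_mult assms chebU_sq_int | simp only: integral_mult_right_zero)+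
  finally show ?thesis .
qed

text \<open>Only \<open>chebU\<close> of index at most \<open>N - 2 + 2 = N\<close> occur, and
  \<open>chebU k\<close> is orthogonal to them. So beyond N the error has exactly the coefficients
  of the solution.\<close>

lemma fc_VN_deriv:
  assumes N: "2 \<le> N" and k: "N < k"
  shows "fc (\<lambda>x. \<Sum>n\<le>N - 2. c n * dphi n x) k = 0"
proof -
  have 0: "fc (chebU k) j = 0" if "j < k" for j
  proof (cases "j = 0")
    case True then show ?thesis by (simp add: fc_def)
  next
    case False then show ?thesis unfolding fc_def using that rw_chebU_orthogonal[of k j] by simp
  qed
  have "fc (\<lambda>x. \<Sum>n\<le>N - 2. c n * dphi n x) k
     = (\<integral>x. (\<Sum>n\<le>N - 2. c n * ((rw x * chebU k x) * (rw x * dphi n x))) \<partial>\<mu>)"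
    unfolding fc_def by (intro Bochner_Integration.integral_cong refl) (simp add: sum_distrib_left sum_distrib_right ac_simps)
  also have "\<dots> = (\<Sum>n\<le>N - 2. (\<integral>x. c n * ((rw x * chebU k x) * (rw x * dphi n x)) \<partial>\<mu>))"
    by (intro Bochner_Integration.integral_sum integrable_mult_right sq_int_mult chebU_sq_int rw_polynomial_sq_int polynomial_phi)
  also have "\<dots> = (\<Sum>n\<le>N - 2. c n * (real (n + 2) * fc (chebU k) (n + 2) - real n * fc (chebU k) n))"
    unfolding integral_mult_right_zero integral_dphi[OF chebU_sq_int] ..
  also have "\<dots> = 0" by (intro sum.neutral ballI) (use N k in \<open>simp add: 0\<close>)
  finally show ?thesis .
qed

lemma energy_approx_diff_polynomial:
  assumes u: "u \<in> V" "weak_deriv u g" "sq_int \<mu> g"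
    and q: "real_polynomial_function q" "real_polynomial_function q'"
      "\<And>x. (q has_real_derivative q' x) (at x)" "q (-1) = 0" "q 1 = 0"
  shows "energy_approx (\<lambda>x. u x - q x) (\<lambda>x. g x - q' x)"
  unfolding energy_approx_def
proof (intro conjI allI impI)
  have sq: "sq_int \<mu> q" "sq_int \<mu> q'"
    by (intro continuous_sq_int_\<mu> polynomial_continuous q)+
  have su: "sq_int \<mu> u" using u by (simp add: V_def L2_eq)
  show "sq_int \<mu> (\<lambda>x. u x - q x)" "sq_int \<mu> (\<lambda>x. rw x * (g x - q' x))" "(\<lambda>x. g x - q' x) \<in> borel_measurable \<mu>"
    by (intro sq_int_diff rw_sq_int sq_int_measurable su u sq)+
  fix \<delta> :: real assume "\<delta> > 0"
  then obtain p p' where p: "real_polynomial_function p" "real_polynomial_function p'"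
    "\<And>x. (p has_real_derivative p' x) (at x)" "p (-1) = 0" "p 1 = 0"
    "nrm \<mu> (\<lambda>x. u x - p x) \<le> \<delta>" "nrm \<mu> (\<lambda>x. rw x * (g x - p' x)) \<le> \<delta>"
    using V_polynomial_approx[OF u(1,2)] by blast
  show "\<exists>p p'. real_polynomial_function p \<and> real_polynomial_function p' \<and>
      (\<forall>x. (p has_real_derivative p' x) (at x)) \<and> p (-1) = 0 \<and> p 1 = 0 \<and>
      nrm \<mu> (\<lambda>x. (u x - q x) - p x) \<le> \<delta> \<and> nrm \<mu> (\<lambda>x. rw x * ((g x - q' x) - p' x)) \<le> \<delta>"
  proof (intro exI conjI allI)
    show "real_polynomial_function (\<lambda>x. p x - q x)" "real_polynomial_function (\<lambda>x. p' x - q' x)"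
      by (intro real_polynomial_function_diff p q)+
    show "((\<lambda>x. p x - q x) has_real_derivative p' x - q' x) (at x)" for x
      by (intro DERIV_diff p q)
    show "p (-1) - q (-1) = 0" "p 1 - q 1 = 0" using p q by auto
    show "nrm \<mu> (\<lambda>x. (u x - q x) - (p x - q x)) \<le> \<delta>" using p(6) by simp
    show "nrm \<mu> (\<lambda>x. rw x * ((g x - q' x) - (p' x - q' x))) \<le> \<delta>" using p(7) by simp
  qed
qed

text \<open>Supplies the three inputs of \<open>Galerkin_error\<close>: the head from Galerkin
  orthogonality, the tail from the decay of the coefficients of \<open>g 1\<close>, and the endpoint
  sums from a pointwise bound on those of \<open>g 2\<close>. The last is why two weak derivatives,
  \<open>2 \<le> m\<close>, are required.\<close>

lemma Galerkin_estimate: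
  fixes g :: "nat \<Rightarrow> real \<Rightarrow> real"
  assumes m: "2 \<le> m" and w: "\<And>j. j < m \<Longrightarrow> weak_deriv (g j) (g (Suc j))" and s: "\<And>j. j \<le> m \<Longrightarrow> sq_int \<mu> (g j)"
    and H: "\<And>j. j \<le> m \<Longrightarrow> nrm \<mu> (g j) \<le> H"
    and u: "g 0 \<in> V" "\<forall>v\<in>V. a (g 0) v = pairing f v"
    and N: "2 \<le> N" and uN: "uN \<in> VN N" "\<forall>v\<in>VN N. a uN v = pairing f v"
    and A: "A = 2 * (4 ^ (m * m) + real m ^ (2 * m))"
  shows "V_norm (\<lambda>x. g 0 x - uN x) \<le> (6 * 2 ^ m + 1) * sqrt A * H / real N ^ (m - 1)"
    "L2_norm (\<lambda>x. g 0 x - uN x) \<le> (6 * 2 ^ m + 1) * sqrt A * H / real N ^ m"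
proof -
  obtain c where q: "real_polynomial_function uN" "uN (-1) = 0" "uN 1 = 0"
    "real_polynomial_function (\<lambda>x. \<Sum>n\<le>N - 2. c n * dphi n x)"
    "\<And>x. (uN has_real_derivative (\<Sum>n\<le>N - 2. c n * dphi n x)) (at x)"
    using VN_elem[OF uN(1)] by blast
  define q' where "q' x = (\<Sum>n\<le>N - 2. c n * dphi n x)" for x
  note q = q[folded q'_def]
  define \<epsilon> where "\<epsilon> x = g 1 x - q' x" for x
  have wg: "weak_deriv (g 0) (g 1)" and sg: "sq_int \<mu> (g 1)" using w[of 0] s[of 1] m by auto
  have wN: "weak_deriv uN q'" by (rule polynomial_weak_deriv[OF q(1,4,5)])
  have we: "weak_deriv (\<lambda>x. g 0 x - uN x) \<epsilon>" unfolding \<epsilon>_def by (rule weak_deriv_diff[OF wg wN])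
  have E: "energy_approx (\<lambda>x. g 0 x - uN x) \<epsilon>"
    unfolding \<epsilon>_def by (rule energy_approx_diff_polynomial) (use u wg sg q in auto)
  have s\<epsilon>: "sq_int \<mu> (\<lambda>x. rw x * \<epsilon> x)" using E by (simp add: energy_approx_def)
  have srw: "sq_int \<mu> (\<lambda>x. rw x * g 1 x)" "sq_int \<mu> (\<lambda>x. rw x * q' x)"
    by (intro rw_sq_int sg, intro rw_polynomial_sq_int q)
  have m1: "m - 1 = Suc (m - 2)" and m0: "m = Suc (m - 1)" using m by auto
  have H0: "0 \<le> H" using order_trans[OF nrm_nonneg H[of 0]] by simp
  have A0: "0 \<le> A" unfolding A by simp
  have rec: "real (n + 2) * fc \<epsilon> (n + 2) = real n * fc \<epsilon> n" if n: "n \<le> N - 2" for n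
  proof -
    have wphi: "weak_deriv (phi n) (dphi n)" by (rule polynomial_weak_deriv[OF polynomial_phi DERIV_phi])
    have "a (g 0) (phi n) = a uN (phi n)"
      using u(2) uN(2) phi_in_VN[OF n] VN_subset_V by (metis subsetD)
    then have "(\<integral>x. (rw x * g 1 x) * (rw x * dphi n x) \<partial>\<mu>) = (\<integral>x. (rw x * q' x) * (rw x * dphi n x) \<partial>\<mu>)"
      unfolding a_eq_rw[OF wg wphi] a_eq_rw[OF wN wphi] .
    then have "real (n + 2) * fc (g 1) (n + 2) - real n * fc (g 1) n = real (n + 2) * fc q' (n + 2) - real n * fc q' n"
      unfolding integral_dphi[OF srw(1)] integral_dphi[OF srw(2)] .
    moreover have "fc \<epsilon> k = fc (g 1) k - fc q' k" for k
      unfolding \<epsilon>_def by (rule fc_diff[OF srw])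
    ultimately show ?thesis by (simp only: right_diff_distrib)
  qed
  \<comment> \<open>Descent by steps of 2: even indices end at \<open>k = 2\<close>, where
    \<open>rec\<close> with \<open>n = 0\<close> gives zero, and odd ones at the unconstrained
    coefficient \<open>fc \<epsilon> 1\<close>.\<close>
  have head: "real k * fc \<epsilon> k = (if odd k then fc \<epsilon> 1 else 0)" if "1 \<le> k" "k \<le> N" for k
    using that
  proof (induction k rule: less_induct)
    case (less k)
    consider "k = 1" | "k = 2" | "k \<ge> 3" using less.prems by linarith
    then show ?case
    proof cases
      case 2 then show ?thesis using rec[of 0] by (simp add: numeral_2_eq_2)
    next
      case 3
      then have "k - 2 + 2 = k" "k - 2 \<le> N - 2" using less.prems by auto
      then have "real k * fc \<epsilon> k = real (k - 2) * fc \<epsilon> (k - 2)"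
        using rec[of "k - 2"] by (simp only:)
      also have "\<dots> = (if odd (k - 2) then fc \<epsilon> 1 else 0)"
        by (rule less.IH) (use 3 less.prems in auto)
      finally show ?thesis using 3 by simp
    qed simp
  qed
  have high: "fc \<epsilon> k = fc (g 1) k" if "N < k" for k
    using fc_diff[OF srw, of k] fc_VN_deriv[OF N that, of c] by (simp add: \<epsilon>_def[abs_def] q'_def[abs_def])
  define T where "T = sqrt A * H / real N ^ (m - 1)"
  have T0: "0 \<le> T" using H0 A0 by (simp add: T_def)
  have tail: "(\<Sum>k\<in>{N<..n}. (fc \<epsilon> k)\<^sup>2) \<le> T\<^sup>2" for n
  proof -
    have "(\<Sum>k\<in>{N<..n}. (fc \<epsilon> k)\<^sup>2) = (\<Sum>k\<in>{N<..n}. (fc (g (m - (m - 1))) k)\<^sup>2)"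
      using m by (intro sum.cong) (auto simp: high)
    also have "\<dots> \<le> A * H\<^sup>2 / real N ^ (2 * (m - 1))"
      unfolding A by (rule fc_tail) (use N m w s H in auto)
    also have "\<dots> = T\<^sup>2"
      using A0 by (simp add: T_def power_divide power_mult_distrib power_mult[symmetric] mult.commute)
    finally show ?thesis .
  qed
  define d where "d k = fc (g 2) k / real k" for k
  define D0 where "D0 = sqrt A * H * 2 ^ (m - 2) / real N ^ (m - 1)"
  \<comment> \<open>A single coefficient is bounded by a tail sum containing it. As
    \<open>k = N\<close> must be covered, the tail starts after \<open>N - 1 \<ge> N / 2\<close>,
    whence the factor \<open>2 ^ (m - 2)\<close>.\<close>
  have d: "\<bar>d k\<bar> \<le> D0" if k: "N \<le> k" for k
  proof -
    have "(fc (g 2) k)\<^sup>2 \<le> (\<Sum>j\<in>{N-1<..k}. (fc (g 2) j)\<^sup>2)"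
      by (rule member_le_sum) (use N k in auto)
    also have "\<dots> = (\<Sum>j\<in>{N-1<..k}. (fc (g (m - (m - 2))) j)\<^sup>2)" using m by simp
    also have "\<dots> \<le> A * H\<^sup>2 / real (N - 1) ^ (2 * (m - 2))"
      unfolding A by (rule fc_tail) (use N m w s H in auto)
    also have "\<dots> \<le> A * H\<^sup>2 / (real N / 2) ^ (2 * (m - 2))"
      using N A0 by (intro divide_left_mono power_mono mult_pos_pos zero_less_power) auto
    also have "\<dots> = (sqrt A * H / (real N / 2) ^ (m - 2))\<^sup>2"
      using A0 by (simp add: power_divide power_mult_distrib power_mult[symmetric] mult.commute)
    finally have "\<bar>fc (g 2) k\<bar> \<le> sqrt A * H / (real N / 2) ^ (m - 2)"
      by (rule power2_le_iff_abs_le[THEN iffD1, rotated]) (use A0 H0 in auto)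
    then have "\<bar>d k\<bar> \<le> (sqrt A * H / (real N / 2) ^ (m - 2)) / real N"
      unfolding d_def abs_divide using k N A0 H0 by (intro frac_le) auto
    also have "\<dots> = D0"
    proof -
      have "real N ^ (m - 1) = real N ^ (m - 2) * real N" unfolding m1 by (rule power_Suc2)
      then show ?thesis by (simp add: D0_def power_divide)
    qed
    finally show ?thesis .
  qed
  \<comment> \<open>The bound of \<open>alternating_abel_bound\<close>; with \<open>D0\<close> of
    order \<open>N^(1-m)\<close> it is of order \<open>N^(-m)\<close>, the full rate needed in
    \<open>L^2\<close>.\<close>
  define D where "D = 2 * D0 / real N"
  have fcd: "fc \<epsilon> k = (d (k - 1) - d (k + 1)) / 2" if "N < k" for k
    unfolding high[OF that] d_def
    by (rule fc_weak_deriv) (use w[of 1] s[of 1] s[of 2] m N that in \<open>auto simp: numeral_2_eq_2\<close>)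
  have ends: "\<bar>\<Sum>k\<in>{N<..n}. fc \<epsilon> k / real k\<bar> \<le> D" "\<bar>\<Sum>k\<in>{N<..n}. (-1)^k * fc \<epsilon> k / real k\<bar> \<le> D" for n
  proof -
    have *: "\<bar>\<Sum>k\<in>{N<..n}. v k * fc \<epsilon> k / real k\<bar> \<le> D" if "\<And>k. \<bar>v k\<bar> \<le> 1" "\<And>k. v (k + 2) = v k" for v
    proof -
      have "(\<Sum>k\<in>{N<..n}. v k * fc \<epsilon> k / real k) = (\<Sum>k\<in>{N<..n}. v k * ((d (k - 1) - d (k + 1)) / 2) / real k)"
        by (intro sum.cong refl) (simp only: fcd greaterThanAtMost_iff)
      then show ?thesis
        unfolding D_def using alternating_abel_bound[of v N d D0 n] that d N by simp
    qed
    show "\<bar>\<Sum>k\<in>{N<..n}. fc \<epsilon> k / real k\<bar> \<le> D" using *[of "\<lambda>_. 1"] by simp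
    show "\<bar>\<Sum>k\<in>{N<..n}. (-1)^k * fc \<epsilon> k / real k\<bar> \<le> D" by (rule *) auto
  qed
  note est = Galerkin_error[OF E _ head tail T0 ends]
  have N1: "1 \<le> N" using N by simp
  have Nm: "real N ^ m = real N ^ (m - 1) * real N" by (subst m0) (rule power_Suc2)
  have D_eq: "D = 2 ^ (m - 1) * (sqrt A * H) / real N ^ m"
  proof -
    have "(2::real) ^ (m - 1) = 2 ^ (m - 2) * 2" unfolding m1 by (rule power_Suc2)
    then show ?thesis by (simp add: D_def D0_def Nm)
  qed
  define X where "X = sqrt A * H"
  have X0: "0 \<le> X" using A0 H0 by (simp add: X_def)
  have pm: "(2::real) ^ m = 2 * 2 ^ (m - 1)" by (subst m0) (rule power_Suc)
  show "V_norm (\<lambda>x. g 0 x - uN x) \<le> (6 * 2 ^ m + 1) * sqrt A * H / real N ^ (m - 1)"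
  proof -
    have "V_norm (\<lambda>x. g 0 x - uN x) \<le> 2 * D + T"
      unfolding V_norm_eq[OF we] by (rule est(1)) (use N1 in auto)
    \<comment> \<open>In the energy norm the tail \<open>T\<close> of order \<open>N^(1-m)\<close>
      sets the rate, so one power of N may be given away here.\<close>
    also have "D \<le> 2 ^ (m - 1) * X / real N ^ (m - 1)"
      unfolding D_eq X_def[symmetric] using X0 N m by (intro divide_left_mono power_increasing) auto
    also have "2 * (2 ^ (m - 1) * X / real N ^ (m - 1)) + T = (2 ^ m + 1) * X / real N ^ (m - 1)"
      unfolding T_def X_def[symmetric] pm by (simp add: add_divide_distrib distrib_right)
    \<comment> \<open>Rounded up so that one constant serves both norms; the \<open>L^2\<close>
      bound arrives with \<open>3 * 2 ^ m + 1\<close>.\<close>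
    also have "\<dots> \<le> (6 * 2 ^ m + 1) * X / real N ^ (m - 1)"
      using X0 by (intro divide_right_mono mult_right_mono) auto
    finally show ?thesis by (simp add: X_def mult.assoc)
  qed
  show "L2_norm (\<lambda>x. g 0 x - uN x) \<le> (6 * 2 ^ m + 1) * sqrt A * H / real N ^ m"
  proof -
    have "L2_norm (\<lambda>x. g 0 x - uN x) \<le> 6 * D + T / real N"
      unfolding L2_norm_eq by (rule est(2)) (use N1 in auto)
    also have "\<dots> = (3 * 2 ^ m + 1) * X / real N ^ m"
      unfolding D_eq T_def X_def[symmetric] pm Nm by (simp add: add_divide_distrib distrib_right)
    also have "\<dots> \<le> (6 * 2 ^ m + 1) * X / real N ^ m"
      using X0 by (intro divide_right_mono mult_right_mono) auto
    finally show ?thesis by (simp add: X_def mult.assoc)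
  qed
qed

theorem mainTheorem4:
  fixes m :: nat
  assumes "m \<ge> 2"
  shows "\<exists>C :: real. \<forall>(f :: real \<Rightarrow> real) (u :: real \<Rightarrow> real) (N :: nat) (uN :: real \<Rightarrow> real).
           L2 f \<longrightarrow> u \<in> V \<longrightarrow> (\<forall>v\<in>V. a u v = pairing f v) \<longrightarrow> u \<in> Hm m \<longrightarrow>
           N \<ge> 2 \<longrightarrow> uN \<in> VN N \<longrightarrow> (\<forall>v\<in>VN N. a uN v = pairing f v) \<longrightarrow>
           V_norm (\<lambda>x. u x - uN x) \<le> C * real N powr (1 - real m) * Hm_norm m u \<and>
           L2_norm (\<lambda>x. u x - uN x) \<le> C * real N powr (- real m) * Hm_norm m u"
proof -
  define A where "A = 2 * (4 ^ (m * m) + real m ^ (2 * m))"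
  show ?thesis
  proof (intro exI[of _ "(6 * 2 ^ m + 1) * sqrt A"] allI impI)
    fix f u uN :: "real \<Rightarrow> real" and N :: nat
    assume *: "u \<in> V" "\<forall>v\<in>V. a u v = pairing f v" "u \<in> Hm m" "N \<ge> 2" "uN \<in> VN N"
      "\<forall>v\<in>VN N. a uN v = pairing f v"
    define g where "g j = (wderiv ^^ j) u" for j
    have s: "sq_int \<mu> (g j)" if "j \<le> m" for j
      using *(3) that by (simp add: Hm_def g_def L2_eq)
    have w: "weak_deriv (g j) (g (Suc j))" if "j < m" for j
      using *(3) that weak_deriv_wderiv[of "g j"] by (simp add: Hm_def g_def)
    have H: "nrm \<mu> (g j) \<le> Hm_norm m u" if "j \<le> m" for j
      unfolding Hm_norm_def nrm_def intI_eq g_def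
      by (intro real_sqrt_le_mono member_le_sum) (use that in \<open>auto intro: integral_nonneg_AE\<close>)
    have g0: "g 0 = u" by (simp add: g_def)
    have G0: "g 0 \<in> V" "\<forall>v\<in>V. a (g 0) v = pairing f v" unfolding g0 by (rule *)+
    have p1: "real N powr (1 - real m) = 1 / real N ^ (m - 1)"
    proof -
      have "real N powr (1 - real m) = real N powr (- real (m - 1))" using assms by (simp add: of_nat_diff)
      also have "\<dots> = 1 / real N ^ (m - 1)" using *(4) by (simp add: powr_minus powr_realpow inverse_eq_divide del: of_nat_diff)
      finally show ?thesis .
    qed
    have p2: "real N powr (- real m) = 1 / real N ^ m"
      using *(4) by (simp add: powr_minus powr_realpow inverse_eq_divide)
    show "V_norm (\<lambda>x. u x - uN x) \<le> (6 * 2 ^ m + 1) * sqrt A * real N powr (1 - real m) * Hm_norm m u \<and>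
          L2_norm (\<lambda>x. u x - uN x) \<le> (6 * 2 ^ m + 1) * sqrt A * real N powr (- real m) * Hm_norm m u"
      using Galerkin_estimate[where g=g, OF assms w s H G0 *(4,5,6) A_def] unfolding p1 p2 g0 by simp
  qed
qed

end
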